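(* (Gauge-Invariant Uniqueness Theorem) Let $(\mathcal G,\Lambda)$ be a self-similar action of a groupoid on a row-finite $k$-graph with no sources, and let $c\colon(\mathcal G\bowtie\Lambda)^2\to\mathbb T$ be a normalised categorical $2$-cocycle. Let $S$ be a Cuntz–Krieger $(\mathcal G,\Lambda;c)$-family in a $C^*$-algebra $A$, and let $\pi^S\colon C^*(\mathcal G,\Lambda;c)\to C^*(S)$ be the homomorphism given by the universal property ($\pi^S(s_\zeta)=S_\zeta$). If there is a strongly continuous action $\beta\colon\mathbb T^k\to\mathrm{Aut}(A)$ such that $\beta_z(S_\zeta)=z^{d(\zeta)}S_\zeta$ for all $\zeta\in\mathcal G\bowtie\Lambda$ and $z\in\mathbb T^k$, and if $\pi^S$ is injective on $\iota^s_{\mathcal G}(C^*(\mathcal G,c))$, then $\pi^S$ is injective.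
   Context: A small category is identified with its set of morphisms; superscript $0$ denotes its identities (objects), $r,s$ codomain and domain, superscript $2$ its composable pairs. All groupoids are countable and discrete. A $k$-graph is a countable category $\Lambda$ with a functor $d\colon\Lambda\to\mathbb N^k$ such that whenever $d(\lambda)=m+n$ there are unique $\mu,\nu\in\Lambda$ with $\lambda=\mu\nu$, $d(\mu)=m$, $d(\nu)=n$. $\Lambda^n=d^{-1}(n)$, $v\Lambda^n=\{\lambda\in\Lambda^n:r(\lambda)=v\}$. $\Lambda$ is row-finite with no sources if $0<|v\Lambda^n|<\infty$ for all $v\in\Lambda^0,n\in\mathbb N^k$. $\mathrm{MCE}(\mu,\nu)=\mu\Lambda\cap\nu\Lambda\cap\Lambda^{d(\mu)\vee d(\nu)}$. A self-similar action of a groupoid $\mathcal G$ on a $k$-graph $\Lambda$ with $\mathcal G^0=\Lambda^0$ consists of a left action $\triangleright$ of $\mathcal G$ on $\Lambda$ and a right action $\triangleleft$ of $\Lambda$ on $\mathcal G$, both defined on $\mathcal G*\Lambda=\{(g,\lambda):s(g)=r(\lambda)\}$ with values in $\Lambda$, $\mathcal G$ respectively: $r(\lambda)\triangleright\lambda=\lambda$, $r(g\triangleright\lambda)=r(g)$, $(gh)\triangleright\lambda=g\triangleright(h\triangleright\lambda)$, $g\triangleright s(g)=r(g)$; $g\triangleleft s(g)=g$, $s(g\triangleleft\lambda)=s(\lambda)$, $g\triangleleft(\lambda\mu)=(g\triangleleft\lambda)\triangleleft\mu$, $r(\lambda)\triangleleft\lambda=s(\lambda)$; such that $s(g\triangleright\lambda)=r(g\triangleleft\lambda)$,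 $g\triangleright(\lambda\mu)=(g\triangleright\lambda)((g\triangleleft\lambda)\triangleright\mu)$, $(gh)\triangleleft\lambda=(g\triangleleft(h\triangleright\lambda))(h\triangleleft\lambda)$, and $d(g\triangleright\lambda)=d(\lambda)$. $\mathcal G\bowtie\Lambda$ is the category with morphisms $\lambda g:=(\lambda,g)$, $s(\lambda)=r(g)$; $r(\lambda g)=r(\lambda)$, $s(\lambda g)=s(g)$; $(\lambda g)(\mu h)=\lambda(g\triangleright\mu)\,(g\triangleleft\mu)h$; $\mathcal G,\Lambda$ are regarded as subcategories ($g=r(g)g$, $\lambda=\lambda s(\lambda)$). The degree functor on $\mathcal G\bowtie\Lambda$ is $d(\lambda g)=d(\lambda)$. A normalised categorical $2$-cocycle on a category $\mathcal E$ is $c\colon\mathcal E^2\to\mathbb T$ with $c(\zeta,\eta)c(\zeta\eta,\theta)=c(\eta,\theta)c(\zeta,\eta\theta)$ and $c(\zeta,\eta)=1$ if $\zeta$ or $\eta$ is an identity; its restriction to $\mathcal G^2$ is still written $c$. A Cuntz–Krieger $(\mathcal G,\Lambda;c)$-family in a $C^*$-algebra $A$ is a map $t\colon\mathcal G\bowtie\Lambda\to A$ with (TCK1) $t_\zeta t_\eta=c(\zeta,\eta)t_{\zeta\eta}$ if $s(\zeta)=r(\eta)$ and $t_\zeta t_\eta=0$ otherwise; (TCK2) $t_\zeta^*t_\zeta=t_{s(\zeta)}$; (TCK3) $t_\mu t_\mu^*t_\nu t_\nu^*=\sum_{\lambda\in\mathrm{MCE}(\mu,\nu)}t_\lambda t_\lambda^*$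 for $\mu,\nu\in\Lambda$; (CK) $t_v=\sum_{\lambda\in v\Lambda^n}t_\lambda t_\lambda^*$ for all $v\in\Lambda^0,n\in\mathbb N^k$. $C^*(t)$ is the $C^*$-subalgebra generated by the $t_\zeta$. $C^*(\mathcal G,\Lambda;c)$ is the $C^*$-algebra generated by a universal such family $s$. $C^*(\mathcal G,c)$ is the full twisted groupoid $C^*$-algebra, universal for unitary representations $w$ of $(\mathcal G,c)$ ($w_gw_h=c(g,h)w_{gh}$ if $s(g)=r(h)$ and $0$ otherwise, $w_g^*=\overline{c(g,g^{-1})}w_{g^{-1}}$), and $\iota^s_{\mathcal G}\colon C^*(\mathcal G,c)\to C^*(\mathcal G,\Lambda;c)$ is the homomorphism with $w_g\mapsto s_g$. *)

theory Defs
  imports "HOL-Analysis.Analysis" "HOL-Algebra.Module"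
begin

section \<open>C*-algebras\<close>

text \<open>
  C*-algebras are carrier-based, on top of the module records of HOL-Algebra. They need not be
  unital: the field \<open>one\<close> inherited from the ring record carries no meaning and is never used.
\<close>

definition complex_ring :: "complex ring" where
  "complex_ring = \<lparr>carrier = UNIV, mult = (*), one = 1, zero = 0, add = (+)\<rparr>"

record 'a cstar = "(complex, 'a) module" +
  adj :: "'a \<Rightarrow> 'a"
  nrm :: "'a \<Rightarrow> real"

text \<open>
  The value \<open>0\<close> outside the carrier is irrelevant; it is there because \<^locale>\<open>Metric_space\<close> asks
  for nonnegativity and symmetry on the whole type.
\<close>

definition cdist :: "('a, 'z) cstar_scheme \<Rightarrow> 'a \<Rightarrow> 'a \<Rightarrow> real" where
  "cdist A x y = (if x \<in> carrier A \<and> y \<in> carrier A then nrm A (x \<ominus>\<^bsub>A\<^esub> y) else 0)"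

definition ctopology :: "('a, 'z) cstar_scheme \<Rightarrow> 'a topology" where
  "ctopology A = Metric_space.mtopology (carrier A) (cdist A)"

locale cstar_algebra = Module.module complex_ring A
  for A :: "('a, 'z) cstar_scheme" (structure) +
  assumes mult_closed: "\<lbrakk>x \<in> carrier A; y \<in> carrier A\<rbrakk> \<Longrightarrow> x \<otimes> y \<in> carrier A"
    and mult_assoc: "\<lbrakk>x \<in> carrier A; y \<in> carrier A; z \<in> carrier A\<rbrakk> \<Longrightarrow>
          (x \<otimes> y) \<otimes> z = x \<otimes> (y \<otimes> z)"
    and mult_l_distr: "\<lbrakk>x \<in> carrier A; y \<in> carrier A; z \<in> carrier A\<rbrakk> \<Longrightarrow>
          (x \<oplus> y) \<otimes> z = x \<otimes> z \<oplus> y \<otimes> z"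
    and mult_r_distr: "\<lbrakk>x \<in> carrier A; y \<in> carrier A; z \<in> carrier A\<rbrakk> \<Longrightarrow>
          z \<otimes> (x \<oplus> y) = z \<otimes> x \<oplus> z \<otimes> y"
    and smult_mult_l: "\<lbrakk>x \<in> carrier A; y \<in> carrier A\<rbrakk> \<Longrightarrow> (a \<odot> x) \<otimes> y = a \<odot> (x \<otimes> y)"
    and smult_mult_r: "\<lbrakk>x \<in> carrier A; y \<in> carrier A\<rbrakk> \<Longrightarrow> x \<otimes> (a \<odot> y) = a \<odot> (x \<otimes> y)"
    and adj_closed: "x \<in> carrier A \<Longrightarrow> adj A x \<in> carrier A"
    and adj_add: "\<lbrakk>x \<in> carrier A; y \<in> carrier A\<rbrakk> \<Longrightarrow> adj A (x \<oplus> y) = adj A x \<oplus> adj A y"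
    and adj_smult: "x \<in> carrier A \<Longrightarrow> adj A (a \<odot> x) = cnj a \<odot> adj A x"
    and adj_mult: "\<lbrakk>x \<in> carrier A; y \<in> carrier A\<rbrakk> \<Longrightarrow> adj A (x \<otimes> y) = adj A y \<otimes> adj A x"
    and adj_adj: "x \<in> carrier A \<Longrightarrow> adj A (adj A x) = x"
    and nrm_nonneg: "x \<in> carrier A \<Longrightarrow> 0 \<le> nrm A x"
    and nrm_eq_0: "x \<in> carrier A \<Longrightarrow> nrm A x = 0 \<longleftrightarrow> x = \<zero>"
    and nrm_triangle: "\<lbrakk>x \<in> carrier A; y \<in> carrier A\<rbrakk> \<Longrightarrow> nrm A (x \<oplus> y) \<le> nrm A x + nrm A y"
    and nrm_smult: "x \<in> carrier A \<Longrightarrow> nrm A (a \<odot> x) = cmod a * nrm A x"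
    and nrm_mult: "\<lbrakk>x \<in> carrier A; y \<in> carrier A\<rbrakk> \<Longrightarrow> nrm A (x \<otimes> y) \<le> nrm A x * nrm A y"
    and nrm_cstar: "x \<in> carrier A \<Longrightarrow> nrm A (adj A x \<otimes> x) = (nrm A x)\<^sup>2"
    and complete: "Metric_space.mcomplete (carrier A) (cdist A)"

definition star_hom ::
  "('a, 'y) cstar_scheme \<Rightarrow> ('b, 'z) cstar_scheme \<Rightarrow> ('a \<Rightarrow> 'b) \<Rightarrow> bool" where
  "star_hom A B \<phi> \<longleftrightarrow>
     \<phi> \<in> carrier A \<rightarrow> carrier B \<and>
     (\<forall>x\<in>carrier A. \<forall>y\<in>carrier A. \<phi> (x \<oplus>\<^bsub>A\<^esub> y) = \<phi> x \<oplus>\<^bsub>B\<^esub> \<phi> y) \<and>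
     (\<forall>a. \<forall>x\<in>carrier A. \<phi> (a \<odot>\<^bsub>A\<^esub> x) = a \<odot>\<^bsub>B\<^esub> \<phi> x) \<and>
     (\<forall>x\<in>carrier A. \<forall>y\<in>carrier A. \<phi> (x \<otimes>\<^bsub>A\<^esub> y) = \<phi> x \<otimes>\<^bsub>B\<^esub> \<phi> y) \<and>
     (\<forall>x\<in>carrier A. \<phi> (adj A x) = adj B (\<phi> x))"

definition star_aut :: "('a, 'z) cstar_scheme \<Rightarrow> ('a \<Rightarrow> 'a) \<Rightarrow> bool" where
  "star_aut A \<phi> \<longleftrightarrow> star_hom A A \<phi> \<and> bij_betw \<phi> (carrier A) (carrier A)"

definition cstar_subalgebra :: "'a set \<Rightarrow> ('a, 'z) cstar_scheme \<Rightarrow> bool" where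
  "cstar_subalgebra C A \<longleftrightarrow>
     closedin (ctopology A) C \<and> \<zero>\<^bsub>A\<^esub> \<in> C \<and>
     (\<forall>x\<in>C. \<forall>y\<in>C. x \<oplus>\<^bsub>A\<^esub> y \<in> C) \<and>
     (\<forall>a. \<forall>x\<in>C. a \<odot>\<^bsub>A\<^esub> x \<in> C) \<and>
     (\<forall>x\<in>C. \<forall>y\<in>C. x \<otimes>\<^bsub>A\<^esub> y \<in> C) \<and>
     (\<forall>x\<in>C. adj A x \<in> C)"

definition cstar_generated :: "('a, 'z) cstar_scheme \<Rightarrow> 'a set \<Rightarrow> 'a set" where
  "cstar_generated A X = \<Inter>{C. cstar_subalgebra C A \<and> X \<subseteq> C}"


section \<open>Small categories, groupoids and higher-rank graphs\<close>

text \<open>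
  Categories are single-sorted: the objects are the identity morphisms. \<open>cmp C x y\<close> is the
  composite \<open>x y\<close>, meaningful when \<open>src C x = rng C y\<close>.
\<close>

record 'm cat =
  mor :: "'m set"
  src :: "'m \<Rightarrow> 'm"
  rng :: "'m \<Rightarrow> 'm"
  cmp :: "'m \<Rightarrow> 'm \<Rightarrow> 'm"

definition obj :: "('m, 'z) cat_scheme \<Rightarrow> 'm set" where
  "obj C = {v \<in> mor C. src C v = v}"

locale small_category =
  fixes C :: "('m, 'z) cat_scheme"
  assumes src_mor: "x \<in> mor C \<Longrightarrow> src C x \<in> mor C"
    and rng_mor: "x \<in> mor C \<Longrightarrow> rng C x \<in> mor C"
    and src_src: "x \<in> mor C \<Longrightarrow> src C (src C x) = src C x"
    and rng_src: "x \<in> mor C \<Longrightarrow> rng C (src C x) = src C x"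
    and src_rng: "x \<in> mor C \<Longrightarrow> src C (rng C x) = rng C x"
    and rng_rng: "x \<in> mor C \<Longrightarrow> rng C (rng C x) = rng C x"
    and cmp_mor: "\<lbrakk>x \<in> mor C; y \<in> mor C; src C x = rng C y\<rbrakk> \<Longrightarrow> cmp C x y \<in> mor C"
    and src_cmp: "\<lbrakk>x \<in> mor C; y \<in> mor C; src C x = rng C y\<rbrakk> \<Longrightarrow> src C (cmp C x y) = src C y"
    and rng_cmp: "\<lbrakk>x \<in> mor C; y \<in> mor C; src C x = rng C y\<rbrakk> \<Longrightarrow> rng C (cmp C x y) = rng C x"
    and cmp_rng: "x \<in> mor C \<Longrightarrow> cmp C (rng C x) x = x"
    and cmp_src: "x \<in> mor C \<Longrightarrow> cmp C x (src C x) = x"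
    and cmp_assoc: "\<lbrakk>x \<in> mor C; y \<in> mor C; z \<in> mor C; src C x = rng C y; src C y = rng C z\<rbrakk> \<Longrightarrow>
          cmp C (cmp C x y) z = cmp C x (cmp C y z)"

definition is_inverse :: "('m, 'z) cat_scheme \<Rightarrow> 'm \<Rightarrow> 'm \<Rightarrow> bool" where
  "is_inverse C g h \<longleftrightarrow> h \<in> mor C \<and> src C h = rng C g \<and> rng C h = src C g \<and>
     cmp C g h = rng C g \<and> cmp C h g = src C g"

definition inverse_of :: "('m, 'z) cat_scheme \<Rightarrow> 'm \<Rightarrow> 'm" where
  "inverse_of C g = (THE h. is_inverse C g h)"

locale countable_groupoid = small_category G for G :: "('m, 'z) cat_scheme" +
  assumes countable_mor: "countable (mor G)"
    and inverse_exists: "g \<in> mor G \<Longrightarrow> \<exists>h. is_inverse G g h"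

text \<open>\<open>\<nat>\<^sup>k\<close> and \<open>\<T>\<^sup>k\<close>: sequences whose entries from index \<open>k\<close> on are trivial.\<close>

definition Nk :: "nat \<Rightarrow> (nat \<Rightarrow> nat) set" where
  "Nk k = {n. \<forall>i\<ge>k. n i = 0}"

definition torus :: "nat \<Rightarrow> (nat \<Rightarrow> complex) set" where
  "torus k = {z. (\<forall>i<k. cmod (z i) = 1) \<and> (\<forall>i\<ge>k. z i = 1)}"

definition torus_power :: "nat \<Rightarrow> (nat \<Rightarrow> complex) \<Rightarrow> (nat \<Rightarrow> nat) \<Rightarrow> complex" where
  "torus_power k z n = (\<Prod>i<k. z i ^ n i)"

record 'm kgraph = "'m cat" +
  kdeg :: "'m \<Rightarrow> nat \<Rightarrow> nat"

locale higher_rank_graph = small_category \<Lambda> for k :: nat and \<Lambda> :: "('m, 'z) kgraph_scheme" +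
  assumes countable_mor: "countable (mor \<Lambda>)"
    and kdeg_Nk: "x \<in> mor \<Lambda> \<Longrightarrow> kdeg \<Lambda> x \<in> Nk k"
    and kdeg_obj: "v \<in> obj \<Lambda> \<Longrightarrow> kdeg \<Lambda> v = (\<lambda>i. 0)"
    and kdeg_cmp: "\<lbrakk>x \<in> mor \<Lambda>; y \<in> mor \<Lambda>; src \<Lambda> x = rng \<Lambda> y\<rbrakk> \<Longrightarrow>
          kdeg \<Lambda> (cmp \<Lambda> x y) = (\<lambda>i. kdeg \<Lambda> x i + kdeg \<Lambda> y i)"
    and factorisation: "\<lbrakk>x \<in> mor \<Lambda>; m \<in> Nk k; n \<in> Nk k; kdeg \<Lambda> x = (\<lambda>i. m i + n i)\<rbrakk> \<Longrightarrow>
          \<exists>!(y, z). y \<in> mor \<Lambda> \<and> z \<in> mor \<Lambda> \<and> src \<Lambda> y = rng \<Lambda> z \<and> x = cmp \<Lambda> y z \<and>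
                    kdeg \<Lambda> y = m \<and> kdeg \<Lambda> z = n"

definition paths_from :: "('m, 'z) kgraph_scheme \<Rightarrow> 'm \<Rightarrow> (nat \<Rightarrow> nat) \<Rightarrow> 'm set" where
  "paths_from \<Lambda> v n = {x \<in> mor \<Lambda>. rng \<Lambda> x = v \<and> kdeg \<Lambda> x = n}"

definition row_finite_no_sources :: "nat \<Rightarrow> ('m, 'z) kgraph_scheme \<Rightarrow> bool" where
  "row_finite_no_sources k \<Lambda> \<longleftrightarrow>
     (\<forall>v\<in>obj \<Lambda>. \<forall>n\<in>Nk k. finite (paths_from \<Lambda> v n) \<and> paths_from \<Lambda> v n \<noteq> {})"

definition extensions_of :: "('m, 'z) cat_scheme \<Rightarrow> 'm \<Rightarrow> 'm set" where
  "extensions_of C x = {cmp C x y | y. y \<in> mor C \<and> src C x = rng C y}"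

definition MCE :: "('m, 'z) kgraph_scheme \<Rightarrow> 'm \<Rightarrow> 'm \<Rightarrow> 'm set" where
  "MCE \<Lambda> x y = {z \<in> mor \<Lambda>. z \<in> extensions_of \<Lambda> x \<and> z \<in> extensions_of \<Lambda> y \<and>
                          kdeg \<Lambda> z = sup (kdeg \<Lambda> x) (kdeg \<Lambda> y)}"


section \<open>Self-similar actions and their Zappa-Szep products\<close>

text \<open>
  The groupoid and the graph share one type of morphisms, so that \<open>obj G = obj \<Lambda>\<close> is a literal
  equality. \<open>L g x\<close> is the left action of the groupoid on the graph and \<open>R g x\<close> is the right
  action of the graph on the groupoid.
\<close>

locale self_similar_action =
  G: countable_groupoid G + \<Lambda>: higher_rank_graph k \<Lambda>
  for k :: nat and G :: "'m cat" and \<Lambda> :: "'m kgraph"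
    and L :: "'m \<Rightarrow> 'm \<Rightarrow> 'm" and R :: "'m \<Rightarrow> 'm \<Rightarrow> 'm" +
  assumes obj_eq: "obj G = obj \<Lambda>"
    and L_mor: "\<lbrakk>g \<in> mor G; x \<in> mor \<Lambda>; src G g = rng \<Lambda> x\<rbrakk> \<Longrightarrow> L g x \<in> mor \<Lambda>"
    and L_rng: "x \<in> mor \<Lambda> \<Longrightarrow> L (rng \<Lambda> x) x = x"
    and rng_L: "\<lbrakk>g \<in> mor G; x \<in> mor \<Lambda>; src G g = rng \<Lambda> x\<rbrakk> \<Longrightarrow> rng \<Lambda> (L g x) = rng G g"
    and L_L: "\<lbrakk>g \<in> mor G; h \<in> mor G; x \<in> mor \<Lambda>; src G g = rng G h; src G h = rng \<Lambda> x\<rbrakk> \<Longrightarrow>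
          L (cmp G g h) x = L g (L h x)"
    and L_src: "g \<in> mor G \<Longrightarrow> L g (src G g) = rng G g"
    and R_mor: "\<lbrakk>g \<in> mor G; x \<in> mor \<Lambda>; src G g = rng \<Lambda> x\<rbrakk> \<Longrightarrow> R g x \<in> mor G"
    and R_src: "g \<in> mor G \<Longrightarrow> R g (src G g) = g"
    and src_R: "\<lbrakk>g \<in> mor G; x \<in> mor \<Lambda>; src G g = rng \<Lambda> x\<rbrakk> \<Longrightarrow> src G (R g x) = src \<Lambda> x"
    and R_R: "\<lbrakk>g \<in> mor G; x \<in> mor \<Lambda>; y \<in> mor \<Lambda>; src G g = rng \<Lambda> x; src \<Lambda> x = rng \<Lambda> y\<rbrakk> \<Longrightarrow>
          R g (cmp \<Lambda> x y) = R (R g x) y"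
    and R_rng: "x \<in> mor \<Lambda> \<Longrightarrow> R (rng \<Lambda> x) x = src \<Lambda> x"
    and src_L: "\<lbrakk>g \<in> mor G; x \<in> mor \<Lambda>; src G g = rng \<Lambda> x\<rbrakk> \<Longrightarrow> src \<Lambda> (L g x) = rng G (R g x)"
    and L_cmp: "\<lbrakk>g \<in> mor G; x \<in> mor \<Lambda>; y \<in> mor \<Lambda>; src G g = rng \<Lambda> x; src \<Lambda> x = rng \<Lambda> y\<rbrakk> \<Longrightarrow>
          L g (cmp \<Lambda> x y) = cmp \<Lambda> (L g x) (L (R g x) y)"
    and R_cmp: "\<lbrakk>g \<in> mor G; h \<in> mor G; x \<in> mor \<Lambda>; src G g = rng G h; src G h = rng \<Lambda> x\<rbrakk> \<Longrightarrow>
          R (cmp G g h) x = cmp G (R g (L h x)) (R h x)"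
    and kdeg_L: "\<lbrakk>g \<in> mor G; x \<in> mor \<Lambda>; src G g = rng \<Lambda> x\<rbrakk> \<Longrightarrow> kdeg \<Lambda> (L g x) = kdeg \<Lambda> x"

definition zappa_szep ::
  "'m cat \<Rightarrow> 'm kgraph \<Rightarrow> ('m \<Rightarrow> 'm \<Rightarrow> 'm) \<Rightarrow> ('m \<Rightarrow> 'm \<Rightarrow> 'm) \<Rightarrow> ('m \<times> 'm) kgraph" where
  "zappa_szep G \<Lambda> L R =
     \<lparr>mor = {(x, g). x \<in> mor \<Lambda> \<and> g \<in> mor G \<and> src \<Lambda> x = rng G g},
      src = (\<lambda>(x, g). (src G g, src G g)),
      rng = (\<lambda>(x, g). (rng \<Lambda> x, rng \<Lambda> x)),
      cmp = (\<lambda>(x, g) (y, h). (cmp \<Lambda> x (L g y), cmp G (R g y) h)),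
      kdeg = (\<lambda>(x, g). kdeg \<Lambda> x)\<rparr>"

definition from_graph :: "'m kgraph \<Rightarrow> 'm \<Rightarrow> 'm \<times> 'm" where
  "from_graph \<Lambda> x = (x, src \<Lambda> x)"

definition from_groupoid :: "'m cat \<Rightarrow> 'm \<Rightarrow> 'm \<times> 'm" where
  "from_groupoid G g = (rng G g, g)"

definition normalised_cocycle ::
  "('e, 'z) cat_scheme \<Rightarrow> ('e \<Rightarrow> 'e \<Rightarrow> complex) \<Rightarrow> bool" where
  "normalised_cocycle E c \<longleftrightarrow>
     (\<forall>x\<in>mor E. \<forall>y\<in>mor E. src E x = rng E y \<longrightarrow> cmod (c x y) = 1) \<and>
     (\<forall>x\<in>mor E. \<forall>y\<in>mor E. \<forall>z\<in>mor E. src E x = rng E y \<longrightarrow> src E y = rng E z \<longrightarrow>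
        c x y * c (cmp E x y) z = c y z * c x (cmp E y z)) \<and>
     (\<forall>x\<in>mor E. \<forall>y\<in>mor E. src E x = rng E y \<longrightarrow> x \<in> obj E \<or> y \<in> obj E \<longrightarrow> c x y = 1)"


section \<open>Cuntz-Krieger families and universal C*-algebras\<close>

text \<open>The sums over \<open>MCE\<close> are finite for the row-finite graphs considered here.\<close>

definition ck_family ::
  "nat \<Rightarrow> 'm cat \<Rightarrow> 'm kgraph \<Rightarrow> ('m \<Rightarrow> 'm \<Rightarrow> 'm) \<Rightarrow> ('m \<Rightarrow> 'm \<Rightarrow> 'm) \<Rightarrow>
   ('m \<times> 'm \<Rightarrow> 'm \<times> 'm \<Rightarrow> complex) \<Rightarrow> ('a, 'z) cstar_scheme \<Rightarrow> ('m \<times> 'm \<Rightarrow> 'a) \<Rightarrow> bool" where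
  "ck_family k G \<Lambda> L R c A t \<longleftrightarrow>
     (let E = zappa_szep G \<Lambda> L R;
          p = (\<lambda>x. t (from_graph \<Lambda> x) \<otimes>\<^bsub>A\<^esub> adj A (t (from_graph \<Lambda> x)))
      in t \<in> mor E \<rightarrow> carrier A \<and>
         (\<forall>\<zeta>\<in>mor E. \<forall>\<eta>\<in>mor E. t \<zeta> \<otimes>\<^bsub>A\<^esub> t \<eta> =
            (if src E \<zeta> = rng E \<eta> then c \<zeta> \<eta> \<odot>\<^bsub>A\<^esub> t (cmp E \<zeta> \<eta>) else \<zero>\<^bsub>A\<^esub>)) \<and>
         (\<forall>\<zeta>\<in>mor E. adj A (t \<zeta>) \<otimes>\<^bsub>A\<^esub> t \<zeta> = t (src E \<zeta>)) \<and>
         (\<forall>\<mu>\<in>mor \<Lambda>. \<forall>\<nu>\<in>mor \<Lambda>. p \<mu> \<otimes>\<^bsub>A\<^esub> p \<nu> = (\<Oplus>\<^bsub>A\<^esub>x\<in>MCE \<Lambda> \<mu> \<nu>. p x)) \<and>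
         (\<forall>v\<in>obj \<Lambda>. \<forall>n\<in>Nk k. t (from_graph \<Lambda> v) = (\<Oplus>\<^bsub>A\<^esub>x\<in>paths_from \<Lambda> v n. p x)))"

definition unitary_rep ::
  "'m cat \<Rightarrow> ('m \<Rightarrow> 'm \<Rightarrow> complex) \<Rightarrow> ('a, 'z) cstar_scheme \<Rightarrow> ('m \<Rightarrow> 'a) \<Rightarrow> bool" where
  "unitary_rep G c A w \<longleftrightarrow>
     w \<in> mor G \<rightarrow> carrier A \<and>
     (\<forall>g\<in>mor G. \<forall>h\<in>mor G. w g \<otimes>\<^bsub>A\<^esub> w h =
        (if src G g = rng G h then c g h \<odot>\<^bsub>A\<^esub> w (cmp G g h) else \<zero>\<^bsub>A\<^esub>)) \<and>
     (\<forall>g\<in>mor G. adj A (w g) = cnj (c g (inverse_of G g)) \<odot>\<^bsub>A\<^esub> w (inverse_of G g))"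

text \<open>
  In the two universal properties below the test algebra \<open>X\<close> ranges over the C*-algebras with
  carrier in \<^typ>\<open>real\<close>. This amounts to letting it range over all C*-algebras: a family indexed
  by the countable set of morphisms lives in the C*-subalgebra that it generates, and this
  subalgebra is separable, hence has at most continuum many elements and is isomorphic to a
  C*-algebra whose carrier is a set of real numbers. Uniqueness of \<open>\<phi>\<close> on the carrier follows
  from generation.
\<close>

definition universal_ck_algebra ::
  "nat \<Rightarrow> 'm cat \<Rightarrow> 'm kgraph \<Rightarrow> ('m \<Rightarrow> 'm \<Rightarrow> 'm) \<Rightarrow> ('m \<Rightarrow> 'm \<Rightarrow> 'm) \<Rightarrow>
   ('m \<times> 'm \<Rightarrow> 'm \<times> 'm \<Rightarrow> complex) \<Rightarrow> 'b cstar \<Rightarrow> ('m \<times> 'm \<Rightarrow> 'b) \<Rightarrow> bool" where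
  "universal_ck_algebra k G \<Lambda> L R c B s \<longleftrightarrow>
     cstar_algebra B \<and> ck_family k G \<Lambda> L R c B s \<and>
     cstar_generated B (s ` mor (zappa_szep G \<Lambda> L R)) = carrier B \<and>
     (\<forall>(X :: real cstar) t. cstar_algebra X \<and> ck_family k G \<Lambda> L R c X t \<longrightarrow>
        (\<exists>\<phi>. star_hom B X \<phi> \<and> (\<forall>\<zeta>\<in>mor (zappa_szep G \<Lambda> L R). \<phi> (s \<zeta>) = t \<zeta>)))"

definition twisted_groupoid_algebra ::
  "'m cat \<Rightarrow> ('m \<Rightarrow> 'm \<Rightarrow> complex) \<Rightarrow> 'b cstar \<Rightarrow> ('m \<Rightarrow> 'b) \<Rightarrow> bool" where
  "twisted_groupoid_algebra G c D w \<longleftrightarrow>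
     cstar_algebra D \<and> unitary_rep G c D w \<and>
     cstar_generated D (w ` mor G) = carrier D \<and>
     (\<forall>(X :: real cstar) u. cstar_algebra X \<and> unitary_rep G c X u \<longrightarrow>
        (\<exists>\<phi>. star_hom D X \<phi> \<and> (\<forall>g\<in>mor G. \<phi> (w g) = u g)))"

definition strongly_continuous_action ::
  "nat \<Rightarrow> ('a, 'z) cstar_scheme \<Rightarrow> ((nat \<Rightarrow> complex) \<Rightarrow> 'a \<Rightarrow> 'a) \<Rightarrow> bool" where
  "strongly_continuous_action k A \<beta> \<longleftrightarrow>
     (\<forall>z\<in>torus k. star_aut A (\<beta> z)) \<and>
     (\<forall>z\<in>torus k. \<forall>w\<in>torus k. \<forall>a\<in>carrier A. \<beta> (\<lambda>i. z i * w i) a = \<beta> z (\<beta> w a)) \<and>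
     (\<forall>a\<in>carrier A. continuous_map (top_of_set (torus k)) (ctopology A) (\<lambda>z. \<beta> z a))"

end

theory Submission
  imports Defs
begin

text \<open>
  Let \<open>b\<close> lie in the kernel of \<open>\<pi>\<close>. The universal property provides a gauge action on \<open>B\<close>, so the
  Fejer means of \<open>b\<close> over the torus converge to \<open>b\<close>, and it suffices that \<open>\<pi>\<close> is isometric on
  homogeneous elements; by the C*-identity, on elements of degree \<open>0\<close>. By (CK) such an element \<open>x\<close> is a
  finite matrix over the algebra of the groupoid, on which injectivity of \<open>\<pi>\<close> bounds the norm of \<open>x\<close>
  by a multiple of the norm of \<open>\<pi> x\<close>; applied to \<open>(x\<^bold>*x)\<^sup>n\<close>, with \<open>n\<close> a large power of two, this removes
  the multiple. Roots of unity replace the torus in all averages, so that no integral is needed.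
\<close>

section \<open>C*-algebras without functional calculus\<close>

text \<open>C*-algebras are given here by axioms only, without unit, spectrum or quotients, so the
  usual fact that injective homomorphisms are isometric needs another route. Selfadjoint elements
  are cut down by fixed point iterations whose solutions satisfy algebraic relations; such relations
  bound norms and survive homomorphisms. Hence homomorphisms contract, images of selfadjoint
  elements have preimages of comparable norm, and an inclusion of kernels becomes a norm inequality.
  The image of the groupoid algebra in \<open>B\<close> is never assumed closed: the inequality is
  proved on \<open>D\<close> and pushed forward.

  No conditional expectation is constructed. In its place stands
  \<open>nrm B x \<le> nrm A (\<pi> x)\<close> for homogeneous \<open>x\<close>. An element of the
  kernel is only a limit of finite sums of homogeneous ones, and the number of summands is not
  bounded along the limit. A Fejer mean of fixed order sees finitely many degrees, which allows a
  second approximation to be chosen fine enough for all of them at once.\<close>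

lemma carrier_complex_ring [simp]: "carrier complex_ring = UNIV"
  by (simp add: complex_ring_def)

context cstar_algebra
begin

abbreviation adj_notation ("_\<^bold>*" [1000] 999) where "x\<^bold>* \<equiv> adj A x"

lemma scale_closed [simp, intro]: "x \<in> carrier A \<Longrightarrow> a \<odot> x \<in> carrier A"
  by simp

lemma scale_add_left: "x \<in> carrier A \<Longrightarrow> (a + b) \<odot> x = a \<odot> x \<oplus> b \<odot> x"
  using smult_l_distr[of a b x] by (simp add: complex_ring_def)

lemma scale_add_right:
  "\<lbrakk>x \<in> carrier A; y \<in> carrier A\<rbrakk> \<Longrightarrow> a \<odot> (x \<oplus> y) = a \<odot> x \<oplus> a \<odot> y"
  using smult_r_distr[of a x y] by simp

lemma scale_scale: "x \<in> carrier A \<Longrightarrow> a \<odot> (b \<odot> x) = (a * b) \<odot> x"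
  using smult_assoc1[of a b x] by (simp add: complex_ring_def)

lemma scale_one [simp]: "x \<in> carrier A \<Longrightarrow> 1 \<odot> x = x"
  using smult_one[of x] by (simp add: complex_ring_def)

lemma scale_zero [simp]: "x \<in> carrier A \<Longrightarrow> 0 \<odot> x = \<zero>"
  using scale_add_left[of x 0 0] by (metis add.r_cancel_one' scale_closed add_0)

lemma scale_zero_right [simp]: "a \<odot> \<zero> = \<zero>"
  by (metis scale_add_right add.r_cancel_one' scale_closed zero_closed l_zero)

declare mult_closed [simp, intro] adj_closed [simp, intro] adj_adj [simp]

lemma neg_eq_scale: "x \<in> carrier A \<Longrightarrow> \<ominus> x = (-1) \<odot> x"
  using scale_add_left[of x 1 "-1"] by (intro minus_equality) (auto simp: a_comm)

lemma diff_eq_scale: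
  "\<lbrakk>x \<in> carrier A; y \<in> carrier A\<rbrakk> \<Longrightarrow> x \<ominus> y = x \<oplus> (-1) \<odot> y"
  by (simp add: a_minus_def neg_eq_scale)

lemma diff_closed [simp, intro]: "\<lbrakk>x \<in> carrier A; y \<in> carrier A\<rbrakk> \<Longrightarrow> x \<ominus> y \<in> carrier A"
  by (simp add: diff_eq_scale)

lemma diff_eq_zero_iff: "\<lbrakk>x \<in> carrier A; y \<in> carrier A\<rbrakk> \<Longrightarrow> x \<ominus> y = \<zero> \<longleftrightarrow> x = y"
  by (metis a_minus_def add.inv_closed add.inv_solve_right' l_zero zero_closed)

lemma diff_self [simp]: "x \<in> carrier A \<Longrightarrow> x \<ominus> x = \<zero>"
  by (simp add: diff_eq_zero_iff)

lemma diff_zero [simp]: "x \<in> carrier A \<Longrightarrow> x \<ominus> \<zero> = x"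
  by (simp add: diff_eq_scale)

lemma diff_add_cancel [simp]: "\<lbrakk>x \<in> carrier A; y \<in> carrier A\<rbrakk> \<Longrightarrow> (x \<ominus> y) \<oplus> y = x"
  by (simp add: a_minus_def a_assoc l_neg)

lemma add_diff_cancel [simp]: "\<lbrakk>x \<in> carrier A; y \<in> carrier A\<rbrakk> \<Longrightarrow> y \<oplus> (x \<ominus> y) = x"
  by (metis diff_add_cancel diff_closed a_comm)

lemma mult_zero_left [simp]: "x \<in> carrier A \<Longrightarrow> \<zero> \<otimes> x = \<zero>"
  using smult_mult_l[of x x 0] by simp

lemma mult_zero_right [simp]: "x \<in> carrier A \<Longrightarrow> x \<otimes> \<zero> = \<zero>"
  using smult_mult_r[of x x 0] by simp

lemma adj_zero [simp]: "\<zero>\<^bold>* = \<zero>"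
  using adj_smult[of \<zero> 0] by simp

lemma nrm_zero [simp]: "nrm A \<zero> = 0"
  by (simp add: nrm_eq_0)

lemma nrm_diff_commute: "\<lbrakk>x \<in> carrier A; y \<in> carrier A\<rbrakk> \<Longrightarrow> nrm A (x \<ominus> y) = nrm A (y \<ominus> x)"
  using nrm_smult[of "x \<ominus> y" "-1"]
  by (simp add: diff_eq_scale scale_add_right scale_scale a_comm)

lemma nrm_diff_triangle:
  assumes "x \<in> carrier A" "y \<in> carrier A" "z \<in> carrier A"
  shows "nrm A (x \<ominus> z) \<le> nrm A (x \<ominus> y) + nrm A (y \<ominus> z)"
proof -
  have "x \<ominus> z = (x \<ominus> y) \<oplus> (y \<ominus> z)"
    using assms by (metis a_assoc a_minus_def add.inv_closed diff_add_cancel diff_closed)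
  then show ?thesis using nrm_triangle[of "x \<ominus> y" "y \<ominus> z"] assms by simp
qed

lemma nrm_diff_le: "\<lbrakk>x \<in> carrier A; y \<in> carrier A\<rbrakk> \<Longrightarrow> nrm A (x \<ominus> y) \<le> nrm A x + nrm A y"
  using nrm_triangle[of x "(-1) \<odot> y"] nrm_smult[of y "-1"] by (simp add: diff_eq_scale)

lemma nrm_le_add_diff:
  "\<lbrakk>x \<in> carrier A; y \<in> carrier A\<rbrakk> \<Longrightarrow> nrm A x \<le> nrm A y + nrm A (x \<ominus> y)"
  using nrm_triangle[of y "x \<ominus> y"] by simp

text \<open>The C*-identity and submultiplicativity give |y|^2 at most |y| times the norm of its
  adjoint; the same for the adjoint gives equality.\<close>

lemma nrm_adj: assumes "x \<in> carrier A" shows "nrm A (x\<^bold>*) = nrm A x"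
proof -
  have *: "nrm A y \<le> nrm A (y\<^bold>*)" if "y \<in> carrier A" for y
  proof (cases "nrm A y = 0")
    case False
    have "nrm A y * nrm A y \<le> nrm A (y\<^bold>*) * nrm A y"
      using nrm_cstar[OF that] nrm_mult[of "y\<^bold>*" y] that by (simp add: power2_eq_square)
    then show ?thesis using False nrm_nonneg[OF that] by (simp add: mult_le_cancel_right)
  qed (simp add: nrm_nonneg that)
  show ?thesis using *[of x] *[of "x\<^bold>*"] assms by simp
qed

lemma add_add_add_commute:
  "\<lbrakk>x \<in> carrier A; y \<in> carrier A; z \<in> carrier A; w \<in> carrier A\<rbrakk> \<Longrightarrow>
     (x \<oplus> y) \<oplus> (z \<oplus> w) = (x \<oplus> z) \<oplus> (y \<oplus> w)"
  by (simp add: a_ac)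

lemma add_diff_add:
  assumes "x \<in> carrier A" "y \<in> carrier A" "z \<in> carrier A" "w \<in> carrier A"
  shows "(x \<oplus> y) \<ominus> (z \<oplus> w) = (x \<ominus> z) \<oplus> (y \<ominus> w)"
  using assms by (simp add: diff_eq_scale scale_add_right add_add_add_commute)

lemma scale_diff_right:
  "\<lbrakk>x \<in> carrier A; y \<in> carrier A\<rbrakk> \<Longrightarrow> a \<odot> (x \<ominus> y) = a \<odot> x \<ominus> a \<odot> y"
  by (simp add: diff_eq_scale scale_add_right scale_scale mult.commute)

lemma mult_diff_right:
  "\<lbrakk>x \<in> carrier A; y \<in> carrier A; z \<in> carrier A\<rbrakk> \<Longrightarrow> z \<otimes> (x \<ominus> y) = z \<otimes> x \<ominus> z \<otimes> y"
  by (simp add: diff_eq_scale mult_r_distr smult_mult_r)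

lemma mult_diff_left:
  "\<lbrakk>x \<in> carrier A; y \<in> carrier A; z \<in> carrier A\<rbrakk> \<Longrightarrow> (x \<ominus> y) \<otimes> z = x \<otimes> z \<ominus> y \<otimes> z"
  by (simp add: diff_eq_scale mult_l_distr smult_mult_l)

lemma adj_diff:
  "\<lbrakk>x \<in> carrier A; y \<in> carrier A\<rbrakk> \<Longrightarrow> (x \<ominus> y)\<^bold>* = x\<^bold>* \<ominus> y\<^bold>*"
  by (simp add: diff_eq_scale adj_add adj_smult)

subsection \<open>Convergence\<close>

sublocale Metric_space "carrier A" "cdist A"
proof
  show "0 \<le> cdist A x y" for x y by (simp add: cdist_def nrm_nonneg)
  show "cdist A x y = cdist A y x" for x y by (simp add: cdist_def nrm_diff_commute)
  show "cdist A x y = 0 \<longleftrightarrow> x = y" if "x \<in> carrier A" "y \<in> carrier A" for x y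
    using that by (simp add: cdist_def nrm_eq_0 diff_eq_zero_iff)
  show "cdist A x z \<le> cdist A x y + cdist A y z"
    if "x \<in> carrier A" "y \<in> carrier A" "z \<in> carrier A" for x y z
    using that by (simp add: cdist_def nrm_diff_triangle)
qed

text \<open>Limits are stated through norms, so that the algebra operations are handled by real
  limits; \<open>converges_iff_limitin\<close> returns to the metric topology, in which completeness
  is phrased.\<close>

definition converges :: "(nat \<Rightarrow> 'a) \<Rightarrow> 'a \<Rightarrow> bool" where
  "converges u x \<longleftrightarrow> (\<forall>n. u n \<in> carrier A) \<and> x \<in> carrier A \<and> (\<lambda>n. nrm A (u n \<ominus> x)) \<longlonglongrightarrow> 0"

lemma convergesD: "converges u x \<Longrightarrow> u n \<in> carrier A" "converges u x \<Longrightarrow> x \<in> carrier A"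
  by (auto simp: converges_def)

lemma convergesI:
  assumes "\<And>n. u n \<in> carrier A" "x \<in> carrier A" "\<And>n. nrm A (u n \<ominus> x) \<le> e n" "e \<longlonglongrightarrow> 0"
  shows "converges u x"
  unfolding converges_def using assms
  by (auto intro: tendsto_sandwich[OF _ _ tendsto_const assms(4)] simp: nrm_nonneg)

lemma converges_const: "x \<in> carrier A \<Longrightarrow> converges (\<lambda>n. x) x"
  by (simp add: converges_def)

lemma converges_add:
  assumes "converges u x" "converges v y"
  shows "converges (\<lambda>n. u n \<oplus> v n) (x \<oplus> y)"
proof (rule convergesI)
  note c = convergesD[OF assms(1)] convergesD[OF assms(2)]
  show "nrm A (u n \<oplus> v n \<ominus> (x \<oplus> y)) \<le> nrm A (u n \<ominus> x) + nrm A (v n \<ominus> y)" for n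
    using nrm_triangle[of "u n \<ominus> x" "v n \<ominus> y"] c by (simp add: add_diff_add)
  show "(\<lambda>n. nrm A (u n \<ominus> x) + nrm A (v n \<ominus> y)) \<longlonglongrightarrow> 0"
    using assms by (auto simp: converges_def intro: tendsto_eq_intros)
qed (use assms in \<open>auto simp: converges_def\<close>)

lemma converges_scale: assumes "converges u x" shows "converges (\<lambda>n. a \<odot> u n) (a \<odot> x)"
proof (rule convergesI)
  show "nrm A (a \<odot> u n \<ominus> a \<odot> x) \<le> cmod a * nrm A (u n \<ominus> x)" for n
    using assms by (simp add: scale_diff_right[symmetric] nrm_smult convergesD)
  show "(\<lambda>n. cmod a * nrm A (u n \<ominus> x)) \<longlonglongrightarrow> 0"
    using assms by (auto simp: converges_def intro: tendsto_eq_intros)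
qed (use assms in \<open>auto simp: converges_def\<close>)

lemma converges_diff:
  assumes "converges u x" "converges v y"
  shows "converges (\<lambda>n. u n \<ominus> v n) (x \<ominus> y)"
  using converges_add[OF assms(1) converges_scale[OF assms(2), of "-1"]] assms
  by (simp add: diff_eq_scale convergesD)

lemma converges_norm: assumes "converges u x" shows "(\<lambda>n. nrm A (u n)) \<longlonglongrightarrow> nrm A x"
proof -
  have bound: "\<bar>nrm A (u n) - nrm A x\<bar> \<le> nrm A (u n \<ominus> x)" for n
    using nrm_le_add_diff[of "u n" x] nrm_le_add_diff[of x "u n"] nrm_diff_commute[of x "u n"] assms
    by (simp add: convergesD)
  have "(\<lambda>n. nrm A (u n) - nrm A x) \<longlonglongrightarrow> 0"
  proof (rule Lim_null_comparison)
    show "\<forall>\<^sub>F n in sequentially. norm (nrm A (u n) - nrm A x) \<le> nrm A (u n \<ominus> x)"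
      using bound by simp
    show "(\<lambda>n. nrm A (u n \<ominus> x)) \<longlonglongrightarrow> 0" using assms by (simp add: converges_def)
  qed
  then show ?thesis by (simp add: LIM_zero_iff)
qed

lemma converges_mult:
  assumes "converges u x" "converges v y"
  shows "converges (\<lambda>n. u n \<otimes> v n) (x \<otimes> y)"
proof (rule convergesI)
  note c = convergesD[OF assms(1)] convergesD[OF assms(2)]
  show "nrm A (u n \<otimes> v n \<ominus> x \<otimes> y) \<le> nrm A (u n) * nrm A (v n \<ominus> y) + nrm A (u n \<ominus> x) * nrm A y" for n
    using nrm_diff_triangle[of "u n \<otimes> v n" "u n \<otimes> y" "x \<otimes> y"]
      nrm_mult[of "u n" "v n \<ominus> y"] nrm_mult[of "u n \<ominus> x" y] c
    by (simp add: mult_diff_left mult_diff_right)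
  show "(\<lambda>n. nrm A (u n) * nrm A (v n \<ominus> y) + nrm A (u n \<ominus> x) * nrm A y) \<longlonglongrightarrow> 0"
    using assms converges_norm[OF assms(1)] by (auto simp: converges_def intro!: tendsto_eq_intros)
qed (use assms in \<open>auto simp: converges_def\<close>)

lemma converges_adj: assumes "converges u x" shows "converges (\<lambda>n. (u n)\<^bold>*) (x\<^bold>*)"
  using assms unfolding converges_def by (simp add: adj_diff[symmetric] nrm_adj)

lemma converges_unique: assumes "converges u x" "converges u y" shows "x = y"
proof -
  have "converges (\<lambda>n. \<zero>) (x \<ominus> y)"
    using converges_diff[OF assms] assms by (simp add: convergesD)
  then show ?thesis
    using converges_norm[of "\<lambda>n. \<zero>" "x \<ominus> y"] assms
    by (simp add: LIMSEQ_const_iff nrm_eq_0 diff_eq_zero_iff convergesD)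
qed

lemma converges_Suc: "converges u x \<Longrightarrow> converges (\<lambda>n. u (Suc n)) x"
  unfolding converges_def using LIMSEQ_Suc by blast

lemma converges_norm_le: "\<lbrakk>converges u x; \<And>n. nrm A (u n) \<le> r\<rbrakk> \<Longrightarrow> nrm A x \<le> r"
  using LIMSEQ_le_const2[OF converges_norm] by blast

lemma converges_iff_limitin:
  "converges u x \<longleftrightarrow> (\<forall>n. u n \<in> carrier A) \<and> limitin mtopology u x sequentially"
proof
  assume c: "converges u x"
  then have "\<exists>N. \<forall>n\<ge>N. nrm A (u n \<ominus> x) < e" if "e > 0" for e
    using that LIMSEQ_D[of "\<lambda>n. nrm A (u n \<ominus> x)" 0 e]
    by (auto simp: converges_def nrm_nonneg)
  then show "(\<forall>n. u n \<in> carrier A) \<and> limitin mtopology u x sequentially"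
    using c by (auto simp: limit_metric_sequentially cdist_def convergesD)
next
  assume c: "(\<forall>n. u n \<in> carrier A) \<and> limitin mtopology u x sequentially"
  then show "converges u x"
    unfolding converges_def limit_metric_sequentially cdist_def
    by (auto intro!: LIMSEQ_I simp: nrm_nonneg)
qed

text \<open>Telescoping leaves a geometric tail, so \<open>u\<close> is Cauchy. The two fixed point
  iterations and the successive corrections in \<open>bounded_lift\<close> have geometrically small
  steps and get their limits here.\<close>

lemma geometric_converges:
  assumes u: "\<And>n. u n \<in> carrier A" and q: "0 \<le> q" "q < 1"
    and step: "\<And>n. nrm A (u (Suc n) \<ominus> u n) \<le> C * q ^ n"
  obtains x where "converges u x"
proof -
  have C: "0 \<le> C" using step[of 0] nrm_nonneg[of "u 1 \<ominus> u 0"] u by simp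
  have dist: "nrm A (u (n + m) \<ominus> u n) \<le> (\<Sum>i<m. C * q ^ (n + i))" for n m
  proof (induction m)
    case (Suc m)
    have "nrm A (u (n + Suc m) \<ominus> u n) \<le> nrm A (u (Suc (n + m)) \<ominus> u (n + m)) + nrm A (u (n + m) \<ominus> u n)"
      using nrm_diff_triangle u by simp
    then show ?case using Suc step[of "n + m"] by simp
  qed (simp add: u)
  have bound: "nrm A (u (n + m) \<ominus> u n) \<le> C / (1 - q) * q ^ n" for n m
  proof -
    have "(\<Sum>i<m. C * q ^ (n + i)) = C * q ^ n * (\<Sum>i<m. q ^ i)"
      by (simp add: power_add sum_distrib_left mult.assoc)
    also have "\<dots> = C * q ^ n * ((1 - q ^ m) / (1 - q))"
      using q by (simp add: geometric_sum field_simps)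
    also have "\<dots> \<le> C * q ^ n * (1 / (1 - q))"
      using q C by (intro mult_left_mono divide_right_mono) auto
    finally show ?thesis using dist[of n m] by simp
  qed
  have "MCauchy u"
    unfolding MCauchy_def
  proof (intro conjI allI impI)
    show "range u \<subseteq> carrier A" using u by auto
    fix e :: real assume "e > 0"
    have lim: "(\<lambda>n. C / (1 - q) * q ^ n) \<longlonglongrightarrow> 0"
      using q by (intro tendsto_mult_right_zero LIMSEQ_power_zero) auto
    obtain N where "\<forall>n\<ge>N. norm (C / (1 - q) * q ^ n - 0) < e / 2"
      using LIMSEQ_D[OF lim, of "e / 2"] \<open>e > 0\<close> by auto
    then have "\<bar>C / (1 - q) * q ^ N\<bar> < e / 2" unfolding real_norm_def diff_0_right by blast
    then have "C / (1 - q) * q ^ N < e / 2" by (rule le_less_trans[OF abs_ge_self])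
    then have N: "nrm A (u n \<ominus> u N) < e / 2" if "N \<le> n" for n
      using le_less_trans[OF bound[of N "n - N"]] that by (simp only: le_add_diff_inverse)
    show "\<exists>N. \<forall>n n'. N \<le> n \<longrightarrow> N \<le> n' \<longrightarrow> cdist A (u n) (u n') < e"
    proof (intro exI allI impI)
      fix n n' assume "N \<le> n" "N \<le> n'"
      then show "cdist A (u n) (u n') < e"
        using N[of n] N[of n'] nrm_diff_triangle[of "u n" "u N" "u n'"]
          nrm_diff_commute[of "u n'" "u N"] u by (simp add: cdist_def)
    qed
  qed
  then obtain x where "limitin mtopology u x sequentially"
    using complete unfolding mcomplete_def by blast
  then show thesis using that u by (auto simp: converges_iff_limitin)
qed

lemma ctopology_eq: "ctopology A = mtopology"
  by (simp add: ctopology_def)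

subsection \<open>The C*-identity\<close>

text \<open>Both \<open>p + iq\<close> and \<open>p - iq\<close> have the same modulus, whose square is \<open>p\<^bold>*p + q\<^bold>*q\<close>.\<close>

lemma nrm_le_of_commuting_adj:
  assumes p: "p \<in> carrier A" and q: "q \<in> carrier A" and z: "z \<in> carrier A"
    and comm: "p\<^bold>* \<otimes> q = q\<^bold>* \<otimes> p" and sum: "p\<^bold>* \<otimes> p \<oplus> q\<^bold>* \<otimes> q = z\<^bold>* \<otimes> z"
  shows "nrm A p \<le> nrm A z" "nrm A q \<le> nrm A z"
proof -
  have *: "nrm A (p \<oplus> a \<odot> q) = nrm A z" if a: "cnj a = - a" "a * a = -1" for a
  proof -
    let ?r = "q\<^bold>* \<otimes> p"
    have r: "?r \<in> carrier A" using p q by simp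
    have m: "- (a * a) = 1" using a by simp
    have "(p \<oplus> a \<odot> q)\<^bold>* \<otimes> (p \<oplus> a \<odot> q)
        = (p\<^bold>* \<otimes> p \<oplus> (- a) \<odot> ?r) \<oplus> (a \<odot> ?r \<oplus> (- (a * a)) \<odot> (q\<^bold>* \<otimes> q))"
      using p q a comm
      by (simp add: adj_add adj_smult mult_l_distr mult_r_distr smult_mult_l smult_mult_r scale_scale
          scale_add_right)
    also have "\<dots> = p\<^bold>* \<otimes> p \<oplus> (((- a) \<odot> ?r \<oplus> a \<odot> ?r) \<oplus> q\<^bold>* \<otimes> q)"
      unfolding m using p q r by (simp add: a_assoc)
    also have "(- a) \<odot> ?r \<oplus> a \<odot> ?r = \<zero>"
      using r by (simp add: scale_add_left[symmetric])
    finally have "(p \<oplus> a \<odot> q)\<^bold>* \<otimes> (p \<oplus> a \<odot> q) = z\<^bold>* \<otimes> z"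
      using sum p q by simp
    then have "(nrm A (p \<oplus> a \<odot> q))\<^sup>2 = (nrm A z)\<^sup>2"
      using nrm_cstar[of "p \<oplus> a \<odot> q"] nrm_cstar[of z] p q z by simp
    then show ?thesis using p q z by (simp add: nrm_nonneg)
  qed
  have i: "nrm A (p \<oplus> \<i> \<odot> q) = nrm A z" "nrm A (p \<oplus> (- \<i>) \<odot> q) = nrm A z"
    using *[of \<i>] *[of "-\<i>"] by simp_all
  have "(p \<oplus> \<i> \<odot> q) \<oplus> (p \<oplus> (- \<i>) \<odot> q) = (p \<oplus> p) \<oplus> (\<i> \<odot> q \<oplus> (- \<i>) \<odot> q)"
    using p q by (simp add: add_add_add_commute)
  also have "\<dots> = 2 \<odot> p"
    using p q scale_add_left[of p 1 1] by (simp add: scale_add_left[symmetric])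
  finally have "2 * nrm A p \<le> nrm A z + nrm A z"
    using nrm_triangle[of "p \<oplus> \<i> \<odot> q" "p \<oplus> (- \<i>) \<odot> q"] i p q nrm_smult[of p 2] by simp
  then show "nrm A p \<le> nrm A z" by simp
  have "(p \<oplus> \<i> \<odot> q) \<ominus> (p \<oplus> (- \<i>) \<odot> q) = (p \<ominus> p) \<oplus> (\<i> \<odot> q \<ominus> (- \<i>) \<odot> q)"
    using p q by (simp add: add_diff_add)
  also have "\<dots> = (2 * \<i>) \<odot> q"
    using p q by (simp add: diff_eq_scale scale_scale scale_add_left[symmetric])
  finally have "2 * nrm A q \<le> nrm A z + nrm A z"
    using nrm_diff_le[of "p \<oplus> \<i> \<odot> q" "p \<oplus> (- \<i>) \<odot> q"] i p q nrm_smult[of q "2 * \<i>"]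
    by (simp add: norm_mult)
  then show "nrm A q \<le> nrm A z" by simp
qed

text \<open>With \<open>p = 2y\<close> and \<open>q = 1 - 2h\<close>, the hypothesis \<open>y\<^sup>2 + h\<^sup>2 = h\<close> says \<open>p\<^sup>2 + q\<^sup>2 = 1\<close>: so
  \<open>p \<plusminus> iq\<close> are unitary multipliers. This replaces the functional calculus.\<close>

lemma circle_multiplier:
  assumes y: "y \<in> carrier A" "y\<^bold>* = y" and h: "h \<in> carrier A" "h\<^bold>* = h" and comm: "y \<otimes> h = h \<otimes> y"
    and eq: "y \<otimes> y \<oplus> h \<otimes> h = h" and z: "z \<in> carrier A"
  shows "nrm A (2 \<odot> (y \<otimes> z)) \<le> nrm A z" "nrm A (z \<ominus> 2 \<odot> (h \<otimes> z)) \<le> nrm A z"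
proof -
  let ?p = "2 \<odot> (y \<otimes> z)" and ?q = "z \<ominus> 2 \<odot> (h \<otimes> z)"
  have yh: "y \<otimes> (h \<otimes> z) = h \<otimes> (y \<otimes> z)"
    using comm y h z by (simp add: mult_assoc[symmetric])
  have c: "?p\<^bold>* \<otimes> ?q = ?q\<^bold>* \<otimes> ?p"
    using y h z by (simp add: diff_eq_scale adj_add adj_smult adj_mult mult_l_distr mult_r_distr smult_mult_l
        smult_mult_r scale_scale scale_add_right mult_assoc yh)
  \<comment> \<open>Quadratic forms of \<open>h\<close>, \<open>y\<^sup>2\<close> and
    \<open>h\<^sup>2\<close> at \<open>z\<close>. The hypothesis reads
    \<open>Y \<oplus> K = H\<close>, and this cancels everything in the sum of squares except
    \<open>adj A z \<otimes> z\<close>.\<close>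
  define H where "H = z\<^bold>* \<otimes> (h \<otimes> z)"
  define Y where "Y = z\<^bold>* \<otimes> (y \<otimes> (y \<otimes> z))"
  define K where "K = z\<^bold>* \<otimes> (h \<otimes> (h \<otimes> z))"
  have car: "H \<in> carrier A" "Y \<in> carrier A" "K \<in> carrier A" using y h z by (auto simp: H_def Y_def K_def)
  have YK: "Y \<oplus> K = H"
    using arg_cong[OF eq, of "\<lambda>t. z\<^bold>* \<otimes> (t \<otimes> z)"] y h z
    by (simp add: H_def Y_def K_def mult_l_distr mult_r_distr mult_assoc)
  have "?p\<^bold>* \<otimes> ?p \<oplus> ?q\<^bold>* \<otimes> ?q
      = 4 \<odot> Y \<oplus> ((z\<^bold>* \<otimes> z \<oplus> (-2) \<odot> H) \<oplus> ((-2) \<odot> H \<oplus> 4 \<odot> K))"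
    using y h z by (simp add: diff_eq_scale adj_add adj_smult adj_mult mult_l_distr mult_r_distr smult_mult_l
        smult_mult_r scale_scale scale_add_right mult_assoc H_def K_def Y_def)
  also have "\<dots> = z\<^bold>* \<otimes> z \<oplus> ((4 \<odot> Y \<oplus> 4 \<odot> K) \<oplus> ((-2) \<odot> H \<oplus> (-2) \<odot> H))"
    using car z by (simp add: a_ac)
  also have "4 \<odot> Y \<oplus> 4 \<odot> K = 4 \<odot> H" using car by (simp add: YK scale_add_right[symmetric])
  also have "4 \<odot> H \<oplus> ((-2) \<odot> H \<oplus> (-2) \<odot> H) = \<zero>" using car by (simp add: scale_add_left[symmetric])
  finally have s: "?p\<^bold>* \<otimes> ?p \<oplus> ?q\<^bold>* \<otimes> ?q = z\<^bold>* \<otimes> z" using z by simp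
  show "nrm A ?p \<le> nrm A z" "nrm A ?q \<le> nrm A z"
    using nrm_le_of_commuting_adj[OF _ _ z c s] y h z by auto
qed

text \<open>Applying the contraction \<open>2y\<close> to \<open>y\<close> itself gives 2|y|^2 \<le>
  |y|. The hypotheses are algebraic relations, so the bound passes to the image of a solution under
  any star homomorphism.\<close>

lemma circle_nrm_le:
  assumes y: "y \<in> carrier A" "y\<^bold>* = y" and h: "h \<in> carrier A" "h\<^bold>* = h" "y \<otimes> h = h \<otimes> y"
    "y \<otimes> y \<oplus> h \<otimes> h = h"
  shows "nrm A y \<le> 1/2"
proof -
  have "2 * nrm A (y \<otimes> y) \<le> nrm A y"
    using circle_multiplier(1)[of y h y] y h by (simp add: nrm_smult)
  then have "2 * (nrm A y * nrm A y) \<le> nrm A y" using nrm_cstar[of y] y by (simp add: power2_eq_square)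
  then have "nrm A y * (2 * nrm A y) \<le> nrm A y * 1" by simp
  then have "0 < nrm A y \<Longrightarrow> 2 * nrm A y \<le> 1" by (simp only: mult_le_cancel_left_pos)
  then show ?thesis by force
qed

text \<open>\<open>h\<close> is the small root (1 - sqrt(1 - 4a^2))/2, found as the fixed point of h
  -> a^2 + h^2. On the ball of radius 1/4 this map has Lipschitz constant 1/4 + 1/4, and it
  preserves the ball since 1/16 + 1/16 \<le> 1/4. Starting at zero keeps the iterates selfadjoint
  and commuting with \<open>a\<close>, and both properties pass to the limit.\<close>

lemma circle_solution:
  assumes a: "a \<in> carrier A" "a\<^bold>* = a" "nrm A a \<le> 1/4"
  obtains h where "h \<in> carrier A" "h\<^bold>* = h" "a \<otimes> h = h \<otimes> a" "a \<otimes> a \<oplus> h \<otimes> h = h"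
proof -
  define T where "T h = a \<otimes> a \<oplus> h \<otimes> h" for h
  define u where "u n = (T ^^ n) \<zero>" for n
  have u_Suc: "u (Suc n) = T (u n)" for n by (simp add: u_def)
  have u: "u n \<in> carrier A \<and> (u n)\<^bold>* = u n \<and> a \<otimes> u n = u n \<otimes> a \<and> nrm A (u n) \<le> 1/4" for n
  proof (induction n)
    case 0 show ?case using a by (simp add: u_def)
  next
    case (Suc n)
    note IH = Suc[THEN conjunct1] Suc[THEN conjunct2, THEN conjunct1]
      Suc[THEN conjunct2, THEN conjunct2, THEN conjunct1] Suc[THEN conjunct2, THEN conjunct2, THEN conjunct2]
    have "a \<otimes> (u n \<otimes> u n) = (u n \<otimes> u n) \<otimes> a"
      using IH a by (metis mult_assoc)
    moreover have "nrm A (T (u n)) \<le> nrm A a * nrm A a + nrm A (u n) * nrm A (u n)"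
      unfolding T_def using nrm_triangle[of "a \<otimes> a" "u n \<otimes> u n"] nrm_mult[of a a] nrm_mult[of "u n" "u n"] a IH
      by auto
    moreover have "nrm A a * nrm A a + nrm A (u n) * nrm A (u n) \<le> 1/4 * (1/4) + 1/4 * (1/4)"
      using a IH by (intro add_mono mult_mono) (auto simp: nrm_nonneg)
    ultimately show ?case
      using IH a by (auto simp: u_Suc T_def adj_add adj_mult mult_l_distr mult_r_distr mult_assoc)
  qed
  then have uc: "\<And>n. u n \<in> carrier A" by blast
  have lip: "nrm A (T x \<ominus> T y) \<le> 1/2 * nrm A (x \<ominus> y)"
    if x: "x \<in> carrier A" "nrm A x \<le> 1/4" and y: "y \<in> carrier A" "nrm A y \<le> 1/4" for x y
  proof -
    have "nrm A (T x \<ominus> T y) = nrm A (x \<otimes> x \<ominus> y \<otimes> y)"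
      unfolding T_def using x y a by (simp add: add_diff_add)
    also have "\<dots> \<le> nrm A (x \<otimes> (x \<ominus> y)) + nrm A ((x \<ominus> y) \<otimes> y)"
      using nrm_diff_triangle[of "x \<otimes> x" "x \<otimes> y" "y \<otimes> y"] x y by (simp add: mult_diff_left mult_diff_right)
    also have "\<dots> \<le> nrm A x * nrm A (x \<ominus> y) + nrm A (x \<ominus> y) * nrm A y"
      using nrm_mult x y by (intro add_mono) auto
    also have "\<dots> \<le> 1/4 * nrm A (x \<ominus> y) + nrm A (x \<ominus> y) * (1/4)"
      using x y by (intro add_mono mult_left_mono mult_right_mono) (auto simp: nrm_nonneg)
    finally show ?thesis by simp
  qed
  have "nrm A (u (Suc n) \<ominus> u n) \<le> nrm A (u 1 \<ominus> u 0) * (1/2) ^ n" for n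
  proof (induction n)
    case (Suc n)
    have "nrm A (u (Suc (Suc n)) \<ominus> u (Suc n)) \<le> 1/2 * nrm A (u (Suc n) \<ominus> u n)"
      using lip[of "u (Suc n)" "u n"] u by (simp add: u_Suc[symmetric])
    then show ?case using Suc by simp
  qed simp
  then obtain h where h: "converges u h" by (rule geometric_converges[OF uc, rotated 2]) auto
  note hc = convergesD(2)[OF h]
  have "converges u (h\<^bold>*)" using converges_adj[OF h] u by simp
  then have 1: "h\<^bold>* = h" using converges_unique h by blast
  have "converges (\<lambda>n. u n \<otimes> a) (a \<otimes> h)" using converges_mult[OF converges_const[OF a(1)] h] u by simp
  then have 2: "a \<otimes> h = h \<otimes> a" using converges_unique converges_mult[OF h converges_const[OF a(1)]] by blast
  have "converges (\<lambda>n. u (Suc n)) (a \<otimes> a \<oplus> h \<otimes> h)"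
    unfolding u_Suc T_def using a h by (intro converges_add converges_mult converges_const) auto
  then have "a \<otimes> a \<oplus> h \<otimes> h = h" using converges_unique converges_Suc[OF h] by blast
  then show thesis using that hc 1 2 by blast
qed

text \<open>The solution \<open>y\<close> is \<open>b (1 + b\<^sup>2)\<inverse>\<close>.\<close>

lemma cayley_solution:
  assumes b: "b \<in> carrier A" "b\<^bold>* = b"
  obtains y where "y \<in> carrier A" "y\<^bold>* = y" "nrm A y \<le> 1/2" "y \<oplus> b \<otimes> (b \<otimes> y) = b"
proof -
  \<comment> \<open>The factor 4 brings \<open>b / r\<close> into the ball of radius 1/4; the
    summand 4 keeps \<open>r\<close> positive when \<open>b\<close> is zero.\<close>
  define r where "r = 4 * nrm A b + 4"
  have r: "r > 0" "nrm A b / r \<le> 1/4" using nrm_nonneg[OF b(1)] by (auto simp: r_def field_simps)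
  define a where "a = complex_of_real (1 / r) \<odot> b"
  have a: "a \<in> carrier A" "a\<^bold>* = a" "nrm A a \<le> 1/4"
    using b r by (auto simp: a_def adj_smult nrm_smult norm_divide)
  obtain h where h: "h \<in> carrier A" "h\<^bold>* = h" "a \<otimes> h = h \<otimes> a" "a \<otimes> a \<oplus> h \<otimes> h = h"
    using circle_solution[OF a] by blast
  \<comment> \<open>Chosen so that, as multipliers, b^2 = 4 t a^2 and hence t (1 - 4a^2) = t -
    b^2.\<close>
  define t where "t = r\<^sup>2 / 4"
  have t: "t > 0" using r by (simp add: t_def)
  \<comment> \<open>This is positivity of \<open>b\<^sup>2\<close>: as multipliers, \<open>(1 - 2h)\<^sup>2 = 1 - 4a\<^sup>2\<close>.\<close>
  have pos: "nrm A (complex_of_real t \<odot> z \<ominus> b \<otimes> (b \<otimes> z)) \<le> t * nrm A z" if z: "z \<in> carrier A" for z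
  proof -
    define z' where "z' = z \<ominus> 2 \<odot> (h \<otimes> z)"
    have z': "z' \<in> carrier A" using h z by (simp add: z'_def)
    have "h \<otimes> z = (a \<otimes> a \<oplus> h \<otimes> h) \<otimes> z" by (simp only: h(4))
    also have "\<dots> = a \<otimes> (a \<otimes> z) \<oplus> h \<otimes> (h \<otimes> z)"
      using a(1) h(1) z by (simp add: mult_l_distr mult_assoc)
    finally have hz: "h \<otimes> z = a \<otimes> (a \<otimes> z) \<oplus> h \<otimes> (h \<otimes> z)" .
    have bz: "b \<otimes> (b \<otimes> z) = (of_real t * 4) \<odot> (a \<otimes> (a \<otimes> z))"
      using b z r by (simp add: a_def t_def smult_mult_l smult_mult_r scale_scale field_simps power2_eq_square)
    define X where "X = a \<otimes> (a \<otimes> z)"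
    define Y where "Y = h \<otimes> (h \<otimes> z)"
    have XY: "X \<in> carrier A" "Y \<in> carrier A" using a h z by (auto simp: X_def Y_def)
    have hz': "h \<otimes> z = X \<oplus> Y" using hz unfolding X_def Y_def .
    have Z1: "z' = z \<oplus> (-2) \<odot> (X \<oplus> Y)"
      unfolding z'_def hz' using z XY by (simp add: diff_eq_scale scale_scale)
    have "h \<otimes> z' = h \<otimes> z \<ominus> 2 \<odot> Y"
      unfolding z'_def Y_def using z h(1) by (simp add: mult_diff_right smult_mult_r)
    then have Z2: "h \<otimes> z' = (X \<oplus> Y) \<oplus> (-2) \<odot> Y"
      unfolding hz' using XY by (simp add: diff_eq_scale scale_scale)
    have "z' \<ominus> 2 \<odot> (h \<otimes> z') = (z \<oplus> ((-2) \<odot> X \<oplus> (-2) \<odot> Y)) \<oplus> (((-2) \<odot> X \<oplus> (-2) \<odot> Y) \<oplus> 4 \<odot> Y)"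
      unfolding Z2 unfolding Z1 using z XY by (simp add: diff_eq_scale scale_add_right scale_scale a_assoc scale_add_left[symmetric])
    also have "\<dots> = z \<oplus> (((-2) \<odot> X \<oplus> (-2) \<odot> X) \<oplus> (((-2) \<odot> Y \<oplus> (-2) \<odot> Y) \<oplus> 4 \<odot> Y))"
      using z XY by (simp add: a_ac)
    also have "((-2) \<odot> Y \<oplus> (-2) \<odot> Y) \<oplus> 4 \<odot> Y = \<zero>"
      using XY by (simp add: scale_add_left[symmetric])
    also have "(-2) \<odot> X \<oplus> (-2) \<odot> X = (-4) \<odot> X"
      using XY by (simp add: scale_add_left[symmetric])
    finally have e1: "z' \<ominus> 2 \<odot> (h \<otimes> z') = z \<ominus> 4 \<odot> X" using z XY by (simp add: diff_eq_scale scale_scale)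
    have e2: "of_real t \<odot> (z \<ominus> 4 \<odot> X) = of_real t \<odot> z \<ominus> b \<otimes> (b \<otimes> z)"
      using z XY bz by (simp add: scale_diff_right scale_scale X_def)
    have "nrm A (z' \<ominus> 2 \<odot> (h \<otimes> z')) \<le> nrm A z'"
      using circle_multiplier(2)[OF a(1,2) h z'] .
    also have "\<dots> \<le> nrm A z" unfolding z'_def
      using circle_multiplier(2)[OF a(1,2) h z] .
    finally have "t * nrm A (z \<ominus> 4 \<odot> X) \<le> t * nrm A z"
      unfolding e1 using t by (intro mult_left_mono) auto
    then show ?thesis
      unfolding e2[symmetric] using t z XY by (simp add: nrm_smult)
  qed
  \<comment> \<open>The equation for \<open>y\<close> is rewritten as (1 + t) y = b + (t - b^2) y;
    after division by 1 + t, the bound \<open>pos\<close> makes the right side a contraction with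
    factor t/(1 + t).\<close>
  define T where "T y = complex_of_real (1 / (1 + t)) \<odot> (b \<oplus> (complex_of_real t \<odot> y \<ominus> b \<otimes> (b \<otimes> y)))" for y
  define u where "u n = (T ^^ n) \<zero>" for n
  have u_Suc: "u (Suc n) = T (u n)" for n by (simp add: u_def)
  have u: "u n \<in> carrier A \<and> (u n)\<^bold>* = u n \<and> b \<otimes> u n = u n \<otimes> b" for n
  proof (induction n)
    case 0 show ?case using b by (simp add: u_def)
  next
    case (Suc n)
    then have IH: "u n \<in> carrier A" "(u n)\<^bold>* = u n" "u n \<otimes> b = b \<otimes> u n" by auto
    have *: "u n \<otimes> (b \<otimes> b) = b \<otimes> (b \<otimes> u n)" using IH b by (metis mult_assoc)
    show ?case
      unfolding u_Suc T_def using IH b *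
      by (simp add: diff_eq_scale adj_add adj_smult adj_mult mult_l_distr mult_r_distr smult_mult_l
        smult_mult_r scale_scale scale_add_right mult_assoc)
  qed
  then have uc: "\<And>n. u n \<in> carrier A" by blast
  have lip: "nrm A (T x \<ominus> T y) \<le> t / (1 + t) * nrm A (x \<ominus> y)"
    if x: "x \<in> carrier A" and y: "y \<in> carrier A" for x y
  proof -
    have "T x \<ominus> T y = complex_of_real (1 / (1 + t)) \<odot> (complex_of_real t \<odot> (x \<ominus> y) \<ominus> b \<otimes> (b \<otimes> (x \<ominus> y)))"
      unfolding T_def using x y b
      by (simp add: scale_diff_right[symmetric] add_diff_add mult_diff_right)
        (simp add: diff_eq_scale scale_add_right scale_scale a_ac mult_ac)
    then have "nrm A (T x \<ominus> T y) = 1 / (1 + t) * nrm A (complex_of_real t \<odot> (x \<ominus> y) \<ominus> b \<otimes> (b \<otimes> (x \<ominus> y)))"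
      using nrm_smult[of "complex_of_real t \<odot> (x \<ominus> y) \<ominus> b \<otimes> (b \<otimes> (x \<ominus> y))" "complex_of_real (1 / (1 + t))"] b x y t
      by (simp del: of_real_divide of_real_add)
    also have "\<dots> \<le> 1 / (1 + t) * (t * nrm A (x \<ominus> y))"
      using pos[of "x \<ominus> y"] x y t by (intro mult_left_mono) auto
    finally show ?thesis by simp
  qed
  have step: "nrm A (u (Suc n) \<ominus> u n) \<le> nrm A (u 1 \<ominus> u 0) * (t / (1 + t)) ^ n" for n
  proof (induction n)
    case (Suc n)
    have "nrm A (u (Suc (Suc n)) \<ominus> u (Suc n)) \<le> t / (1 + t) * nrm A (u (Suc n) \<ominus> u n)"
      using lip[of "u (Suc n)" "u n"] uc by (simp add: u_Suc[symmetric])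
    also have "\<dots> \<le> t / (1 + t) * (nrm A (u 1 \<ominus> u 0) * (t / (1 + t)) ^ n)"
      using Suc t by (intro mult_left_mono) auto
    finally show ?case by (simp add: mult_ac)
  qed simp
  obtain y where y: "converges u y"
    by (rule geometric_converges[OF uc _ _ step]) (use t in auto)
  note yc = convergesD(2)[OF y]
  have "converges u (y\<^bold>*)" using converges_adj[OF y] u by simp
  then have 1: "y\<^bold>* = y" using converges_unique y by blast
  have "converges (\<lambda>n. u n \<otimes> b) (b \<otimes> y)" using converges_mult[OF converges_const[OF b(1)] y] u by simp
  then have 2: "b \<otimes> y = y \<otimes> b" using converges_unique converges_mult[OF y converges_const[OF b(1)]] by blast
  have "converges (\<lambda>n. u (Suc n)) (T y)"
    unfolding u_Suc T_def using b y
    by (intro converges_add converges_diff converges_scale converges_mult converges_const) auto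
  then have "T y = y" using converges_unique converges_Suc[OF y] by blast
  then have "complex_of_real (1 + t) \<odot> y = complex_of_real (1 + t) \<odot> T y" by simp
  also have "\<dots> = b \<oplus> (complex_of_real t \<odot> y \<ominus> b \<otimes> (b \<otimes> y))"
  proof -
    have "complex_of_real (1 + t) * complex_of_real (1 / (1 + t)) = 1"
      using t by (metis of_real_1 of_real_mult nonzero_mult_div_cancel_left times_divide_eq_right mult.right_neutral add_pos_pos less_irrefl zero_less_one)
    then show ?thesis unfolding T_def using b yc by (simp add: scale_scale del: of_real_add of_real_divide)
  qed
  finally have e: "y \<oplus> complex_of_real t \<odot> y = b \<oplus> (complex_of_real t \<odot> y \<ominus> b \<otimes> (b \<otimes> y))"
    using yc by (simp add: scale_add_left)
  have "(y \<oplus> b \<otimes> (b \<otimes> y)) \<oplus> complex_of_real t \<odot> y = (y \<oplus> complex_of_real t \<odot> y) \<oplus> b \<otimes> (b \<otimes> y)"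
    using b yc by (simp add: a_ac)
  also have "\<dots> = b \<oplus> complex_of_real t \<odot> y" unfolding e using b yc by (simp add: a_assoc)
  finally have 3: "y \<oplus> b \<otimes> (b \<otimes> y) = b" using b yc by simp
  \<comment> \<open>Multiplying y + b^2 y = b by \<open>y\<close> shows that \<open>y\<close> and
    \<open>b \<otimes> y\<close> solve the circle equation.\<close>
  have "nrm A y \<le> 1/2"
  proof (rule circle_nrm_le[OF yc 1])
    show "b \<otimes> y \<in> carrier A" using b yc by simp
    show "(b \<otimes> y)\<^bold>* = b \<otimes> y" using b yc 1 2 by (simp add: adj_mult)
    show "y \<otimes> (b \<otimes> y) = (b \<otimes> y) \<otimes> y" using 2 b yc by (metis mult_assoc)
    have "b \<otimes> y = (y \<oplus> b \<otimes> (b \<otimes> y)) \<otimes> y" by (simp add: 3)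
    also have "\<dots> = y \<otimes> y \<oplus> (b \<otimes> y) \<otimes> (b \<otimes> y)"
      using b yc 2 by (simp add: mult_l_distr) (metis mult_assoc mult_closed)
    finally show "y \<otimes> y \<oplus> (b \<otimes> y) \<otimes> (b \<otimes> y) = b \<otimes> y" by simp
  qed
  then show thesis using that yc 1 3 by blast
qed

subsection \<open>Iterated squares\<close>

text \<open>Iterated squares need no unit, and for selfadjoint elements the C*-identity computes
  their norms exactly.\<close>

definition squares :: "nat \<Rightarrow> 'a \<Rightarrow> 'a" where
  "squares m x = ((\<lambda>y. y \<otimes> y) ^^ m) x"

lemma squares_Suc [simp]: "squares (Suc m) x = squares m x \<otimes> squares m x"
  and squares_0 [simp]: "squares 0 x = x"
  by (simp_all add: squares_def)

lemma squares_selfadjoint: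
  assumes "x \<in> carrier A" "x\<^bold>* = x"
  shows "squares m x \<in> carrier A \<and> (squares m x)\<^bold>* = squares m x \<and> nrm A (squares m x) = nrm A x ^ (2 ^ m)"
proof (induction m)
  case (Suc m)
  then show ?case
    using nrm_cstar[of "squares m x"] by (simp add: adj_mult power_mult[symmetric] mult.commute)
qed (use assms in simp)

end

text \<open>For 0 < y < x the quotients (x/y)^(2^m) exceed any \<open>K\<close>; for y = 0 the case
  m = 0 already decides.\<close>

lemma le_of_power_le:
  fixes x y K :: real
  assumes x: "0 \<le> x" and y: "0 \<le> y" and le: "\<And>m. x ^ (2 ^ m) \<le> K * y ^ (2 ^ m)"
  shows "x \<le> y"
proof (rule ccontr)
  assume "\<not> x \<le> y"
  then have xy: "y < x" by simp
  have K: "0 < K"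
    using le[of 0] xy y mult_nonpos_nonneg[of K y] by (cases "K \<le> 0") auto
  show False
  proof (cases "y = 0")
    case True
    then show False using le[of 0] xy by simp
  next
    case False
    then have y: "0 < y" using y by simp
    define q where "q = x / y"
    have q: "1 < q" using xy y by (simp add: q_def)
    have "q ^ (2 ^ m) \<le> K" for m
      using le[of m] y by (simp add: q_def power_divide divide_le_eq)
    moreover obtain n where "K < q ^ n" using real_arch_pow[OF q] by blast
    moreover have "q ^ n \<le> q ^ (2 ^ n)" using q by (intro power_increasing) (auto intro: less_imp_le)
    ultimately show False by (meson less_le_trans not_less)
  qed
qed

section \<open>Sums, closures and homomorphisms\<close>

context cstar_algebra
begin

lemma nrm_finsum_le:
  assumes "f \<in> I \<rightarrow> carrier A"
  shows "nrm A (\<Oplus>i\<in>I. f i) \<le> (\<Sum>i\<in>I. nrm A (f i))"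
  using assms
proof (induction I rule: infinite_finite_induct)
  case (insert i I)
  then show ?case
    using nrm_triangle[of "f i" "\<Oplus>i\<in>I. f i"] by (auto simp: finsum_insert Pi_iff intro!: finsum_closed)
qed simp_all

lemma scale_finsum:
  "f \<in> I \<rightarrow> carrier A \<Longrightarrow> a \<odot> (\<Oplus>i\<in>I. f i) = (\<Oplus>i\<in>I. a \<odot> f i)"
  by (induction I rule: infinite_finite_induct) (auto simp: scale_add_right Pi_iff intro!: finsum_closed)

lemma mult_finsum_left:
  "\<lbrakk>f \<in> I \<rightarrow> carrier A; x \<in> carrier A\<rbrakk> \<Longrightarrow> (\<Oplus>i\<in>I. f i) \<otimes> x = (\<Oplus>i\<in>I. f i \<otimes> x)"
  by (induction I rule: infinite_finite_induct) (auto simp: mult_l_distr Pi_iff intro!: finsum_closed)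

lemma mult_finsum_right:
  "\<lbrakk>f \<in> I \<rightarrow> carrier A; x \<in> carrier A\<rbrakk> \<Longrightarrow> x \<otimes> (\<Oplus>i\<in>I. f i) = (\<Oplus>i\<in>I. x \<otimes> f i)"
  by (induction I rule: infinite_finite_induct) (auto simp: mult_r_distr Pi_iff intro!: finsum_closed)

lemma finsum_zero_extend:
  assumes "finite J" "I \<subseteq> J" "\<And>i. i \<in> J - I \<Longrightarrow> f i = \<zero>" "\<And>i. i \<in> I \<Longrightarrow> f i \<in> carrier A"
  shows "(\<Oplus>i\<in>I. f i) = (\<Oplus>i\<in>J. f i)"
proof (rule add.finprod_mono_neutral_cong_left)
  show "f \<in> J \<rightarrow> carrier A"
  proof
    fix i assume "i \<in> J" then show "f i \<in> carrier A" using assms by (cases "i \<in> I") auto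
  qed
qed (use assms in auto)

lemma finsum_diff:
  assumes "f \<in> I \<rightarrow> carrier A" "g \<in> I \<rightarrow> carrier A"
  shows "(\<Oplus>i\<in>I. f i) \<ominus> (\<Oplus>i\<in>I. g i) = (\<Oplus>i\<in>I. f i \<ominus> g i)"
  using assms
  by (induction I rule: infinite_finite_induct) (auto simp: add_diff_add Pi_iff intro!: finsum_closed)

section \<open>Sequential closures and density in generated subalgebras\<close>

lemma closure_of_iff_converges:
  assumes "S \<subseteq> carrier A"
  shows "x \<in> Abstract_Topology.closure_of mtopology S \<longleftrightarrow> (\<exists>u. (\<forall>n. u n \<in> S) \<and> converges u x)"
proof
  assume "x \<in> Abstract_Topology.closure_of mtopology S"
  then have x: "x \<in> carrier A" and approx: "\<And>r. r > 0 \<Longrightarrow> \<exists>y\<in>S. y \<in> mball x r"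
    unfolding metric_closure_of by auto
  have "\<forall>n. \<exists>y. y \<in> S \<and> nrm A (y \<ominus> x) \<le> 1 / real (Suc n)"
  proof
    fix n
    obtain y where "y \<in> S" "y \<in> mball x (1 / real (Suc n))" using approx[of "1 / real (Suc n)"] by auto
    then show "\<exists>y. y \<in> S \<and> nrm A (y \<ominus> x) \<le> 1 / real (Suc n)"
      using x by (intro exI[of _ y]) (auto simp: cdist_def nrm_diff_commute[of y x] split: if_splits)
  qed
  then obtain u where u: "\<And>n. u n \<in> S" "\<And>n. nrm A (u n \<ominus> x) \<le> 1 / real (Suc n)" by metis
  have "converges u x"
    by (rule convergesI[OF _ x u(2)]) (use u assms LIMSEQ_Suc[OF lim_1_over_n] in auto)
  then show "\<exists>u. (\<forall>n. u n \<in> S) \<and> converges u x" using u by blast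
next
  assume "\<exists>u. (\<forall>n. u n \<in> S) \<and> converges u x"
  then obtain u where u: "\<And>n. u n \<in> S" "converges u x" by blast
  note c = convergesD[OF u(2)]
  have "\<exists>y\<in>S. y \<in> mball x r" if r: "r > 0" for r
  proof -
    obtain n where "norm (nrm A (u n \<ominus> x) - 0) < r"
      using LIMSEQ_D[of "\<lambda>n. nrm A (u n \<ominus> x)" 0 r] r u(2) unfolding converges_def by blast
    then have "u n \<in> mball x r"
      using c by (simp add: cdist_def nrm_diff_commute[of x] nrm_nonneg)
    then show ?thesis using u(1) by blast
  qed
  then show "x \<in> Abstract_Topology.closure_of mtopology S"
    unfolding metric_closure_of using c by blast
qed

lemma cstar_subalgebra_closure_of:
  assumes S: "S \<subseteq> carrier A" "\<zero> \<in> S" "\<And>x y. \<lbrakk>x \<in> S; y \<in> S\<rbrakk> \<Longrightarrow> x \<oplus> y \<in> S"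
    "\<And>a x. x \<in> S \<Longrightarrow> a \<odot> x \<in> S" "\<And>x y. \<lbrakk>x \<in> S; y \<in> S\<rbrakk> \<Longrightarrow> x \<otimes> y \<in> S"
    "\<And>x. x \<in> S \<Longrightarrow> x\<^bold>* \<in> S"
  shows "cstar_subalgebra (Abstract_Topology.closure_of mtopology S) A"
  unfolding cstar_subalgebra_def ctopology_eq
proof (intro conjI ballI allI)
  let ?C = "Abstract_Topology.closure_of mtopology S"
  have closureI: "y \<in> ?C" if "\<And>n. v n \<in> S" "converges v y" for v y
    using that closure_of_iff_converges[OF S(1)] by blast
  have closureE: "\<exists>u. (\<forall>n. u n \<in> S) \<and> converges u x" if "x \<in> ?C" for x
    using that closure_of_iff_converges[OF S(1)] by blast
  show "closedin mtopology ?C" by simp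
  show "\<zero> \<in> ?C"
    by (rule closureI[OF _ converges_const]) (use S(2) in auto)
  fix x assume "x \<in> ?C"
  then obtain u where u: "\<And>n. u n \<in> S" "converges u x" using closureE by blast
  show "a \<odot> x \<in> ?C" for a
    by (rule closureI[OF _ converges_scale[OF u(2)]]) (rule S(4)[OF u(1)])
  show "x\<^bold>* \<in> ?C"
    by (rule closureI[OF _ converges_adj[OF u(2)]]) (rule S(6)[OF u(1)])
  fix y assume "y \<in> ?C"
  then obtain v where v: "\<And>n. v n \<in> S" "converges v y" using closureE by blast
  show "x \<oplus> y \<in> ?C"
    by (rule closureI[OF _ converges_add[OF u(2) v(2)]]) (rule S(3)[OF u(1) v(1)])
  show "x \<otimes> y \<in> ?C"
    by (rule closureI[OF _ converges_mult[OF u(2) v(2)]]) (rule S(5)[OF u(1) v(1)])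
qed

lemma cstar_generated_subset_carrier:
  assumes "X \<subseteq> carrier A" shows "cstar_generated A X \<subseteq> carrier A"
proof -
  have "cstar_subalgebra (carrier A) A"
    unfolding cstar_subalgebra_def ctopology_eq using closedin_topspace[of mtopology] by simp
  then show ?thesis unfolding cstar_generated_def using assms by blast
qed

text \<open>The closure of \<open>S\<close> is one of the C*-subalgebras whose intersection defines
  \<open>cstar_generated\<close>.\<close>

lemma dense_in_generated:
  assumes S: "S \<subseteq> carrier A" "\<zero> \<in> S" "\<And>x y. \<lbrakk>x \<in> S; y \<in> S\<rbrakk> \<Longrightarrow> x \<oplus> y \<in> S"
    "\<And>a x. x \<in> S \<Longrightarrow> a \<odot> x \<in> S" "\<And>x y. \<lbrakk>x \<in> S; y \<in> S\<rbrakk> \<Longrightarrow> x \<otimes> y \<in> S"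
    "\<And>x. x \<in> S \<Longrightarrow> x\<^bold>* \<in> S"
    and "X \<subseteq> S" "x \<in> cstar_generated A X" "0 < e"
  obtains y where "y \<in> S" "nrm A (x \<ominus> y) < e"
proof -
  have "S \<subseteq> Abstract_Topology.closure_of mtopology S" using S(1) by (simp add: closure_of_subset)
  then have "x \<in> Abstract_Topology.closure_of mtopology S"
    using assms(7,8) cstar_subalgebra_closure_of[OF S] unfolding cstar_generated_def by blast
  then obtain u where u: "\<And>n. u n \<in> S" "converges u x"
    unfolding closure_of_iff_converges[OF S(1)] by blast
  then obtain n where "norm (nrm A (u n \<ominus> x) - 0) < e"
    using LIMSEQ_D[of "\<lambda>n. nrm A (u n \<ominus> x)" 0 e] \<open>0 < e\<close> unfolding converges_def by blast
  then have "nrm A (x \<ominus> u n) < e"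
    using u convergesD[OF u(2)] nrm_diff_commute[of x "u n"] by (simp add: nrm_nonneg)
  then show thesis using that u(1) by blast
qed

end

section \<open>Star homomorphisms: contractivity, lifting and comparison of kernels\<close>

lemma star_homD:
  assumes "star_hom A B \<phi>"
  shows "x \<in> carrier A \<Longrightarrow> \<phi> x \<in> carrier B"
    "\<lbrakk>x \<in> carrier A; y \<in> carrier A\<rbrakk> \<Longrightarrow> \<phi> (x \<oplus>\<^bsub>A\<^esub> y) = \<phi> x \<oplus>\<^bsub>B\<^esub> \<phi> y"
    "x \<in> carrier A \<Longrightarrow> \<phi> (a \<odot>\<^bsub>A\<^esub> x) = a \<odot>\<^bsub>B\<^esub> \<phi> x"
    "\<lbrakk>x \<in> carrier A; y \<in> carrier A\<rbrakk> \<Longrightarrow> \<phi> (x \<otimes>\<^bsub>A\<^esub> y) = \<phi> x \<otimes>\<^bsub>B\<^esub> \<phi> y"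
    "x \<in> carrier A \<Longrightarrow> \<phi> (adj A x) = adj B (\<phi> x)"
  using assms unfolding star_hom_def by auto

lemma star_hom_ident: "star_hom A A (\<lambda>x. x)"
  by (simp add: star_hom_def)

lemma star_hom_comp:
  "\<lbrakk>star_hom A B \<phi>; star_hom B C \<psi>\<rbrakk> \<Longrightarrow> star_hom A C (\<lambda>x. \<psi> (\<phi> x))"
  by (simp add: star_hom_def Pi_iff)

locale cstar_hom = dom: cstar_algebra A + cod: cstar_algebra B
  for A :: "('a, 'y) cstar_scheme" and B :: "('b, 'z) cstar_scheme" and \<phi> :: "'a \<Rightarrow> 'b" +
  assumes hom: "star_hom A B \<phi>"
begin

lemmas hom_simps [simp] = star_homD[OF hom]

lemma hom_zero [simp]: "\<phi> \<zero>\<^bsub>A\<^esub> = \<zero>\<^bsub>B\<^esub>"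
  using hom_simps(3)[of "\<zero>\<^bsub>A\<^esub>" 0] hom_simps(1)[of "\<zero>\<^bsub>A\<^esub>"] by simp

lemma hom_diff [simp]:
  "\<lbrakk>x \<in> carrier A; y \<in> carrier A\<rbrakk> \<Longrightarrow> \<phi> (x \<ominus>\<^bsub>A\<^esub> y) = \<phi> x \<ominus>\<^bsub>B\<^esub> \<phi> y"
  by (simp add: dom.diff_eq_scale cod.diff_eq_scale)

lemma hom_finsum:
  "f \<in> I \<rightarrow> carrier A \<Longrightarrow> \<phi> (\<Oplus>\<^bsub>A\<^esub>i\<in>I. f i) = (\<Oplus>\<^bsub>B\<^esub>i\<in>I. \<phi> (f i))"
  by (induction I rule: infinite_finite_induct) (auto simp: Pi_iff intro!: dom.finsum_closed)

lemma hom_squares: "\<lbrakk>x \<in> carrier A; adj A x = x\<rbrakk> \<Longrightarrow> \<phi> (dom.squares m x) = cod.squares m (\<phi> x)"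
  by (induction m) (simp_all add: dom.squares_selfadjoint)

end

text \<open>The power trick: on selfadjoint elements the norm of the \<open>2\<^sup>m\<close>-th power is the \<open>2\<^sup>m\<close>-th power
  of the norm, so any multiplicative constant in a comparison of two C*-seminorms can be removed.\<close>

lemma star_hom_nrm_le_of_bounded:
  assumes "cstar_algebra D" "cstar_algebra A" "cstar_algebra B"
    and "star_hom D B \<psi>" "star_hom D A \<phi>"
    and S: "S \<subseteq> carrier D" "\<And>x y. \<lbrakk>x \<in> S; y \<in> S\<rbrakk> \<Longrightarrow> x \<otimes>\<^bsub>D\<^esub> y \<in> S" "\<And>x. x \<in> S \<Longrightarrow> adj D x \<in> S"
    and bound: "\<And>x. \<lbrakk>x \<in> S; adj D x = x\<rbrakk> \<Longrightarrow> nrm B (\<psi> x) \<le> K * nrm A (\<phi> x)"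
    and x: "x \<in> S"
  shows "nrm B (\<psi> x) \<le> nrm A (\<phi> x)"
proof -
  interpret psi: cstar_hom D B \<psi> by (intro cstar_hom.intro cstar_hom_axioms.intro assms)
  interpret phi: cstar_hom D A \<phi> by (intro cstar_hom.intro cstar_hom_axioms.intro assms)
  \<comment> \<open>\<open>x\<close> enters through this selfadjoint product, whose iterated squares
    remain in \<open>S\<close>; hence one constant \<open>K\<close> serves for all powers.\<close>
  define y where "y = adj D x \<otimes>\<^bsub>D\<^esub> x"
  have xc: "x \<in> carrier D" using x S by auto
  have y: "y \<in> carrier D" "adj D y = y" using xc by (auto simp: y_def psi.dom.adj_mult)
  have ysq: "psi.dom.squares m y \<in> S" for m by (induction m) (auto simp: y_def x S)
  have "nrm B (\<psi> y) \<le> nrm A (\<phi> y)"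
  proof (rule le_of_power_le)
    show "0 \<le> nrm B (\<psi> y)" "0 \<le> nrm A (\<phi> y)" using y by (simp_all add: psi.cod.nrm_nonneg phi.cod.nrm_nonneg)
    fix m
    have sa: "adj B (\<psi> y) = \<psi> y" "adj A (\<phi> y) = \<phi> y"
      using psi.hom_simps(5)[of y] phi.hom_simps(5)[of y] y by auto
    have "nrm B (\<psi> (psi.dom.squares m y)) \<le> K * nrm A (\<phi> (psi.dom.squares m y))"
      using ysq psi.dom.squares_selfadjoint[OF y] by (intro bound) auto
    then show "nrm B (\<psi> y) ^ 2 ^ m \<le> K * nrm A (\<phi> y) ^ 2 ^ m"
      using psi.cod.squares_selfadjoint[OF _ sa(1), of m] phi.cod.squares_selfadjoint[OF _ sa(2), of m] y
      by (simp add: psi.hom_squares phi.hom_squares)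
  qed
  then have "(nrm B (\<psi> x))\<^sup>2 \<le> (nrm A (\<phi> x))\<^sup>2"
    using psi.cod.nrm_cstar[of "\<psi> x"] phi.cod.nrm_cstar[of "\<phi> x"] xc by (simp add: y_def)
  then show ?thesis by (rule power2_le_imp_le) (use xc in \<open>simp add: phi.cod.nrm_nonneg\<close>)
qed

context cstar_hom
begin

text \<open>A solution of \<open>a\<^sup>2 + h\<^sup>2 = h\<close> is carried to a solution, which bounds the image of \<open>a\<close>.\<close>

lemma hom_nrm_le:
  assumes "x \<in> carrier A"
  shows "nrm B (\<phi> x) \<le> nrm A x"
proof (rule star_hom_nrm_le_of_bounded[where S = "carrier A" and D = A and K = 2,
      OF dom.cstar_algebra_axioms dom.cstar_algebra_axioms cod.cstar_algebra_axioms hom star_hom_ident])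
  fix a assume a: "a \<in> carrier A" "adj A a = a"
  show "nrm B (\<phi> a) \<le> 2 * nrm A a"
  proof (cases "nrm A a = 0")
    case True
    then have "a = \<zero>\<^bsub>A\<^esub>" using a dom.nrm_eq_0 by blast
    then show ?thesis by simp
  next
    case False
    then have pos: "nrm A a > 0" using dom.nrm_nonneg[OF a(1)] by simp
    \<comment> \<open>Scaled to norm 1/4, where \<open>circle_solution\<close> applies; the bound
      1/2 on the image then costs the factor 2.\<close>
    define b where "b = complex_of_real (1 / (4 * nrm A a)) \<odot>\<^bsub>A\<^esub> a"
    have b: "b \<in> carrier A" "adj A b = b" "nrm A b \<le> 1/4"
      using a pos by (auto simp: b_def dom.adj_smult dom.nrm_smult norm_divide norm_mult)
    obtain h where h: "h \<in> carrier A" "adj A h = h" "b \<otimes>\<^bsub>A\<^esub> h = h \<otimes>\<^bsub>A\<^esub> b" "b \<otimes>\<^bsub>A\<^esub> b \<oplus>\<^bsub>A\<^esub> h \<otimes>\<^bsub>A\<^esub> h = h"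
      using dom.circle_solution[OF b] by blast
    have "nrm B (\<phi> b) \<le> 1/2"
    proof (rule cod.circle_nrm_le[of _ "\<phi> h"])
      show "adj B (\<phi> b) = \<phi> b" using hom_simps(5)[OF b(1)] b(2) by simp
      show "adj B (\<phi> h) = \<phi> h" using hom_simps(5)[OF h(1)] h(2) by simp
      show "\<phi> b \<otimes>\<^bsub>B\<^esub> \<phi> h = \<phi> h \<otimes>\<^bsub>B\<^esub> \<phi> b"
        using arg_cong[OF h(3), of \<phi>] b(1) h(1) by simp
      show "\<phi> b \<otimes>\<^bsub>B\<^esub> \<phi> b \<oplus>\<^bsub>B\<^esub> \<phi> h \<otimes>\<^bsub>B\<^esub> \<phi> h = \<phi> h"
        using hom_simps(2)[of "b \<otimes>\<^bsub>A\<^esub> b" "h \<otimes>\<^bsub>A\<^esub> h"] b(1) h(1) unfolding h(4) by simp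
    qed (use b h in simp_all)
    then have "1 / (4 * nrm A a) * nrm B (\<phi> a) \<le> 1 / 2"
      using a pos by (simp add: b_def cod.nrm_smult norm_divide norm_mult)
    then show ?thesis using pos by (simp add: field_simps)
  qed
qed (use assms in auto)

lemma hom_converges: "dom.converges u x \<Longrightarrow> cod.converges (\<lambda>n. \<phi> (u n)) (\<phi> x)"
  by (rule cod.convergesI[where e = "\<lambda>n. nrm A (u n \<ominus>\<^bsub>A\<^esub> x)"])
    (auto simp: dom.converges_def hom_nrm_le simp flip: hom_diff)

text \<open>Cutting \<open>b\<close> down to \<open>b (1 + b\<^sup>2)\<inverse>\<close>, suitably rescaled, changes its image only to third order.\<close>

lemma approximate_lift:
  assumes b: "b \<in> carrier A" "adj A b = b" and d: "0 < d" "nrm B (\<phi> b) \<le> d"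
  obtains b' where "b' \<in> carrier A" "adj A b' = b'" "nrm A b' \<le> d" "nrm B (\<phi> (b \<ominus>\<^bsub>A\<^esub> b')) \<le> d / 4"
proof -
  \<comment> \<open>The scale \<open>1 / (2 * d)\<close> makes the norm of the image of
    \<open>b1\<close> at most 1/2. Then the image of b1^2 y has norm at most 1/8, and scaling back
    by 2d gives d/4 for the error and d for the norm of \<open>b'\<close>.\<close>
  define b1 where "b1 = complex_of_real (1 / (2 * d)) \<odot>\<^bsub>A\<^esub> b"
  have b1: "b1 \<in> carrier A" "adj A b1 = b1" using b by (auto simp: b1_def dom.adj_smult)
  have nb1: "nrm B (\<phi> b1) \<le> 1/2"
    using d b by (simp add: b1_def cod.nrm_smult norm_divide norm_mult field_simps)
  obtain y where y: "y \<in> carrier A" "adj A y = y" "nrm A y \<le> 1/2" "y \<oplus>\<^bsub>A\<^esub> b1 \<otimes>\<^bsub>A\<^esub> (b1 \<otimes>\<^bsub>A\<^esub> y) = b1"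
    using dom.cayley_solution[OF b1] by blast
  have byy: "b1 \<ominus>\<^bsub>A\<^esub> y = b1 \<otimes>\<^bsub>A\<^esub> (b1 \<otimes>\<^bsub>A\<^esub> y)"
  proof -
    have "b1 \<otimes>\<^bsub>A\<^esub> (b1 \<otimes>\<^bsub>A\<^esub> y) \<oplus>\<^bsub>A\<^esub> y = (b1 \<ominus>\<^bsub>A\<^esub> y) \<oplus>\<^bsub>A\<^esub> y"
      using y(1) b1(1) dom.a_comm[of y "b1 \<otimes>\<^bsub>A\<^esub> (b1 \<otimes>\<^bsub>A\<^esub> y)"] y(4) by simp
    then show ?thesis
      using dom.add.right_cancel[of y "b1 \<otimes>\<^bsub>A\<^esub> (b1 \<otimes>\<^bsub>A\<^esub> y)" "b1 \<ominus>\<^bsub>A\<^esub> y"] y(1) b1(1)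
      by (simp del: dom.diff_add_cancel)
  qed
  have "nrm B (\<phi> (b1 \<ominus>\<^bsub>A\<^esub> y)) \<le> nrm B (\<phi> b1) * (nrm B (\<phi> b1) * nrm B (\<phi> y))"
    unfolding byy using cod.nrm_mult[of "\<phi> b1" "\<phi> b1 \<otimes>\<^bsub>B\<^esub> \<phi> y"] cod.nrm_mult[of "\<phi> b1" "\<phi> y"] b1(1) y(1)
      mult_left_mono[OF cod.nrm_mult[of "\<phi> b1" "\<phi> y"] cod.nrm_nonneg[of "\<phi> b1"]] by simp
  also have "\<dots> \<le> 1/2 * (1/2 * (1/2))"
    using nb1 y(3) hom_nrm_le[OF y(1)] b1(1) y(1)
    by (intro mult_mono) (auto simp: cod.nrm_nonneg)
  finally have n: "nrm B (\<phi> (b1 \<ominus>\<^bsub>A\<^esub> y)) \<le> 1/8" by simp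
  define b' where "b' = complex_of_real (2 * d) \<odot>\<^bsub>A\<^esub> y"
  have b': "b' \<in> carrier A" "adj A b' = b'" using y by (auto simp: b'_def dom.adj_smult)
  have b'n: "nrm A b' \<le> d" using y(1,3) d by (simp add: b'_def dom.nrm_smult norm_mult)
  have "b = complex_of_real (2 * d) \<odot>\<^bsub>A\<^esub> b1" using b d by (simp add: b1_def dom.scale_scale)
  then have "b \<ominus>\<^bsub>A\<^esub> b' = complex_of_real (2 * d) \<odot>\<^bsub>A\<^esub> (b1 \<ominus>\<^bsub>A\<^esub> y)"
    using b1(1) y(1) by (simp add: b'_def dom.scale_diff_right)
  then have "nrm B (\<phi> (b \<ominus>\<^bsub>A\<^esub> b')) = 2 * d * nrm B (\<phi> (b1 \<ominus>\<^bsub>A\<^esub> y))"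
    using b1(1) y(1) d by (simp add: cod.nrm_smult norm_mult del: hom_diff)
  then show thesis using that[OF b' b'n] n d by simp
qed

text \<open>Each remainder \<open>r n\<close> is approximated by \<open>approximate_lift\<close> and
  the approximation is subtracted, so that the bound on the image shrinks by the factor 1/4. The
  remainders converge to an element \<open>l\<close> of the kernel; \<open>b\<close> minus
  \<open>l\<close> is the lift, of norm at most the sum of the norms of the corrections.\<close>

lemma bounded_lift:
  assumes b: "b \<in> carrier A" "adj A b = b" and d: "0 < d" "nrm B (\<phi> b) \<le> d"
  obtains x where "x \<in> carrier A" "nrm A x \<le> 2 * d" "\<phi> x = \<phi> b"
proof -
  \<comment> \<open>The clause for n = 0 makes the chosen sequence start at
    \<open>b\<close>.\<close>
  define P where "P n r \<longleftrightarrow> r \<in> carrier A \<and> adj A r = r \<and> nrm B (\<phi> r) \<le> d * (1/4) ^ n \<and> (n = 0 \<longrightarrow> r = b)"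
    for n r
  have "\<exists>r. \<forall>n. P n (r n) \<and> nrm A (r (Suc n) \<ominus>\<^bsub>A\<^esub> r n) \<le> d * (1/4) ^ n"
  proof (rule dependent_nat_choice)
    show "\<exists>r. P 0 r" using b d by (auto simp: P_def)
    fix r n assume "P n r"
    then have r: "r \<in> carrier A" "adj A r = r" "nrm B (\<phi> r) \<le> d * (1/4) ^ n" by (auto simp: P_def)
    have "0 < d * (1/4) ^ n" using d by simp
    then obtain b' where b': "b' \<in> carrier A" "adj A b' = b'" "nrm A b' \<le> d * (1/4) ^ n"
      "nrm B (\<phi> (r \<ominus>\<^bsub>A\<^esub> b')) \<le> d * (1/4) ^ n / 4"
      using approximate_lift[OF r(1,2) _ r(3)] by blast
    have "(r \<ominus>\<^bsub>A\<^esub> b') \<ominus>\<^bsub>A\<^esub> r = (r \<ominus>\<^bsub>A\<^esub> r) \<oplus>\<^bsub>A\<^esub> (-1) \<odot>\<^bsub>A\<^esub> b'"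
      using r(1) b'(1) unfolding dom.diff_eq_scale[OF r(1) r(1)] by (simp add: dom.diff_eq_scale dom.a_ac)
    also have "\<dots> = (-1) \<odot>\<^bsub>A\<^esub> b'" using r(1) b'(1) by simp
    finally have "nrm A ((r \<ominus>\<^bsub>A\<^esub> b') \<ominus>\<^bsub>A\<^esub> r) = nrm A b'"
      using b'(1) by (simp add: dom.nrm_smult)
    then show "\<exists>r'. P (Suc n) r' \<and> nrm A (r' \<ominus>\<^bsub>A\<^esub> r) \<le> d * (1/4) ^ n"
      using r b' by (intro exI[of _ "r \<ominus>\<^bsub>A\<^esub> b'"]) (simp add: P_def dom.adj_diff)
  qed
  then obtain r where r: "\<And>n. P n (r n)" and step: "\<And>n. nrm A (r (Suc n) \<ominus>\<^bsub>A\<^esub> r n) \<le> d * (1/4) ^ n"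
    by blast
  have rc: "\<And>n. r n \<in> carrier A" and r0: "r 0 = b" and small: "\<And>n. nrm B (\<phi> (r n)) \<le> d * (1/4) ^ n"
    using r by (auto simp: P_def)
  obtain l where l: "dom.converges r l"
    by (rule dom.geometric_converges[OF rc _ _ step]) auto
  note lc = dom.convergesD(2)[OF l]
  have "cod.converges (\<lambda>n. \<phi> (r n)) \<zero>\<^bsub>B\<^esub>"
  proof (rule cod.convergesI)
    show "nrm B (\<phi> (r n) \<ominus>\<^bsub>B\<^esub> \<zero>\<^bsub>B\<^esub>) \<le> d * (1/4) ^ n" for n using small rc by simp
    show "(\<lambda>n. d * (1/4) ^ n) \<longlonglongrightarrow> 0" by (intro tendsto_mult_right_zero LIMSEQ_power_zero) auto
  qed (use rc in auto)
  then have "\<phi> l = \<zero>\<^bsub>B\<^esub>" using cod.converges_unique hom_converges[OF l] by blast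
  then have 1: "\<phi> (b \<ominus>\<^bsub>A\<^esub> l) = \<phi> b" using b lc by simp
  \<comment> \<open>The corrections add up to at most 4d/3. The majorant with 2d has room to spare
    and closes the induction.\<close>
  have bound: "nrm A (b \<ominus>\<^bsub>A\<^esub> r n) \<le> 2 * d * (1 - (1/4) ^ n)" for n
  proof (induction n)
    case 0 then show ?case using r0 b by simp
  next
    case (Suc n)
    have "nrm A (b \<ominus>\<^bsub>A\<^esub> r (Suc n)) \<le> nrm A (b \<ominus>\<^bsub>A\<^esub> r n) + nrm A (r n \<ominus>\<^bsub>A\<^esub> r (Suc n))"
      using dom.nrm_diff_triangle b(1) rc by blast
    also have "\<dots> \<le> 2 * d * (1 - (1/4) ^ n) + d * (1/4) ^ n"
      using Suc step[of n] dom.nrm_diff_commute[OF rc rc] by (metis add_mono)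
    also have "\<dots> \<le> 2 * d * (1 - (1/4) ^ Suc n)" using d by (simp add: algebra_simps)
    finally show ?case .
  qed
  have "nrm A (b \<ominus>\<^bsub>A\<^esub> l) \<le> 2 * d"
  proof (rule dom.converges_norm_le)
    show "dom.converges (\<lambda>n. b \<ominus>\<^bsub>A\<^esub> r n) (b \<ominus>\<^bsub>A\<^esub> l)"
      using dom.converges_diff[OF dom.converges_const[OF b(1)] l] .
    fix n
    have "2 * d * (1 - (1/4) ^ n) \<le> 2 * d * 1" using d by (intro mult_left_mono) auto
    then show "nrm A (b \<ominus>\<^bsub>A\<^esub> r n) \<le> 2 * d" using bound[of n] by simp
  qed
  then show thesis using that[of "b \<ominus>\<^bsub>A\<^esub> l"] 1 b(1) lc by simp
qed

end

text \<open>By \<open>ker\<close>, the value \<open>\<psi> b\<close> depends only on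
  \<open>\<phi> b\<close>, so \<open>b\<close> may be replaced by a preimage of norm at most 2d.
  With \<psi> = \<iota> and \<phi> = \<pi> after \<iota> this turns injectivity on the image of
  \<iota> into a lower bound for \<pi> there, without knowing that this image is closed.\<close>

lemma star_hom_nrm_le_of_kernel:
  assumes "cstar_algebra D" "cstar_algebra A" "cstar_algebra B"
    and psi: "star_hom D B \<psi>" and phi: "star_hom D A \<phi>"
    and ker: "\<And>x. \<lbrakk>x \<in> carrier D; \<phi> x = \<zero>\<^bsub>A\<^esub>\<rbrakk> \<Longrightarrow> \<psi> x = \<zero>\<^bsub>B\<^esub>"
    and x: "x \<in> carrier D"
  shows "nrm B (\<psi> x) \<le> nrm A (\<phi> x)"
proof (rule star_hom_nrm_le_of_bounded[where S = "carrier D" and K = 2, OF assms(1-3) psi phi _ _ _ _ x])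
  interpret psi: cstar_hom D B \<psi> by (intro cstar_hom.intro cstar_hom_axioms.intro assms)
  interpret phi: cstar_hom D A \<phi> by (intro cstar_hom.intro cstar_hom_axioms.intro assms)
  fix b assume b: "b \<in> carrier D" "adj D b = b"
  \<comment> \<open>\<open>d\<close> stays strictly above the norm of \<open>\<phi> b\<close>,
    because \<open>bounded_lift\<close> asks for a positive \<open>d\<close>.\<close>
  have le: "nrm B (\<psi> b) \<le> 2 * d" if d: "nrm A (\<phi> b) < d" for d
  proof -
    have "0 < d" using d phi.cod.nrm_nonneg[of "\<phi> b"] b by simp
    then obtain y where y: "y \<in> carrier D" "nrm D y \<le> 2 * d" "\<phi> y = \<phi> b"
      using phi.bounded_lift[OF b, of d] d by auto
    have "\<psi> (b \<ominus>\<^bsub>D\<^esub> y) = \<zero>\<^bsub>B\<^esub>" using b y by (intro ker) (simp_all add: psi.dom.diff_closed)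
    then have "\<psi> b = \<psi> y" using b y by (simp add: psi.cod.diff_eq_zero_iff)
    then show ?thesis using psi.hom_nrm_le[OF y(1)] y(2) by simp
  qed
  have "nrm B (\<psi> b) / 2 \<le> nrm A (\<phi> b)"
  proof (rule dense_ge)
    fix d assume "nrm A (\<phi> b) < d"
    from le[OF this] show "nrm B (\<psi> b) / 2 \<le> d" by simp
  qed
  then show "nrm B (\<psi> b) \<le> 2 * nrm A (\<phi> b)" by simp
qed (simp_all add: cstar_algebra.mult_closed[OF assms(1)] cstar_algebra.adj_closed[OF assms(1)])

section \<open>Replacing the carrier\<close>

text \<open>The universal property tests only algebras with carrier in the reals. An algebra that
  embeds into the reals as a set is moved there by pushing its structure along \<open>f\<close>; the
  field \<open>one\<close> gets an arbitrary value.\<close>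

definition transport :: "('a \<Rightarrow> 'c) \<Rightarrow> ('a, 'z) cstar_scheme \<Rightarrow> 'c cstar" where
  "transport f A = (let g = inv_into (carrier A) f in
     \<lparr>carrier = f ` carrier A, mult = (\<lambda>x y. f (g x \<otimes>\<^bsub>A\<^esub> g y)), one = f (\<zero>\<^bsub>A\<^esub>), zero = f (\<zero>\<^bsub>A\<^esub>),
      add = (\<lambda>x y. f (g x \<oplus>\<^bsub>A\<^esub> g y)), smult = (\<lambda>a x. f (a \<odot>\<^bsub>A\<^esub> g x)),
      adj = (\<lambda>x. f (adj A (g x))), nrm = (\<lambda>x. nrm A (g x))\<rparr>)"

context cstar_algebra
begin

context
  fixes f :: "'a \<Rightarrow> 'c" and X :: "'c cstar"
  assumes inj: "inj_on f (carrier A)"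
  defines "X \<equiv> transport f A"
begin

lemma transport_simps:
  "carrier X = f ` carrier A" "\<zero>\<^bsub>X\<^esub> = f \<zero>"
  "\<lbrakk>x \<in> carrier A; y \<in> carrier A\<rbrakk> \<Longrightarrow> f x \<otimes>\<^bsub>X\<^esub> f y = f (x \<otimes> y)"
  "\<lbrakk>x \<in> carrier A; y \<in> carrier A\<rbrakk> \<Longrightarrow> f x \<oplus>\<^bsub>X\<^esub> f y = f (x \<oplus> y)"
  "x \<in> carrier A \<Longrightarrow> a \<odot>\<^bsub>X\<^esub> f x = f (a \<odot> x)"
  "x \<in> carrier A \<Longrightarrow> adj X (f x) = f (x\<^bold>*)"
  "x \<in> carrier A \<Longrightarrow> nrm X (f x) = nrm A x"
  unfolding X_def transport_def Let_def using inv_into_f_f[OF inj] by simp_all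

lemma transport_module: "module complex_ring X"
proof (rule moduleI)
  show "cring complex_ring" by (rule R.cring_axioms)
  show "abelian_group X"
  proof (rule abelian_groupI)
    fix x assume "x \<in> carrier X"
    then obtain x' where x': "x' \<in> carrier A" "x = f x'" by (auto simp: transport_simps)
    then show "\<exists>y\<in>carrier X. y \<oplus>\<^bsub>X\<^esub> x = \<zero>\<^bsub>X\<^esub>"
      by (intro bexI[of _ "f (\<ominus> x')"]) (simp_all add: transport_simps l_neg)
  qed (auto simp: transport_simps a_ac)
qed (auto simp: transport_simps scale_add_left scale_add_right scale_scale complex_ring_def)

lemma transport_diff:
  "\<lbrakk>x \<in> carrier A; y \<in> carrier A\<rbrakk> \<Longrightarrow> f x \<ominus>\<^bsub>X\<^esub> f y = f (x \<ominus> y)"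
proof -
  interpret X: Module.module complex_ring X by (rule transport_module)
  assume x: "x \<in> carrier A" and y: "y \<in> carrier A"
  have "\<ominus>\<^bsub>X\<^esub> f y = f (\<ominus> y)"
    using y by (intro X.minus_equality) (simp_all add: transport_simps l_neg)
  then show ?thesis using x y by (simp add: a_minus_def transport_simps)
qed

lemma transport_cstar_algebra: "cstar_algebra X"
proof (intro cstar_algebra.intro cstar_algebra_axioms.intro)
  show "Module.module complex_ring X" by (rule transport_module)
  have dist: "cdist X (f x) (f y) = cdist A x y" if "x \<in> carrier A" "y \<in> carrier A" for x y
    using that by (simp add: cdist_def transport_simps transport_diff)
  have M: "Metric_space (carrier X) (cdist X)"
  proof
    fix x y
    show "0 \<le> cdist X x y" by (auto simp: cdist_def transport_simps transport_diff nrm_nonneg)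
    show "cdist X x y = cdist X y x"
      by (auto simp: cdist_def transport_simps transport_diff nrm_diff_commute)
    assume "x \<in> carrier X" "y \<in> carrier X"
    then obtain x' y' where x': "x' \<in> carrier A" "x = f x'" and y': "y' \<in> carrier A" "y = f y'"
      by (auto simp: transport_simps)
    then show "cdist X x y = 0 \<longleftrightarrow> x = y"
      using inj by (simp add: dist inj_on_eq_iff)
    fix z assume "z \<in> carrier X"
    then obtain z' where "z' \<in> carrier A" "z = f z'" by (auto simp: transport_simps)
    then show "cdist X x z \<le> cdist X x y + cdist X y z" using x' y' by (simp add: dist triangle)
  qed
  show "Metric_space.mcomplete (carrier X) (cdist X)"
    unfolding Metric_space.mcomplete_def[OF M]
  proof (intro allI impI)
    fix u assume "Metric_space.MCauchy (carrier X) (cdist X) u"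
    then have u: "range u \<subseteq> f ` carrier A"
      and cau: "\<And>e. e > 0 \<Longrightarrow> \<exists>N. \<forall>n n'. N \<le> n \<longrightarrow> N \<le> n' \<longrightarrow> cdist X (u n) (u n') < e"
      unfolding Metric_space.MCauchy_def[OF M] by (auto simp: transport_simps)
    have "\<forall>n. \<exists>y. y \<in> carrier A \<and> u n = f y" using u by blast
    then obtain v where v: "\<And>n. v n \<in> carrier A" "\<And>n. u n = f (v n)" by metis
    have "MCauchy v" unfolding MCauchy_def using v cau by (auto simp: dist)
    then obtain x where x: "limitin mtopology v x sequentially" using complete unfolding mcomplete_def by blast
    then have "x \<in> carrier A" by (simp add: limitin_mspace)
    then have "limitin (Metric_space.mtopology (carrier X) (cdist X)) u (f x) sequentially"
      using x v unfolding limit_metric_sequentially Metric_space.limit_metric_sequentially[OF M]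
      by (simp add: dist transport_simps)
    then show "\<exists>x. limitin (Metric_space.mtopology (carrier X) (cdist X)) u x sequentially" ..
  qed
qed (use inj in \<open>auto simp: transport_simps mult_assoc mult_l_distr mult_r_distr smult_mult_l smult_mult_r
    adj_add adj_smult adj_mult nrm_nonneg nrm_eq_0 nrm_triangle nrm_smult nrm_mult nrm_cstar inj_on_eq_iff\<close>)

lemma transport_star_hom: "star_hom A X f"
  unfolding star_hom_def by (auto simp: transport_simps)

lemma transport_star_hom_inv: "star_hom X A (inv_into (carrier A) f)"
  unfolding star_hom_def using inj by (auto simp: transport_simps)

end

text \<open>A point is determined by the pairs \<open>(n, j)\<close> for which it lies within
  \<open>1 / real (Suc j)\<close> of the dense point \<open>q n\<close>, that is, by a set of
  naturals; these sets biject with the reals.\<close>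

lemma separable_embeds_real:
  assumes Q: "countable Q" "Q \<subseteq> carrier A"
    and dense: "\<And>x e. \<lbrakk>x \<in> carrier A; e > 0\<rbrakk> \<Longrightarrow> \<exists>q\<in>Q. nrm A (x \<ominus> q) < e"
  obtains f :: "'a \<Rightarrow> real" where "inj_on f (carrier A)"
proof -
  have "Q \<noteq> {}" using dense[of \<zero> 1] by auto
  define q where "q = from_nat_into Q"
  have q: "range q = Q" unfolding q_def using Q(1) \<open>Q \<noteq> {}\<close> by (rule range_from_nat_into[OF _ , rotated])
  then have qc: "q n \<in> carrier A" for n using Q(2) by blast
  define F where "F x = {to_nat (n, j) | n j :: nat. nrm A (x \<ominus> q n) < 1 / real (Suc j)}" for x
  have F: "to_nat (n, j) \<in> F x \<longleftrightarrow> nrm A (x \<ominus> q n) < 1 / real (Suc j)" for n j x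
    unfolding F_def by auto
  have "inj_on F (carrier A)"
  proof (rule inj_onI, rule ccontr)
    fix x y assume x: "x \<in> carrier A" and y: "y \<in> carrier A" and eq: "F x = F y" and "x \<noteq> y"
    then have "0 < nrm A (x \<ominus> y) / 2"
      using nrm_nonneg[of "x \<ominus> y"] nrm_eq_0[of "x \<ominus> y"] diff_eq_zero_iff[of x y] by (simp add: less_le)
    then obtain j where j: "1 / real (Suc j) < nrm A (x \<ominus> y) / 2"
      using nat_approx_posE by blast
    obtain n where n: "nrm A (x \<ominus> q n) < 1 / real (Suc j)"
      using dense[OF x, of "1 / real (Suc j)"] q by auto
    then have "nrm A (y \<ominus> q n) < 1 / real (Suc j)" using F[of n j x] F[of n j y] eq by simp
    then show False
      using n j nrm_diff_triangle[OF x qc y, of n] nrm_diff_commute[OF y qc, of n] by simp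
  qed
  moreover obtain h :: "nat set \<Rightarrow> real" where "bij_betw h UNIV UNIV"
    using nat_sets_eqpoll_reals unfolding eqpoll_def by blast
  ultimately have "inj_on (h \<circ> F) (carrier A)"
    by (meson UNIV_I bij_betw_imp_inj_on comp_inj_on inj_on_subset subset_UNIV)
  then show thesis by (rule that)
qed

end

section \<open>Averaging over the torus\<close>

text \<open>Integer exponents, because products of generators with adjoints of generators have
  differences of degrees as their degrees.\<close>

definition torus_zpower :: "nat \<Rightarrow> (nat \<Rightarrow> complex) \<Rightarrow> (nat \<Rightarrow> int) \<Rightarrow> complex" where
  "torus_zpower k z m = (\<Prod>i<k. z i powi m i)"

definition root_point :: "nat \<Rightarrow> nat \<Rightarrow> (nat \<Rightarrow> nat) \<Rightarrow> nat \<Rightarrow> complex" where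
  "root_point k L j i = (if i < k then cis (2 * pi * real (j i) / real L) else 1)"

lemma root_point_torus: "root_point k L j \<in> torus k"
  by (simp add: torus_def root_point_def)

text \<open>Character orthogonality on the cyclic group of order \<open>L\<close>; the bound on
  \<open>m\<close> excludes nonzero multiples of \<open>L\<close>.\<close>

lemma sum_root_powers:
  assumes "\<bar>m\<bar> < int L"
  shows "(\<Sum>a<L. cis (2 * pi * real a / real L) powi m) = (if m = 0 then of_nat L else 0)"
proof (cases "m = 0")
  case False
  have L: "L > 0" using assms by simp
  define w where "w = cis (2 * pi * real_of_int m / real L)"
  have w: "cis (2 * pi * real a / real L) powi m = w ^ a" for a
    unfolding w_def cis_power_int Complex.DeMoivre by (simp add: mult_ac)
  have "w \<noteq> 1"
  proof
    assume "w = 1"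
    then have "cos (2 * pi * real_of_int m / real L) = 1" by (simp add: w_def complex_eq_iff)
    then obtain n where "2 * pi * real_of_int m / real L = real_of_int n * 2 * pi"
      unfolding cos_one_2pi_int by blast
    then have "real_of_int m = real_of_int (n * int L)" using L by (simp add: field_simps)
    then have m: "m = n * int L" by linarith
    then have "\<bar>n\<bar> \<ge> 1" using False by auto
    then have "\<bar>m\<bar> \<ge> int L" using mult_right_mono[of 1 "\<bar>n\<bar>" "int L"] by (simp add: m abs_mult)
    then show False using assms by simp
  qed
  moreover have "w ^ L = 1"
    using L cis_multiple_2pi[of "real_of_int m"] unfolding w_def Complex.DeMoivre by simp
  ultimately show ?thesis using False geometric_sum[of w L] unfolding w by simp
qed simp

text \<open>Fourier coefficients of the Fejer kernel of order \<open>N\<close>. They vanish outside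
  a finite range, tend to 1, and belong to a nonnegative kernel of total mass 1, so that averaging
  with it does not increase norms.\<close>

definition fejer :: "nat \<Rightarrow> int \<Rightarrow> real" where
  "fejer N m = max 0 (1 - real_of_int \<bar>m\<bar> / real N)"

lemma fejer_bounds: "0 \<le> fejer N m" "fejer N m \<le> 1"
  by (auto simp: fejer_def)

lemma fejer_eq_0: "N > 0 \<Longrightarrow> int N \<le> \<bar>m\<bar> \<Longrightarrow> fejer N m = 0"
  by (simp add: fejer_def)

lemma fejer_tendsto: "(\<lambda>N. fejer (Suc N) m) \<longlonglongrightarrow> 1"
proof -
  have "(\<lambda>N. real_of_int \<bar>m\<bar> * (1 / real (Suc N))) \<longlonglongrightarrow> 0"
    by (intro tendsto_mult_right_zero LIMSEQ_Suc[OF lim_1_over_n])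
  then have "(\<lambda>N. max 0 (1 - real_of_int \<bar>m\<bar> * (1 / real (Suc N)))) \<longlonglongrightarrow> max 0 (1 - 0)"
    by (intro tendsto_intros)
  then show ?thesis by (simp add: fejer_def)
qed

text \<open>The set indexes the pairs below \<open>N\<close> with difference \<open>m\<close>, which
  survive in the expansion of the Fejer kernel; truncation in \<open>nat\<close> gives 0 once |m|
  reaches \<open>N\<close>.\<close>

lemma card_shifted_pairs:
  "card {a. a < N \<and> 0 \<le> int a + m \<and> int a + m < int N} = nat (int N - \<bar>m\<bar>)"
proof -
  have "{a. a < N \<and> 0 \<le> int a + m \<and> int a + m < int N} = {nat (- m) ..< nat (min (int N) (int N - m))}"
    by auto
  then show ?thesis by (simp add: nat_diff_distrib' min_def)
qed

text \<open>The Fejer kernel, sampled at the roots of unity of order \<open>L\<close> and divided by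
  \<open>L\<close>, so that the weights sum to 1 when \<open>L\<close> is at least
  \<open>N\<close>.\<close>

definition fejer_weight :: "nat \<Rightarrow> nat \<Rightarrow> nat \<Rightarrow> real" where
  "fejer_weight N L a = (cmod (\<Sum>b<N. cis (2 * pi * real a / real L) ^ b))\<^sup>2 / (real N * real L)"

text \<open>The squared modulus expands into the powers \<open>int b - int c + m\<close> with
  \<open>b\<close> and \<open>c\<close> below \<open>N\<close>. The lower bound on \<open>L\<close>
  keeps these exponents below \<open>L\<close> in absolute value, so only the pairs with
  \<open>int c = int b + m\<close> survive.\<close>

lemma fejer_weight_transform:
  assumes N: "N > 0" and mL: "\<bar>m\<bar> + int N \<le> int L"
  shows "(\<Sum>a<L. of_real (fejer_weight N L a) * cis (2 * pi * real a / real L) powi m) = of_real (fejer N m)"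
proof -
  define w where "w a = cis (2 * pi * real a / real L)" for a
  have w0: "w a \<noteq> 0" "cnj (w a) = inverse (w a)" for a
    by (simp_all add: w_def cis_cnj cis_inverse)
  have L: "L > 0" using N mL by simp
  have expand: "of_real (fejer_weight N L a) * w a powi m
      = (\<Sum>b<N. \<Sum>c<N. w a powi (int b - int c + m)) / (of_nat N * of_nat L)" for a
  proof -
    have "of_real ((cmod (\<Sum>b<N. w a ^ b))\<^sup>2) = (\<Sum>b<N. w a ^ b) * (\<Sum>c<N. inverse (w a) ^ c)"
      by (simp add: complex_norm_square w0(2) del: of_real_power)
    also have "\<dots> = (\<Sum>b<N. \<Sum>c<N. w a powi (int b - int c))"
      using w0(1) by (simp add: sum_product power_int_diff power_inverse field_simps)
    finally show ?thesis
      unfolding fejer_weight_def w_def[symmetric]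
      using w0(1) by (simp add: sum_distrib_right power_int_add del: of_real_power)
  qed
  have "(\<Sum>a<L. of_real (fejer_weight N L a) * w a powi m)
      = (\<Sum>b<N. \<Sum>c<N. \<Sum>a<L. w a powi (int b - int c + m)) / (of_nat N * of_nat L)"
    unfolding expand sum_divide_distrib[symmetric]
    by (subst sum.swap, rule arg_cong[where f = "\<lambda>x. x / _"], rule sum.cong[OF refl], rule sum.swap)
  also have "(\<Sum>b<N. \<Sum>c<N. \<Sum>a<L. w a powi (int b - int c + m))
      = (\<Sum>b<N. \<Sum>c<N. if int c = int b + m then of_nat L else 0)"
  proof (intro sum.cong refl)
    fix b c assume "b \<in> {..<N}" "c \<in> {..<N}"
    then have "\<bar>int b - int c + m\<bar> < int L" using mL by auto
    then show "(\<Sum>a<L. w a powi (int b - int c + m)) = (if int c = int b + m then of_nat L else 0)"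
      using sum_root_powers[of "int b - int c + m" L] unfolding w_def by auto
  qed
  also have "\<dots> = (\<Sum>b<N. if 0 \<le> int b + m \<and> int b + m < int N then of_nat L else 0)"
  proof (intro sum.cong refl)
    fix b
    have "(\<Sum>c<N. if int c = int b + m then of_nat L else 0)
        = (\<Sum>c<N. if c = nat (int b + m) then (if 0 \<le> int b + m then of_nat L else 0) else (0::complex))"
      by (intro sum.cong refl) auto
    then show "(\<Sum>c<N. if int c = int b + m then of_nat L else 0)
        = (if 0 \<le> int b + m \<and> int b + m < int N then of_nat L else (0::complex))"
      by (auto simp: sum.delta)
  qed
  also have "\<dots> = of_nat L * of_nat (card {b. b < N \<and> 0 \<le> int b + m \<and> int b + m < int N})"
    by (simp add: sum.If_cases Int_def mult.commute)
  finally have "(\<Sum>a<L. of_real (fejer_weight N L a) * w a powi m)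
      = of_nat L * of_nat (nat (int N - \<bar>m\<bar>)) / (of_nat N * of_nat L)"
    unfolding card_shifted_pairs .
  also have "\<dots> = of_nat (nat (int N - \<bar>m\<bar>)) / of_nat N" using L by simp
  also have "\<dots> = of_real (real (nat (int N - \<bar>m\<bar>)) / real N)" by simp
  also have "real (nat (int N - \<bar>m\<bar>)) / real N = fejer N m"
  proof (cases "\<bar>m\<bar> \<le> int N")
    case True
    then have "real (nat (int N - \<bar>m\<bar>)) = real N - real_of_int \<bar>m\<bar>" by simp
    moreover have "real_of_int \<bar>m\<bar> / real N \<le> 1" using True N by (simp add: divide_le_eq_1)
    ultimately show ?thesis using N by (simp add: fejer_def diff_divide_distrib)
  next
    case False
    then show ?thesis using fejer_eq_0[OF N] by simp
  qed
  finally show ?thesis unfolding w_def .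
qed

lemma fejer_weight_nonneg: "0 \<le> fejer_weight N L a"
  by (simp add: fejer_weight_def)

lemma sum_fejer_weight: "0 < N \<Longrightarrow> N \<le> L \<Longrightarrow> (\<Sum>a<L. fejer_weight N L a) = 1"
  using fejer_weight_transform[of N 0 L] by (simp add: fejer_def flip: of_real_sum)

lemma product_weight_transform:
  "(\<Sum>j\<in>PiE {..<k} (\<lambda>_. {..<L}). (\<Prod>i<k. w i (j i)) * torus_zpower k (root_point k L j) m)
    = (\<Prod>i<k. \<Sum>a<L. w i a * cis (2 * pi * real a / real L) powi m i)"
  by (subst prod_sum_PiE) (auto simp: torus_zpower_def root_point_def prod.distrib intro!: sum.cong prod.cong)

section \<open>Norm estimates for averages of sums of eigenvectors\<close>

context cstar_algebra
begin

text \<open>By the eigenvector equations the weighted sum equals the combination, with coefficients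
  \<open>\<kappa> z\<close>, of the images of the whole sum under the \<open>\<alpha> z\<close>;
  each of these maps is contractive.\<close>

lemma nrm_average_le:
  assumes Z: "finite Z" and x: "x \<in> M \<rightarrow> carrier A"
    and \<alpha>: "\<And>z. z \<in> Z \<Longrightarrow> star_hom A A (\<alpha> z)"
    and eig: "\<And>z m. \<lbrakk>z \<in> Z; m \<in> M\<rbrakk> \<Longrightarrow> \<alpha> z (x m) = \<theta> z m \<odot> x m"
  shows "nrm A (\<Oplus>m\<in>M. (\<Sum>z\<in>Z. \<kappa> z * \<theta> z m) \<odot> x m) \<le> (\<Sum>z\<in>Z. cmod (\<kappa> z)) * nrm A (\<Oplus>m\<in>M. x m)"
  using Z \<alpha> eig
proof (induction Z)
  case empty
  have "(\<Oplus>m\<in>M. 0 \<odot> x m) = (\<Oplus>m\<in>M. \<zero>)"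
    using x by (intro finsum_cong') (auto simp: Pi_iff)
  then show ?case by simp
next
  case (insert z Z)
  interpret a: cstar_hom A A "\<alpha> z"
    by (intro cstar_hom.intro cstar_hom_axioms.intro cstar_algebra_axioms insert.prems) auto
  let ?X = "\<Oplus>m\<in>M. x m"
  have X: "?X \<in> carrier A" using x by (rule finsum_closed)
  have "(\<Oplus>m\<in>M. (\<Sum>z\<in>insert z Z. \<kappa> z * \<theta> z m) \<odot> x m)
      = (\<Oplus>m\<in>M. \<kappa> z \<odot> \<alpha> z (x m) \<oplus> (\<Sum>z\<in>Z. \<kappa> z * \<theta> z m) \<odot> x m)"
    using x insert by (intro finsum_cong') (auto simp: Pi_iff scale_add_left scale_scale)
  also have "\<dots> = (\<Oplus>m\<in>M. \<kappa> z \<odot> \<alpha> z (x m)) \<oplus> (\<Oplus>m\<in>M. (\<Sum>z\<in>Z. \<kappa> z * \<theta> z m) \<odot> x m)"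
    using x by (intro finsum_addf) (auto simp: Pi_iff)
  also have "(\<Oplus>m\<in>M. \<kappa> z \<odot> \<alpha> z (x m)) = \<kappa> z \<odot> \<alpha> z ?X"
    using x by (subst a.hom_finsum) (auto simp: Pi_iff scale_finsum)
  finally have "nrm A (\<Oplus>m\<in>M. (\<Sum>z\<in>insert z Z. \<kappa> z * \<theta> z m) \<odot> x m)
      \<le> cmod (\<kappa> z) * nrm A (\<alpha> z ?X) + nrm A (\<Oplus>m\<in>M. (\<Sum>z\<in>Z. \<kappa> z * \<theta> z m) \<odot> x m)"
    using nrm_triangle[of "\<kappa> z \<odot> \<alpha> z ?X" "\<Oplus>m\<in>M. (\<Sum>z\<in>Z. \<kappa> z * \<theta> z m) \<odot> x m"] X x
    by (simp add: nrm_smult finsum_closed Pi_iff)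
  also have "\<dots> \<le> cmod (\<kappa> z) * nrm A ?X + (\<Sum>z\<in>Z. cmod (\<kappa> z)) * nrm A ?X"
    using insert a.hom_nrm_le[OF X] by (intro add_mono mult_left_mono) auto
  finally show ?case using insert by (simp add: distrib_right)
qed

context
  fixes k :: nat and M :: "(nat \<Rightarrow> int) set" and x \<alpha>
  assumes M: "finite M" and x: "x \<in> M \<rightarrow> carrier A"
    and \<alpha>: "\<And>z. z \<in> torus k \<Longrightarrow> star_hom A A (\<alpha> z)"
    and eig: "\<And>z m. \<lbrakk>z \<in> torus k; m \<in> M\<rbrakk> \<Longrightarrow> \<alpha> z (x m) = torus_zpower k z m \<odot> x m"
begin

lemma nrm_product_average_le:
  "nrm A (\<Oplus>m\<in>M. (\<Prod>i<k. \<Sum>a<L. w i a * cis (2 * pi * real a / real L) powi m i) \<odot> x m)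
    \<le> (\<Prod>i<k. \<Sum>a<L. cmod (w i a)) * nrm A (\<Oplus>m\<in>M. x m)"
proof -
  let ?J = "PiE {..<k} (\<lambda>_. {..<L})"
  have "(\<Prod>i<k. \<Sum>a<L. cmod (w i a)) = (\<Sum>j\<in>?J. cmod (\<Prod>i<k. w i (j i)))"
    by (subst prod_sum_PiE) (auto simp: prod_norm)
  moreover have "nrm A (\<Oplus>m\<in>M. (\<Sum>j\<in>?J. (\<Prod>i<k. w i (j i)) * torus_zpower k (root_point k L j) m) \<odot> x m)
      \<le> (\<Sum>j\<in>?J. cmod (\<Prod>i<k. w i (j i))) * nrm A (\<Oplus>m\<in>M. x m)"
    by (rule nrm_average_le[where \<alpha> = "\<lambda>j. \<alpha> (root_point k L j)"])
      (auto simp: \<alpha> eig root_point_torus x finite_PiE)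
  ultimately show ?thesis unfolding product_weight_transform by simp
qed

lemma coordinate_bound: "\<exists>C::nat. \<forall>m\<in>M. \<forall>i<k. \<bar>m i\<bar> \<le> int C"
proof -
  have "finite ((\<lambda>(m, i). nat \<bar>m i\<bar>) ` (M \<times> {..<k}))" using M by simp
  then obtain C where C: "\<And>y. y \<in> (\<lambda>(m, i). nat \<bar>m i\<bar>) ` (M \<times> {..<k}) \<Longrightarrow> y \<le> C"
    unfolding finite_nat_set_iff_bounded_le by blast
  have "\<bar>m i\<bar> \<le> int C" if "m \<in> M" "i < k" for m i
  proof -
    have "nat \<bar>m i\<bar> \<le> C" using that by (intro C) auto
    then show ?thesis by simp
  qed
  then show ?thesis by blast
qed

text \<open>Averaging against the conjugate of the character \<open>n\<close> extracts the component
  at \<open>n\<close>, with weights of total modulus 1. Coordinates from \<open>k\<close> on are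
  invisible to the torus, hence the hypothesis on the support.\<close>

lemma nrm_component_le:
  assumes supp: "\<And>m i. \<lbrakk>m \<in> M; k \<le> i\<rbrakk> \<Longrightarrow> m i = 0" and n: "n \<in> M"
  shows "nrm A (x n) \<le> nrm A (\<Oplus>m\<in>M. x m)"
proof -
  obtain C :: nat where C: "\<And>m i. \<lbrakk>m \<in> M; i < k\<rbrakk> \<Longrightarrow> \<bar>m i\<bar> \<le> int C" using coordinate_bound by blast
  \<comment> \<open>Coordinate differences within \<open>M\<close> are at most \<open>2 * C\<close>,
    hence never a nonzero multiple of \<open>L\<close>.\<close>
  define L where "L = 2 * C + 1"
  have L: "L > 0" by (simp add: L_def)
  define w where "w i a = cis (2 * pi * real a / real L) powi (- n i) / of_nat L" for i a
  have "(\<Prod>i<k. \<Sum>a<L. w i a * cis (2 * pi * real a / real L) powi m i) = (if m = n then 1 else 0)"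
    if m: "m \<in> M" for m
  proof -
    have "(\<Sum>a<L. w i a * cis (2 * pi * real a / real L) powi m i) = (if m i = n i then 1 else 0)"
      if i: "i < k" for i
    proof -
      have "\<bar>m i - n i\<bar> < int L" using C[OF m i] C[OF n i] by (simp add: L_def)
      then have s: "(\<Sum>a<L. cis (2 * pi * real a / real L) powi (m i - n i)) = (if m i = n i then of_nat L else 0)"
        by (simp add: sum_root_powers)
      have "(\<Sum>a<L. w i a * cis (2 * pi * real a / real L) powi m i)
          = (\<Sum>a<L. cis (2 * pi * real a / real L) powi (m i - n i)) / of_nat L"
        unfolding sum_divide_distrib
        by (intro sum.cong refl) (simp add: w_def power_int_diff power_int_minus field_simps)
      then show ?thesis unfolding s using L by simp
    qed
    then have "(\<Prod>i<k. \<Sum>a<L. w i a * cis (2 * pi * real a / real L) powi m i)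
        = (\<Prod>i<k. if m i = n i then 1 else 0)" by (intro prod.cong) auto
    moreover have "m = n \<longleftrightarrow> (\<forall>i<k. m i = n i)"
      using supp[OF m] supp[OF n] by (metis ext not_le)
    ultimately show ?thesis by auto
  qed
  then have "(\<Oplus>m\<in>M. (\<Prod>i<k. \<Sum>a<L. w i a * cis (2 * pi * real a / real L) powi m i) \<odot> x m)
      = (\<Oplus>m\<in>M. if n = m then x m else \<zero>)"
    using x by (intro finsum_cong') (auto simp: Pi_iff)
  also have "\<dots> = x n" using x n M by (intro add.finprod_singleton) auto
  finally have "nrm A (x n) \<le> (\<Prod>i<k. \<Sum>a<L. cmod (w i a)) * nrm A (\<Oplus>m\<in>M. x m)"
    using nrm_product_average_le[where L = L and w = w] by simp
  also have "(\<Prod>i<k. \<Sum>a<L. cmod (w i a)) = 1"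
    using L by (simp add: w_def norm_divide norm_power_int)
  finally show ?thesis by simp
qed

text \<open>Fejer weights are nonnegative and sum to 1 in each coordinate, so this average is a
  contraction; \<open>L = C + N\<close> meets the size condition of
  \<open>fejer_weight_transform\<close>.\<close>

lemma nrm_fejer_sum_le:
  assumes N: "N > 0"
  shows "nrm A (\<Oplus>m\<in>M. complex_of_real (\<Prod>i<k. fejer N (m i)) \<odot> x m) \<le> nrm A (\<Oplus>m\<in>M. x m)"
proof -
  obtain C :: nat where C: "\<And>m i. \<lbrakk>m \<in> M; i < k\<rbrakk> \<Longrightarrow> \<bar>m i\<bar> \<le> int C" using coordinate_bound by blast
  define L where "L = C + N"
  have "(\<Prod>i<k. \<Sum>a<L. complex_of_real (fejer_weight N L a) * cis (2 * pi * real a / real L) powi m i)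
      = complex_of_real (\<Prod>i<k. fejer N (m i))" if m: "m \<in> M" for m
    unfolding of_real_prod
    by (intro prod.cong refl fejer_weight_transform[OF N]) (use C[OF m] in \<open>auto simp: L_def\<close>)
  then have "(\<Oplus>m\<in>M. complex_of_real (\<Prod>i<k. fejer N (m i)) \<odot> x m)
    = (\<Oplus>m\<in>M. (\<Prod>i<k. \<Sum>a<L. complex_of_real (fejer_weight N L a) * cis (2 * pi * real a / real L) powi m i) \<odot> x m)"
    using x by (intro finsum_cong') (auto simp: Pi_iff)
  then show ?thesis
    using nrm_product_average_le[where L = L and w = "\<lambda>_ a. complex_of_real (fejer_weight N L a)"] N
    by (simp add: fejer_weight_nonneg sum_fejer_weight L_def)
qed

end

end

section \<open>Cuntz-Krieger families\<close>

context self_similar_action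
begin

abbreviation E :: "('m \<times> 'm) kgraph" where "E \<equiv> zappa_szep G \<Lambda> L R"
abbreviation "gr \<equiv> from_graph \<Lambda>"
abbreviation "gp \<equiv> from_groupoid G"

lemma E_simps [simp]:
  "(x, g) \<in> mor E \<longleftrightarrow> x \<in> mor \<Lambda> \<and> g \<in> mor G \<and> src \<Lambda> x = rng G g"
  "src E (x, g) = (src G g, src G g)" "rng E (x, g) = (rng \<Lambda> x, rng \<Lambda> x)"
  "cmp E (x, g) (y, h) = (cmp \<Lambda> x (L g y), cmp G (R g y) h)" "kdeg E (x, g) = kdeg \<Lambda> x"
  by (auto simp: zappa_szep_def)

lemma objD:
  assumes "v \<in> obj \<Lambda>"
  shows "v \<in> mor \<Lambda>" "src \<Lambda> v = v" "rng \<Lambda> v = v" "v \<in> mor G" "src G v = v" "rng G v = v"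
    "kdeg \<Lambda> v = (\<lambda>i. 0)"
proof -
  show v: "v \<in> mor \<Lambda>" "src \<Lambda> v = v" "kdeg \<Lambda> v = (\<lambda>i. 0)"
    using assms \<Lambda>.kdeg_obj by (auto simp: obj_def)
  show "rng \<Lambda> v = v" using \<Lambda>.rng_src[OF v(1)] v by simp
  show w: "v \<in> mor G" "src G v = v" using assms obj_eq[symmetric] by (auto simp: obj_def)
  show "rng G v = v" using G.rng_src[OF w(1)] w by simp
qed

lemma src_rng_obj:
  "g \<in> mor G \<Longrightarrow> src G g \<in> obj \<Lambda>" "g \<in> mor G \<Longrightarrow> rng G g \<in> obj \<Lambda>"
  "x \<in> mor \<Lambda> \<Longrightarrow> src \<Lambda> x \<in> obj \<Lambda>" "x \<in> mor \<Lambda> \<Longrightarrow> rng \<Lambda> x \<in> obj \<Lambda>"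
proof -
  show "g \<in> mor G \<Longrightarrow> src G g \<in> obj \<Lambda>" "g \<in> mor G \<Longrightarrow> rng G g \<in> obj \<Lambda>"
    unfolding obj_eq[symmetric] by (simp_all add: obj_def G.src_mor G.src_src G.rng_mor G.src_rng)
  show "x \<in> mor \<Lambda> \<Longrightarrow> src \<Lambda> x \<in> obj \<Lambda>" "x \<in> mor \<Lambda> \<Longrightarrow> rng \<Lambda> x \<in> obj \<Lambda>"
    by (simp_all add: obj_def \<Lambda>.src_mor \<Lambda>.src_src \<Lambda>.rng_mor \<Lambda>.src_rng)
qed

lemma src_rng_simps [simp]:
  "g \<in> mor G \<Longrightarrow> src \<Lambda> (src G g) = src G g" "g \<in> mor G \<Longrightarrow> rng \<Lambda> (src G g) = src G g"
  "g \<in> mor G \<Longrightarrow> src \<Lambda> (rng G g) = rng G g" "g \<in> mor G \<Longrightarrow> rng \<Lambda> (rng G g) = rng G g"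
  "g \<in> mor G \<Longrightarrow> src G (src G g) = src G g" "g \<in> mor G \<Longrightarrow> rng G (src G g) = src G g"
  "g \<in> mor G \<Longrightarrow> src G (rng G g) = rng G g" "g \<in> mor G \<Longrightarrow> rng G (rng G g) = rng G g"
  "g \<in> mor G \<Longrightarrow> src G g \<in> mor \<Lambda>" "g \<in> mor G \<Longrightarrow> rng G g \<in> mor \<Lambda>"
  "g \<in> mor G \<Longrightarrow> src G g \<in> mor G" "g \<in> mor G \<Longrightarrow> rng G g \<in> mor G"
  "g \<in> mor G \<Longrightarrow> kdeg \<Lambda> (src G g) = (\<lambda>i. 0)" "g \<in> mor G \<Longrightarrow> kdeg \<Lambda> (rng G g) = (\<lambda>i. 0)"
  "x \<in> mor \<Lambda> \<Longrightarrow> src G (src \<Lambda> x) = src \<Lambda> x" "x \<in> mor \<Lambda> \<Longrightarrow> rng G (src \<Lambda> x) = src \<Lambda> x"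
  "x \<in> mor \<Lambda> \<Longrightarrow> src G (rng \<Lambda> x) = rng \<Lambda> x" "x \<in> mor \<Lambda> \<Longrightarrow> rng G (rng \<Lambda> x) = rng \<Lambda> x"
  "x \<in> mor \<Lambda> \<Longrightarrow> src \<Lambda> (src \<Lambda> x) = src \<Lambda> x" "x \<in> mor \<Lambda> \<Longrightarrow> rng \<Lambda> (src \<Lambda> x) = src \<Lambda> x"
  "x \<in> mor \<Lambda> \<Longrightarrow> src \<Lambda> (rng \<Lambda> x) = rng \<Lambda> x" "x \<in> mor \<Lambda> \<Longrightarrow> rng \<Lambda> (rng \<Lambda> x) = rng \<Lambda> x"
  "x \<in> mor \<Lambda> \<Longrightarrow> src \<Lambda> x \<in> mor \<Lambda>" "x \<in> mor \<Lambda> \<Longrightarrow> rng \<Lambda> x \<in> mor \<Lambda>"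
  "x \<in> mor \<Lambda> \<Longrightarrow> src \<Lambda> x \<in> mor G" "x \<in> mor \<Lambda> \<Longrightarrow> rng \<Lambda> x \<in> mor G"
  by (simp_all add: objD[OF src_rng_obj(1)] objD[OF src_rng_obj(2)] objD[OF src_rng_obj(3)] objD[OF src_rng_obj(4)])

text \<open>Degrees add because moving a groupoid element past a path keeps the degree of the path,
  by \<open>kdeg_L\<close>.\<close>

lemma E_cmp:
  assumes "\<zeta> \<in> mor E" "\<eta> \<in> mor E" "src E \<zeta> = rng E \<eta>"
  shows "cmp E \<zeta> \<eta> \<in> mor E" "src E (cmp E \<zeta> \<eta>) = src E \<eta>" "rng E (cmp E \<zeta> \<eta>) = rng E \<zeta>"
    "kdeg E (cmp E \<zeta> \<eta>) = (\<lambda>i. kdeg E \<zeta> i + kdeg E \<eta> i)"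
  using assms
  by (cases \<zeta>; cases \<eta>;
      auto simp: L_mor R_mor rng_L src_L src_R \<Lambda>.cmp_mor \<Lambda>.src_cmp \<Lambda>.rng_cmp G.cmp_mor G.src_cmp G.rng_cmp
        \<Lambda>.kdeg_cmp kdeg_L)+

lemma E_src:
  assumes "\<zeta> \<in> mor E"
  shows "src E \<zeta> \<in> mor E" "src E (src E \<zeta>) = src E \<zeta>" "rng E (src E \<zeta>) = src E \<zeta>"
    "kdeg E (src E \<zeta>) = (\<lambda>i. 0)" "cmp E \<zeta> (src E \<zeta>) = \<zeta>" "src E \<zeta> \<in> obj E"
proof -
  obtain x g where z: "\<zeta> = (x, g)" "x \<in> mor \<Lambda>" "g \<in> mor G" "src \<Lambda> x = rng G g"
    using assms by (cases \<zeta>) auto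
  show "src E \<zeta> \<in> mor E" "src E (src E \<zeta>) = src E \<zeta>" "rng E (src E \<zeta>) = src E \<zeta>"
    "kdeg E (src E \<zeta>) = (\<lambda>i. 0)" "src E \<zeta> \<in> obj E"
    using z by (auto simp: obj_def)
  show "cmp E \<zeta> (src E \<zeta>) = \<zeta>"
    using z \<Lambda>.cmp_src[of x] by (simp add: L_src R_src G.cmp_src)
qed

lemma E_rng:
  assumes "\<zeta> \<in> mor E"
  shows "rng E \<zeta> \<in> mor E" "src E (rng E \<zeta>) = rng E \<zeta>" "cmp E (rng E \<zeta>) \<zeta> = \<zeta>" "rng E \<zeta> \<in> obj E"
proof -
  obtain x g where z: "\<zeta> = (x, g)" "x \<in> mor \<Lambda>" "g \<in> mor G" "src \<Lambda> x = rng G g"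
    using assms by (cases \<zeta>) auto
  show "rng E \<zeta> \<in> mor E" "src E (rng E \<zeta>) = rng E \<zeta>" "rng E \<zeta> \<in> obj E"
    using z by (auto simp: obj_def)
  show "cmp E (rng E \<zeta>) \<zeta> = \<zeta>"
    using z G.cmp_rng[of g] by (simp add: L_rng R_rng \<Lambda>.cmp_rng)
qed

lemma gr_simps [simp]:
  assumes "x \<in> mor \<Lambda>"
  shows "gr x \<in> mor E" "src E (gr x) = (src \<Lambda> x, src \<Lambda> x)" "rng E (gr x) = (rng \<Lambda> x, rng \<Lambda> x)"
    "kdeg E (gr x) = kdeg \<Lambda> x"
  using assms by (auto simp: from_graph_def)

lemma gp_simps [simp]:
  assumes "g \<in> mor G"
  shows "gp g \<in> mor E" "src E (gp g) = (src G g, src G g)" "rng E (gp g) = (rng G g, rng G g)"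
    "kdeg E (gp g) = (\<lambda>i. 0)"
  using assms by (auto simp: from_groupoid_def)

lemma gr_obj: "v \<in> obj \<Lambda> \<Longrightarrow> gr v = (v, v)"
  by (simp add: from_graph_def objD)

lemma cmp_gr_gr:
  "\<lbrakk>x \<in> mor \<Lambda>; y \<in> mor \<Lambda>; src \<Lambda> x = rng \<Lambda> y\<rbrakk> \<Longrightarrow> cmp E (gr x) (gr y) = gr (cmp \<Lambda> x y)"
  using G.cmp_src[of "src \<Lambda> y"]
  by (simp add: from_graph_def L_rng R_rng \<Lambda>.src_cmp)

lemma cmp_gp_gp:
  "\<lbrakk>g \<in> mor G; h \<in> mor G; src G g = rng G h\<rbrakk> \<Longrightarrow> cmp E (gp g) (gp h) = gp (cmp G g h)"
  using L_src[of g] R_src[of g] \<Lambda>.cmp_src[of "rng G g"] by (simp add: from_groupoid_def G.rng_cmp)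

lemma cmp_gr_gp:
  assumes "(x, g) \<in> mor E" shows "cmp E (gr x) (gp g) = (x, g)"
  using assms L_rng[of "src \<Lambda> x"] R_rng[of "src \<Lambda> x"] \<Lambda>.cmp_src[of x] G.cmp_rng[of g]
  by (simp add: from_graph_def from_groupoid_def)

lemma countable_E: "countable (mor E)"
proof (rule countable_subset)
  show "mor E \<subseteq> mor \<Lambda> \<times> mor G" by (auto simp: zappa_szep_def)
qed (use \<Lambda>.countable_mor G.countable_mor in simp)

lemma factorisation_unique:
  assumes "x \<in> mor \<Lambda>" "y \<in> mor \<Lambda>" "src \<Lambda> x = rng \<Lambda> y" "x' \<in> mor \<Lambda>" "y' \<in> mor \<Lambda>" "src \<Lambda> x' = rng \<Lambda> y'"
    and eq: "cmp \<Lambda> x y = cmp \<Lambda> x' y'" and d: "kdeg \<Lambda> x = kdeg \<Lambda> x'"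
  shows "x = x'"
proof -
  let ?z = "cmp \<Lambda> x y"
  have "(\<lambda>i. kdeg \<Lambda> x i + kdeg \<Lambda> y i) = (\<lambda>i. kdeg \<Lambda> x' i + kdeg \<Lambda> y' i)"
    using \<Lambda>.kdeg_cmp[OF assms(1-3)] \<Lambda>.kdeg_cmp[OF assms(4-6)] eq by simp
  then have dy: "kdeg \<Lambda> y = kdeg \<Lambda> y'" using d by (simp add: fun_eq_iff)
  define P where "P = (\<lambda>(u, v). u \<in> mor \<Lambda> \<and> v \<in> mor \<Lambda> \<and> src \<Lambda> u = rng \<Lambda> v \<and> ?z = cmp \<Lambda> u v \<and>
      kdeg \<Lambda> u = kdeg \<Lambda> x \<and> kdeg \<Lambda> v = kdeg \<Lambda> y)"
  have "\<exists>!p. P p"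
    unfolding P_def
    by (rule \<Lambda>.factorisation[OF \<Lambda>.cmp_mor[OF assms(1-3)] \<Lambda>.kdeg_Nk[OF assms(1)] \<Lambda>.kdeg_Nk[OF assms(2)]
          \<Lambda>.kdeg_cmp[OF assms(1-3)]])
  moreover have "P (x, y)" "P (x', y')" using assms dy by (simp_all add: P_def)
  ultimately have "(x, y) = (x', y')" by blast
  then show ?thesis by simp
qed

text \<open>A common extension would have both paths as initial segments of the same degree, against
  unique factorisation.\<close>

lemma MCE_same_degree:
  assumes "x \<in> mor \<Lambda>" "y \<in> mor \<Lambda>" "kdeg \<Lambda> x = kdeg \<Lambda> y" "x \<noteq> y"
  shows "MCE \<Lambda> x y = {}"
proof (rule ccontr)
  assume "MCE \<Lambda> x y \<noteq> {}"
  then obtain u v where "u \<in> mor \<Lambda>" "v \<in> mor \<Lambda>" "src \<Lambda> x = rng \<Lambda> u" "src \<Lambda> y = rng \<Lambda> v" "cmp \<Lambda> x u = cmp \<Lambda> y v"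
    by (auto simp: MCE_def extensions_of_def)
  then show False using factorisation_unique[of x u y v] assms by simp
qed

end

text \<open>Instantiated both by the universal family in \<open>B\<close> and by the given family in
  \<open>A\<close>, whose gradings are compared through \<open>\<pi>\<close>.\<close>

locale ck_rep = self_similar_action k G \<Lambda> L R + cstar_algebra A
  for k :: nat and G :: "'m cat" and \<Lambda> :: "'m kgraph" and L R
    and A :: "('a, 'z) cstar_scheme" (structure) +
  fixes c :: "'m \<times> 'm \<Rightarrow> 'm \<times> 'm \<Rightarrow> complex" and t :: "'m \<times> 'm \<Rightarrow> 'a"
  assumes row_finite: "row_finite_no_sources k \<Lambda>"
    and cocycle: "normalised_cocycle (zappa_szep G \<Lambda> L R) c"
    and family: "ck_family k G \<Lambda> L R c A t"
begin

section \<open>Consequences of the Cuntz-Krieger relations\<close>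

abbreviation "pr x \<equiv> t (gr x) \<otimes> (t (gr x))\<^bold>*"

lemma t_closed [simp, intro]: "\<zeta> \<in> mor E \<Longrightarrow> t \<zeta> \<in> carrier A"
  using family by (auto simp: ck_family_def Let_def)

lemma t_mult: "\<lbrakk>\<zeta> \<in> mor E; \<eta> \<in> mor E; src E \<zeta> = rng E \<eta>\<rbrakk> \<Longrightarrow> t \<zeta> \<otimes> t \<eta> = c \<zeta> \<eta> \<odot> t (cmp E \<zeta> \<eta>)"
  and t_mult_zero: "\<lbrakk>\<zeta> \<in> mor E; \<eta> \<in> mor E; src E \<zeta> \<noteq> rng E \<eta>\<rbrakk> \<Longrightarrow> t \<zeta> \<otimes> t \<eta> = \<zero>"
  and t_star: "\<zeta> \<in> mor E \<Longrightarrow> (t \<zeta>)\<^bold>* \<otimes> t \<zeta> = t (src E \<zeta>)"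
  and pr_mult: "\<lbrakk>\<mu> \<in> mor \<Lambda>; \<nu> \<in> mor \<Lambda>\<rbrakk> \<Longrightarrow> pr \<mu> \<otimes> pr \<nu> = (\<Oplus>x\<in>MCE \<Lambda> \<mu> \<nu>. pr x)"
  and t_obj_sum: "\<lbrakk>v \<in> obj \<Lambda>; n \<in> Nk k\<rbrakk> \<Longrightarrow> t (gr v) = (\<Oplus>x\<in>paths_from \<Lambda> v n. pr x)"
  using family by (auto simp: ck_family_def Let_def)

lemma cocycle_nonzero: "\<lbrakk>\<zeta> \<in> mor E; \<eta> \<in> mor E; src E \<zeta> = rng E \<eta>\<rbrakk> \<Longrightarrow> c \<zeta> \<eta> \<noteq> 0"
  using cocycle unfolding normalised_cocycle_def by (metis norm_zero zero_neq_one)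

lemma t_cmp:
  assumes "\<zeta> \<in> mor E" "\<eta> \<in> mor E" "src E \<zeta> = rng E \<eta>"
  shows "t (cmp E \<zeta> \<eta>) = inverse (c \<zeta> \<eta>) \<odot> (t \<zeta> \<otimes> t \<eta>)"
  using assms cocycle_nonzero[OF assms] by (simp add: t_mult scale_scale E_cmp)

lemma t_src: "\<zeta> \<in> mor E \<Longrightarrow> t \<zeta> \<otimes> t (src E \<zeta>) = t \<zeta>"
  and t_rng: "\<zeta> \<in> mor E \<Longrightarrow> t (rng E \<zeta>) \<otimes> t \<zeta> = t \<zeta>"
proof -
  assume z: "\<zeta> \<in> mor E"
  have "c \<zeta> (src E \<zeta>) = 1" "c (rng E \<zeta>) \<zeta> = 1"
    using cocycle z E_src[OF z] E_rng[OF z] unfolding normalised_cocycle_def by auto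
  then show "t \<zeta> \<otimes> t (src E \<zeta>) = t \<zeta>" "t (rng E \<zeta>) \<otimes> t \<zeta> = t \<zeta>"
    using z E_src[OF z] E_rng[OF z] by (simp_all add: t_mult)
qed

lemma t_src_adj: "\<zeta> \<in> mor E \<Longrightarrow> (t (src E \<zeta>))\<^bold>* = t (src E \<zeta>)"
  using t_star[of \<zeta>] by (metis adj_adj adj_mult adj_closed t_closed)

lemma t_obj_adj:
  assumes "v \<in> mor E" "src E v = v" shows "(t v)\<^bold>* = t v" "t v \<otimes> t v = t v"
  using t_src_adj[OF assms(1)] t_src[OF assms(1)] assms(2) by simp_all

lemma t_adj_src: "\<zeta> \<in> mor E \<Longrightarrow> t (src E \<zeta>) \<otimes> (t \<zeta>)\<^bold>* = (t \<zeta>)\<^bold>*"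
  and t_adj_rng: "\<zeta> \<in> mor E \<Longrightarrow> (t \<zeta>)\<^bold>* \<otimes> t (rng E \<zeta>) = (t \<zeta>)\<^bold>*"
proof -
  assume z: "\<zeta> \<in> mor E"
  show "t (src E \<zeta>) \<otimes> (t \<zeta>)\<^bold>* = (t \<zeta>)\<^bold>*"
    using arg_cong[OF t_src[OF z], of "adj A"] z E_src[OF z] by (simp add: adj_mult t_src_adj)
  show "(t \<zeta>)\<^bold>* \<otimes> t (rng E \<zeta>) = (t \<zeta>)\<^bold>*"
    using arg_cong[OF t_rng[OF z], of "adj A"] z E_rng[OF z] by (simp add: adj_mult t_obj_adj)
qed

text \<open>\<open>t (src E \<zeta>)\<close> is a projection, so its norm is 0 or 1; by the
  C*-identity this is the square of the norm of \<open>t \<zeta>\<close>.\<close>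

lemma nrm_t_le_1: assumes z: "\<zeta> \<in> mor E" shows "nrm A (t \<zeta>) \<le> 1"
proof -
  let ?v = "t (src E \<zeta>)"
  have v: "?v \<in> carrier A" using z E_src[OF z] by auto
  have "(nrm A ?v)\<^sup>2 = nrm A ?v"
    using nrm_cstar[OF v] z E_src[OF z] by (simp add: t_obj_adj)
  then have "nrm A ?v = 0 \<or> nrm A ?v = 1" by (simp add: power2_eq_square)
  then have "(nrm A (t \<zeta>))\<^sup>2 \<le> 1\<^sup>2" using nrm_cstar[of "t \<zeta>"] z by (auto simp: t_star)
  then show ?thesis by (rule power2_le_imp_le) simp
qed

lemma t_pr: "x \<in> mor \<Lambda> \<Longrightarrow> pr x \<otimes> t (gr x) = t (gr x)"
  and t_adj_pr: "x \<in> mor \<Lambda> \<Longrightarrow> (t (gr x))\<^bold>* \<otimes> pr x = (t (gr x))\<^bold>*"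
  using t_src[of "gr x"] t_adj_src[of "gr x"] t_star[of "gr x"]
  by (simp_all add: mult_assoc) (simp flip: mult_assoc)

text \<open>Range projections may be inserted between the two factors; at equal degree their product
  is a sum over the empty set \<open>MCE \<Lambda> x y\<close>.\<close>

lemma t_orthogonal:
  assumes x: "x \<in> mor \<Lambda>" and y: "y \<in> mor \<Lambda>" and "kdeg \<Lambda> x = kdeg \<Lambda> y" "x \<noteq> y"
  shows "(t (gr x))\<^bold>* \<otimes> t (gr y) = \<zero>"
proof -
  have 0: "pr x \<otimes> pr y = \<zero>" using pr_mult[OF x y] MCE_same_degree[OF assms] by simp
  have "(t (gr x))\<^bold>* \<otimes> t (gr y) = ((t (gr x))\<^bold>* \<otimes> pr x) \<otimes> (pr y \<otimes> t (gr y))"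
    using x y by (simp only: t_pr t_adj_pr)
  also have "\<dots> = (t (gr x))\<^bold>* \<otimes> ((pr x \<otimes> pr y) \<otimes> t (gr y))"
    using x y by (simp add: mult_assoc)
  finally show ?thesis unfolding 0 using x y by simp
qed

text \<open>With \<open>h\<close> inverse to \<open>g\<close>, the range unit is a scalar multiple
  of \<open>t (gp g) \<otimes> t (gp h)\<close>; multiplied from the left by the adjoint of
  \<open>t (gp g)\<close>, it leaves a multiple of \<open>t (gp h)\<close>. The scalar comes from
  the cocycle and does not affect spans.\<close>

lemma t_gp_adj:
  assumes g: "g \<in> mor G"
  obtains u h where "h \<in> mor G" "rng G h = src G g" "src G h = rng G g" "(t (gp g))\<^bold>* = u \<odot> t (gp h)"
proof -
  obtain h where h: "h \<in> mor G" "src G h = rng G g" "rng G h = src G g" "cmp G g h = rng G g"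
    using G.inverse_exists[OF g] by (auto simp: is_inverse_def)
  have eq: "rng E (gp g) = gp (rng G g)" using g by (simp add: from_groupoid_def)
  have "t (rng E (gp g)) = inverse (c (gp g) (gp h)) \<odot> (t (gp g) \<otimes> t (gp h))"
    using t_cmp[of "gp g" "gp h"] g h by (simp add: cmp_gp_gp eq)
  then have "(t (gp g))\<^bold>* = (t (gp g))\<^bold>* \<otimes> (inverse (c (gp g) (gp h)) \<odot> (t (gp g) \<otimes> t (gp h)))"
    using t_adj_rng[of "gp g"] g by simp
  also have "\<dots> = inverse (c (gp g) (gp h)) \<odot> (((t (gp g))\<^bold>* \<otimes> t (gp g)) \<otimes> t (gp h))"
    using g h by (simp add: smult_mult_r mult_assoc)
  also have "((t (gp g))\<^bold>* \<otimes> t (gp g)) \<otimes> t (gp h) = t (gp h)"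
    using t_star[of "gp g"] t_rng[of "gp h"] g h by simp
  finally show thesis using that h by blast
qed

subsection \<open>Homogeneous elements\<close>

text \<open>The algebraic span, without closure: every element involves finitely many paths, and for
  \<open>m\<close> = 0 this is what later places it in a finite corner.\<close>

inductive_set homogeneous :: "(nat \<Rightarrow> int) \<Rightarrow> 'a set" for m where
  zero: "\<zero> \<in> homogeneous m"
| gen: "\<lbrakk>\<zeta> \<in> mor E; \<eta> \<in> mor E; \<And>i. int (kdeg E \<zeta> i) - int (kdeg E \<eta> i) = m i\<rbrakk> \<Longrightarrow>
    a \<odot> (t \<zeta> \<otimes> (t \<eta>)\<^bold>*) \<in> homogeneous m"
| add: "\<lbrakk>x \<in> homogeneous m; y \<in> homogeneous m\<rbrakk> \<Longrightarrow> x \<oplus> y \<in> homogeneous m"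

lemma homogeneous_closed: "x \<in> homogeneous m \<Longrightarrow> x \<in> carrier A"
  by (induction rule: homogeneous.induct) auto

lemma homogeneous_scale: "x \<in> homogeneous m \<Longrightarrow> a \<odot> x \<in> homogeneous m"
proof (induction rule: homogeneous.induct)
  case (gen \<zeta> \<eta> b)
  then show ?case using homogeneous.gen[of \<zeta> \<eta> m "a * b"] by (simp add: scale_scale)
qed (auto simp: scale_add_right homogeneous_closed intro: homogeneous.intros)

lemma homogeneous_adj: "x \<in> homogeneous m \<Longrightarrow> x\<^bold>* \<in> homogeneous (\<lambda>i. - m i)"
proof (induction rule: homogeneous.induct)
  case (gen \<zeta> \<eta> b)
  then have "int (kdeg E \<eta> i) - int (kdeg E \<zeta> i) = - m i" for i using gen(3)[of i] by linarith
  then show ?case using homogeneous.gen[of \<eta> \<zeta> "\<lambda>i. - m i" "cnj b"] gen by (simp add: adj_smult adj_mult)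
qed (auto simp: adj_add homogeneous_closed intro: homogeneous.intros)

lemma homogeneous_finsum: "(\<And>i. i \<in> I \<Longrightarrow> f i \<in> homogeneous m) \<Longrightarrow> (\<Oplus>i\<in>I. f i) \<in> homogeneous m"
proof (induction I rule: infinite_finite_induct)
  case (insert i I)
  then have "f \<in> insert i I \<rightarrow> carrier A" using homogeneous_closed by blast
  then show ?case using insert by (auto simp: Pi_iff intro: homogeneous.intros)
qed (auto intro: homogeneous.zero)

lemma homogeneous_mult_t_left:
  assumes z: "\<zeta> \<in> mor E" and x: "x \<in> homogeneous m"
  shows "t \<zeta> \<otimes> x \<in> homogeneous (\<lambda>i. int (kdeg E \<zeta> i) + m i)"
  using x
proof (induction rule: homogeneous.induct)
  case (gen \<alpha> \<beta> b)
  have d: "int (kdeg E \<zeta> i) + int (kdeg E \<alpha> i) - int (kdeg E \<beta> i) = int (kdeg E \<zeta> i) + m i" for i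
    using gen(3)[of i] by linarith
  show ?case
  proof (cases "src E \<zeta> = rng E \<alpha>")
    case True
    have "t \<zeta> \<otimes> (b \<odot> (t \<alpha> \<otimes> (t \<beta>)\<^bold>*)) = b \<odot> ((t \<zeta> \<otimes> t \<alpha>) \<otimes> (t \<beta>)\<^bold>*)"
      using z gen by (simp add: smult_mult_r mult_assoc)
    also have "\<dots> = (b * c \<zeta> \<alpha>) \<odot> (t (cmp E \<zeta> \<alpha>) \<otimes> (t \<beta>)\<^bold>*)"
      using z gen True by (simp add: t_mult smult_mult_l scale_scale E_cmp)
    also have "\<dots> \<in> homogeneous (\<lambda>i. int (kdeg E \<zeta> i) + m i)"
      using z gen True d by (intro homogeneous.gen) (auto simp: E_cmp)
    finally show ?thesis .
  next
    case False
    have "t \<zeta> \<otimes> (b \<odot> (t \<alpha> \<otimes> (t \<beta>)\<^bold>*)) = b \<odot> ((t \<zeta> \<otimes> t \<alpha>) \<otimes> (t \<beta>)\<^bold>*)"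
      using z gen by (simp add: smult_mult_r mult_assoc)
    then show ?thesis using z gen False by (simp add: t_mult_zero homogeneous.zero)
  qed
qed (use z in \<open>auto simp: mult_r_distr homogeneous_closed intro: homogeneous.intros\<close>)

lemma homogeneous_mult_t_adj_right:
  assumes z: "\<zeta> \<in> mor E" and x: "x \<in> homogeneous m"
  shows "x \<otimes> (t \<zeta>)\<^bold>* \<in> homogeneous (\<lambda>i. m i - int (kdeg E \<zeta> i))"
  using homogeneous_adj[OF homogeneous_mult_t_left[OF z homogeneous_adj[OF x]]] z homogeneous_closed[OF x]
  by (simp add: adj_mult)

lemma homogeneous_gp_adj_left:
  assumes g: "g \<in> mor G" and x: "x \<in> homogeneous m"
  shows "(t (gp g))\<^bold>* \<otimes> x \<in> homogeneous m"
proof -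
  obtain u h where h: "h \<in> mor G" "(t (gp g))\<^bold>* = u \<odot> t (gp h)" using t_gp_adj[OF g] by blast
  have "t (gp h) \<otimes> x \<in> homogeneous m"
    using homogeneous_mult_t_left[OF _ x, of "gp h"] h by simp
  then show ?thesis using homogeneous_scale h homogeneous_closed[OF x] by (simp add: smult_mult_l)
qed

text \<open>Inserting range projections turns the product into a sum over common extensions z = x w
  = y w', whose term is a multiple of \<open>t (gr w)\<close> times the adjoint of
  \<open>t (gr w')\<close>. Comparing the two expressions for the degree of \<open>z\<close> gives
  the degree difference.\<close>

lemma homogeneous_graph_pair:
  assumes x: "x \<in> mor \<Lambda>" and y: "y \<in> mor \<Lambda>"
  shows "(t (gr x))\<^bold>* \<otimes> t (gr y) \<in> homogeneous (\<lambda>i. int (kdeg \<Lambda> y i) - int (kdeg \<Lambda> x i))"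
proof -
  have pc: "pr \<in> MCE \<Lambda> x y \<rightarrow> carrier A" by (auto simp: MCE_def)
  have cut: "\<exists>u w. w \<in> mor \<Lambda> \<and> kdeg \<Lambda> z = (\<lambda>i. kdeg \<Lambda> x i + kdeg \<Lambda> w i) \<and> (t (gr x))\<^bold>* \<otimes> t (gr z) = u \<odot> t (gr w)"
    if x: "x \<in> mor \<Lambda>" and z: "z \<in> extensions_of \<Lambda> x" for x z
  proof -
    obtain w where w: "w \<in> mor \<Lambda>" "src \<Lambda> x = rng \<Lambda> w" "z = cmp \<Lambda> x w"
      using z by (auto simp: extensions_of_def)
    have "t (gr z) = inverse (c (gr x) (gr w)) \<odot> (t (gr x) \<otimes> t (gr w))"
      using t_cmp[of "gr x" "gr w"] x w by (simp add: cmp_gr_gr)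
    then have "(t (gr x))\<^bold>* \<otimes> t (gr z) = inverse (c (gr x) (gr w)) \<odot> (((t (gr x))\<^bold>* \<otimes> t (gr x)) \<otimes> t (gr w))"
      using x w by (simp add: smult_mult_r mult_assoc)
    also have "((t (gr x))\<^bold>* \<otimes> t (gr x)) \<otimes> t (gr w) = t (gr w)"
      using t_star[of "gr x"] t_rng[of "gr w"] x w by simp
    finally show ?thesis using w x by (auto simp: \<Lambda>.kdeg_cmp)
  qed
  have "(t (gr x))\<^bold>* \<otimes> t (gr y) = ((t (gr x))\<^bold>* \<otimes> pr x) \<otimes> (pr y \<otimes> t (gr y))"
    using x y by (simp only: t_pr t_adj_pr)
  also have "\<dots> = (t (gr x))\<^bold>* \<otimes> ((pr x \<otimes> pr y) \<otimes> t (gr y))"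
    using x y by (simp add: mult_assoc)
  also have "\<dots> = (\<Oplus>z\<in>MCE \<Lambda> x y. (t (gr x))\<^bold>* \<otimes> (pr z \<otimes> t (gr y)))"
    unfolding pr_mult[OF x y] using x y pc
    by (simp add: mult_finsum_left) (subst mult_finsum_right, auto simp: MCE_def)
  also have "\<dots> \<in> homogeneous (\<lambda>i. int (kdeg \<Lambda> y i) - int (kdeg \<Lambda> x i))"
  proof (rule homogeneous_finsum)
    fix z assume z: "z \<in> MCE \<Lambda> x y"
    then have zm: "z \<in> mor \<Lambda>" by (simp add: MCE_def)
    obtain u w where w: "w \<in> mor \<Lambda>" "kdeg \<Lambda> z = (\<lambda>i. kdeg \<Lambda> x i + kdeg \<Lambda> w i)"
      "(t (gr x))\<^bold>* \<otimes> t (gr z) = u \<odot> t (gr w)"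
      using cut[OF x, of z] z by (auto simp: MCE_def)
    obtain u' w' where w': "w' \<in> mor \<Lambda>" "kdeg \<Lambda> z = (\<lambda>i. kdeg \<Lambda> y i + kdeg \<Lambda> w' i)"
      "(t (gr y))\<^bold>* \<otimes> t (gr z) = u' \<odot> t (gr w')"
      using cut[OF y, of z] z by (auto simp: MCE_def)
    have "(t (gr z))\<^bold>* \<otimes> t (gr y) = cnj u' \<odot> (t (gr w'))\<^bold>*"
      using arg_cong[OF w'(3), of "adj A"] y zm w'(1) by (simp add: adj_mult adj_smult)
    moreover have "(t (gr x))\<^bold>* \<otimes> (pr z \<otimes> t (gr y)) = ((t (gr x))\<^bold>* \<otimes> t (gr z)) \<otimes> ((t (gr z))\<^bold>* \<otimes> t (gr y))"
      using x y zm by (simp add: mult_assoc)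
    ultimately have "(t (gr x))\<^bold>* \<otimes> (pr z \<otimes> t (gr y)) = (u * cnj u') \<odot> (t (gr w) \<otimes> (t (gr w'))\<^bold>*)"
      using w(1) w'(1) by (simp add: w(3) smult_mult_l smult_mult_r scale_scale mult.commute)
    moreover have "int (kdeg \<Lambda> w i) - int (kdeg \<Lambda> w' i) = int (kdeg \<Lambda> y i) - int (kdeg \<Lambda> x i)" for i
      using fun_cong[OF w(2), of i] fun_cong[OF w'(2), of i] by linarith
    ultimately show "(t (gr x))\<^bold>* \<otimes> (pr z \<otimes> t (gr y)) \<in> homogeneous (\<lambda>i. int (kdeg \<Lambda> y i) - int (kdeg \<Lambda> x i))"
      using w w' by (auto intro: homogeneous.gen)
  qed
  finally show ?thesis .
qed

text \<open>The twist enters only as a nonzero scalar, so span and degree arguments may treat the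
  path and the groupoid element separately.\<close>

lemma t_decompose:
  assumes "(x, g) \<in> mor E"
  obtains u where "u \<noteq> 0" "t (x, g) = u \<odot> (t (gr x) \<otimes> t (gp g))"
  using t_cmp[of "gr x" "gp g"] cocycle_nonzero[of "gr x" "gp g"] cmp_gr_gp[OF assms] assms
  by (intro that[of "inverse (c (gr x) (gp g))"]) auto

lemma homogeneous_pair:
  assumes z: "\<zeta> \<in> mor E" and e: "\<eta> \<in> mor E"
  shows "(t \<zeta>)\<^bold>* \<otimes> t \<eta> \<in> homogeneous (\<lambda>i. int (kdeg E \<eta> i) - int (kdeg E \<zeta> i))"
proof -
  obtain x g y h where xg: "\<zeta> = (x, g)" "\<eta> = (y, h)" by (cases \<zeta>, cases \<eta>) auto
  obtain u where u: "t \<zeta> = u \<odot> (t (gr x) \<otimes> t (gp g))" using t_decompose[of x g] z xg by metis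
  obtain v where v: "t \<eta> = v \<odot> (t (gr y) \<otimes> t (gp h))" using t_decompose[of y h] e xg by metis
  have m: "x \<in> mor \<Lambda>" "y \<in> mor \<Lambda>" "g \<in> mor G" "h \<in> mor G" using z e xg by auto
  let ?d = "\<lambda>i. int (kdeg \<Lambda> y i) - int (kdeg \<Lambda> x i)"
  let ?a = "(t (gp g))\<^bold>* \<otimes> ((t (gr x))\<^bold>* \<otimes> t (gr y))"
  have a: "?a \<in> homogeneous ?d"
    using homogeneous_gp_adj_left[OF m(3)] homogeneous_graph_pair[OF m(1,2)] by blast
  \<comment> \<open>Right multiplication by \<open>t (gp h)\<close> is obtained from left
    multiplication by its adjoint, taking adjoints before and after.\<close>
  have "(t (gp h))\<^bold>* \<otimes> ?a\<^bold>* \<in> homogeneous (\<lambda>i. - ?d i)"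
    using homogeneous_gp_adj_left[OF m(4) homogeneous_adj[OF a]] .
  then have "((t (gp h))\<^bold>* \<otimes> ?a\<^bold>*)\<^bold>* \<in> homogeneous (\<lambda>i. - (- ?d i))" by (rule homogeneous_adj)
  moreover have "((t (gp h))\<^bold>* \<otimes> ?a\<^bold>*)\<^bold>* = ?a \<otimes> t (gp h)" using m by (simp add: adj_mult mult_assoc)
  ultimately have "?a \<otimes> t (gp h) \<in> homogeneous ?d" by simp
  then have "(cnj u * v) \<odot> (?a \<otimes> t (gp h)) \<in> homogeneous ?d" by (rule homogeneous_scale)
  moreover have "(t \<zeta>)\<^bold>* \<otimes> t \<eta> = (cnj u * v) \<odot> (?a \<otimes> t (gp h))"
    unfolding u v using m
    by (simp add: adj_smult adj_mult smult_mult_l smult_mult_r scale_scale mult_assoc mult.commute)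
  ultimately show ?thesis using xg by simp
qed

text \<open>Only the inner factors meet, the adjoint of \<open>t \<eta>\<close> and
  \<open>t \<alpha>\<close>; \<open>homogeneous_pair\<close> rewrites their product.\<close>

lemma homogeneous_mult:
  assumes x: "x \<in> homogeneous m" and y: "y \<in> homogeneous n"
  shows "x \<otimes> y \<in> homogeneous (\<lambda>i. m i + n i)"
  using x
proof (induction rule: homogeneous.induct)
  case zero then show ?case using homogeneous_closed[OF y] by (simp add: homogeneous.zero)
next
  case (add x x')
  then show ?case using homogeneous_closed y by (simp add: mult_l_distr homogeneous.add)
next
  case (gen \<zeta> \<eta> a)
  have "(t \<eta>)\<^bold>* \<otimes> y \<in> homogeneous (\<lambda>i. n i - int (kdeg E \<eta> i))"
    using y
  proof (induction rule: homogeneous.induct)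
    case (gen \<alpha> \<beta> b)
    note g = gen
    have "((t \<eta>)\<^bold>* \<otimes> t \<alpha>) \<otimes> (t \<beta>)\<^bold>* \<in> homogeneous (\<lambda>i. int (kdeg E \<alpha> i) - int (kdeg E \<eta> i) - int (kdeg E \<beta> i))"
      using homogeneous_mult_t_adj_right[OF g(2) homogeneous_pair[OF \<open>\<eta> \<in> mor E\<close> g(1)]] .
    moreover have "(\<lambda>i. int (kdeg E \<alpha> i) - int (kdeg E \<eta> i) - int (kdeg E \<beta> i)) = (\<lambda>i. n i - int (kdeg E \<eta> i))"
      using g(3) by (auto simp: fun_eq_iff algebra_simps)
    ultimately show ?case using homogeneous_scale g \<open>\<eta> \<in> mor E\<close> by (simp add: smult_mult_r mult_assoc)
  qed (use \<open>\<eta> \<in> mor E\<close> in \<open>auto simp: mult_r_distr homogeneous_closed intro: homogeneous.intros\<close>)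
  then have "t \<zeta> \<otimes> ((t \<eta>)\<^bold>* \<otimes> y) \<in> homogeneous (\<lambda>i. int (kdeg E \<zeta> i) + (n i - int (kdeg E \<eta> i)))"
    by (rule homogeneous_mult_t_left[OF gen(1)])
  moreover have "(\<lambda>i. int (kdeg E \<zeta> i) + (n i - int (kdeg E \<eta> i))) = (\<lambda>i. m i + n i)"
    using gen(3) by (auto simp: fun_eq_iff algebra_simps)
  ultimately show ?case
    using homogeneous_scale gen homogeneous_closed[OF y] by (simp add: smult_mult_l mult_assoc)
qed

end

context ck_rep
begin

subsection \<open>The dense subalgebra\<close>

text \<open>\<open>K = UNIV\<close> gives the dense star subalgebra of finite sums. A countable
  \<open>K\<close> gives a countable set, since the step rule builds elements along lists; it
  remains dense when \<open>K\<close> is dense in the plane.\<close>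

inductive_set spanned :: "complex set \<Rightarrow> 'a set" for K where
  zero: "\<zero> \<in> spanned K"
| step: "\<lbrakk>x \<in> spanned K; a \<in> K; \<zeta> \<in> mor E; \<eta> \<in> mor E\<rbrakk> \<Longrightarrow> a \<odot> (t \<zeta> \<otimes> (t \<eta>)\<^bold>*) \<oplus> x \<in> spanned K"

lemma spanned_closed: "x \<in> spanned K \<Longrightarrow> x \<in> carrier A"
  by (induction rule: spanned.induct) auto

lemma spanned_add: "\<lbrakk>x \<in> spanned K; y \<in> spanned K\<rbrakk> \<Longrightarrow> x \<oplus> y \<in> spanned K"
  by (induction rule: spanned.induct) (auto simp: a_assoc spanned_closed intro: spanned.step)

lemma homogeneous_spanned: "x \<in> homogeneous m \<Longrightarrow> x \<in> spanned UNIV"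
proof (induction rule: homogeneous.induct)
  case (gen \<zeta> \<eta> a)
  then show ?case using spanned.step[OF spanned.zero, of a UNIV \<zeta> \<eta>] by simp
qed (auto intro: spanned.zero spanned_add)

lemma spanned_scale: "x \<in> spanned UNIV \<Longrightarrow> a \<odot> x \<in> spanned UNIV"
proof (induction rule: spanned.induct)
  case (step x b \<zeta> \<eta>)
  then show ?case
    using spanned.step[of "a \<odot> x" UNIV "a * b" \<zeta> \<eta>] by (simp add: scale_add_right scale_scale spanned_closed)
qed (auto intro: spanned.zero)

lemma spanned_adj: "x \<in> spanned UNIV \<Longrightarrow> x\<^bold>* \<in> spanned UNIV"
proof (induction rule: spanned.induct)
  case (step x b \<zeta> \<eta>)
  then show ?case
    using spanned.step[of "x\<^bold>*" UNIV "cnj b" \<eta> \<zeta>] by (simp add: adj_add adj_smult adj_mult spanned_closed)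
qed (auto intro: spanned.zero)

lemma spanned_mult:
  assumes "x \<in> spanned UNIV" "y \<in> spanned UNIV"
  shows "x \<otimes> y \<in> spanned UNIV"
  using assms(1)
proof (induction rule: spanned.induct)
  case zero then show ?case using spanned_closed[OF assms(2)] by (simp add: spanned.zero)
next
  case (step x a \<zeta> \<eta>)
  have g: "a \<odot> (t \<zeta> \<otimes> (t \<eta>)\<^bold>*) \<in> homogeneous (\<lambda>i. int (kdeg E \<zeta> i) - int (kdeg E \<eta> i))"
    using step by (intro homogeneous.gen) auto
  have "a \<odot> (t \<zeta> \<otimes> (t \<eta>)\<^bold>*) \<otimes> y \<in> spanned UNIV"
    using assms(2)
  proof (induction rule: spanned.induct)
    case zero then show ?case using step by (simp add: spanned.zero)
  next
    case (step y b \<alpha> \<beta>)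
    have "b \<odot> (t \<alpha> \<otimes> (t \<beta>)\<^bold>*) \<in> homogeneous (\<lambda>i. int (kdeg E \<alpha> i) - int (kdeg E \<beta> i))"
      using step by (intro homogeneous.gen) auto
    from homogeneous_spanned[OF homogeneous_mult[OF g this]] spanned_add[OF _ step(5)]
    show ?case using homogeneous_closed[OF g] step by (simp add: mult_r_distr spanned_closed)
  qed
  from spanned_add[OF this step(5)] show ?case
    using homogeneous_closed[OF g] step assms(2) by (simp add: mult_l_distr spanned_closed)
qed

lemma t_spanned: "\<zeta> \<in> mor E \<Longrightarrow> t \<zeta> \<in> spanned UNIV"
  using spanned.step[OF spanned.zero, of 1 UNIV \<zeta> "src E \<zeta>"] E_src[of \<zeta>]
  by (simp add: t_obj_adj t_src)

lemma generated_subset_carrier: "cstar_generated A (t ` mor E) \<subseteq> carrier A"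
  by (rule cstar_generated_subset_carrier) auto

lemma spanned_dense:
  assumes "x \<in> cstar_generated A (t ` mor E)" "0 < e"
  obtains y where "y \<in> spanned UNIV" "nrm A (x \<ominus> y) < e"
  by (rule dense_in_generated[of "spanned UNIV" "t ` mor E" x e])
    (use assms in \<open>auto simp: spanned_closed t_spanned intro: spanned.zero spanned_add spanned_scale spanned_mult spanned_adj\<close>)

lemma nrm_gen_le_1: "\<lbrakk>\<zeta> \<in> mor E; \<eta> \<in> mor E\<rbrakk> \<Longrightarrow> nrm A (t \<zeta> \<otimes> (t \<eta>)\<^bold>*) \<le> 1"
  using nrm_mult[of "t \<zeta>" "(t \<eta>)\<^bold>*"] mult_mono[OF nrm_t_le_1[of \<zeta>] nrm_t_le_1[of \<eta>]]
  by (simp add: nrm_adj nrm_nonneg)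

text \<open>Countably many generators and a countable dense set of coefficients make the algebra
  separable.\<close>

lemma generated_embeds_real:
  assumes gen: "cstar_generated A (t ` mor E) = carrier A"
  obtains f :: "'a \<Rightarrow> real" where "inj_on f (carrier A)"
proof -
  obtain K :: "complex set" where K: "countable K" "\<And>X. open X \<Longrightarrow> X \<noteq> {} \<Longrightarrow> \<exists>d\<in>K. d \<in> X"
    using countable_dense_exists by blast
  let ?f = "\<lambda>l. foldr (\<lambda>(a, \<zeta>, \<eta>) x. a \<odot> (t \<zeta> \<otimes> (t \<eta>)\<^bold>*) \<oplus> x) l \<zero>"
  have sub: "spanned K \<subseteq> ?f ` lists (K \<times> mor E \<times> mor E)"
  proof
    fix x assume "x \<in> spanned K"
    then show "x \<in> ?f ` lists (K \<times> mor E \<times> mor E)"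
    proof (induction rule: spanned.induct)
      case zero then show ?case by (intro image_eqI[of _ _ "[]"]) auto
    next
      case (step x a \<zeta> \<eta>)
      then obtain l where l: "l \<in> lists (K \<times> mor E \<times> mor E)" "x = ?f l" by blast
      then show ?case using step by (intro image_eqI[of _ _ "(a, \<zeta>, \<eta>) # l"]) auto
    qed
  qed
  have "countable (lists (K \<times> mor E \<times> mor E))"
    using K(1) countable_E by (intro countable_lists) simp
  then have c: "countable (spanned K)" by (rule countable_subset[OF sub countable_image])
  have approx: "\<exists>y\<in>spanned K. nrm A (x \<ominus> y) < e" if "x \<in> spanned UNIV" "e > 0" for x e
    using that
  proof (induction arbitrary: e rule: spanned.induct)
    case zero then show ?case by (intro bexI[of _ \<zero>]) (auto intro: spanned.zero)
  next
    case (step x a \<zeta> \<eta>)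
    obtain y where y: "y \<in> spanned K" "nrm A (x \<ominus> y) < e / 2" using step.IH[of "e / 2"] step.prems by auto
    obtain b where b: "b \<in> K" "dist a b < e / 2"
      using K(2)[of "ball a (e / 2)"] step.prems by (auto simp: mem_ball)
    let ?g = "t \<zeta> \<otimes> (t \<eta>)\<^bold>*"
    have g: "?g \<in> carrier A" using step by auto
    note yc = spanned_closed[OF y(1)] and xc = spanned_closed[OF step(1)]
    have "a \<odot> ?g \<ominus> b \<odot> ?g = (a - b) \<odot> ?g"
      using g scale_add_left[of ?g a "- b"] by (simp add: diff_eq_scale scale_scale)
    then have "nrm A (a \<odot> ?g \<ominus> b \<odot> ?g) \<le> dist a b * 1"
      using g nrm_gen_le_1[of \<zeta> \<eta>] step by (simp add: nrm_smult dist_norm mult_left_le)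
    moreover have "nrm A ((a \<odot> ?g \<oplus> x) \<ominus> (b \<odot> ?g \<oplus> y)) \<le> nrm A (a \<odot> ?g \<ominus> b \<odot> ?g) + nrm A (x \<ominus> y)"
      using g xc yc nrm_triangle[of "a \<odot> ?g \<ominus> b \<odot> ?g" "x \<ominus> y"] by (simp add: add_diff_add)
    ultimately have "nrm A ((a \<odot> ?g \<oplus> x) \<ominus> (b \<odot> ?g \<oplus> y)) < e" using y b by linarith
    then show ?case using spanned.step[OF y(1) b(1)] step by blast
  qed
  have "\<exists>y\<in>spanned K. nrm A (x \<ominus> y) < e" if x: "x \<in> carrier A" and e: "e > 0" for x e
  proof -
    have half: "0 < e / 2" using e by simp
    obtain z where z: "z \<in> spanned UNIV" "nrm A (x \<ominus> z) < e / 2"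
      using spanned_dense[of x "e / 2"] x half gen by blast
    obtain y where y: "y \<in> spanned K" "nrm A (z \<ominus> y) < e / 2" using approx[OF z(1) half] by blast
    then show ?thesis using z nrm_diff_triangle[OF x spanned_closed[OF z(1)] spanned_closed[OF y(1)]]
      by (intro bexI[of _ y]) auto
  qed
  then show thesis using separable_embeds_real[OF c] that spanned_closed by blast
qed

text \<open>Terms are sorted by degree. \<open>f\<close> is total and zero off \<open>M\<close>, so
  that two decompositions can be summed over the union of their index sets.\<close>

lemma spanned_decompose:
  assumes "x \<in> spanned UNIV"
  obtains M f where "finite M" "\<And>m. f m \<in> homogeneous m" "\<And>m. m \<notin> M \<Longrightarrow> f m = \<zero>"
    "\<And>m i. \<lbrakk>m \<in> M; k \<le> i\<rbrakk> \<Longrightarrow> m i = 0" "x = (\<Oplus>m\<in>M. f m)"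
proof -
  have "\<exists>M f. finite M \<and> (\<forall>m. f m \<in> homogeneous m) \<and> (\<forall>m. m \<notin> M \<longrightarrow> f m = \<zero>) \<and>
      (\<forall>m i. m \<in> M \<longrightarrow> k \<le> i \<longrightarrow> m i = 0) \<and> x = (\<Oplus>m\<in>M. f m)"
    using assms
  proof (induction rule: spanned.induct)
    case zero
    show ?case by (intro exI[of _ "{}"] exI[of _ "\<lambda>_. \<zero>"]) (simp add: homogeneous.zero)
  next
    case (step x a \<zeta> \<eta>)
    then obtain M f where M: "finite M" "\<And>m. f m \<in> homogeneous m" "\<And>m. m \<notin> M \<Longrightarrow> f m = \<zero>"
      "\<And>m i. m \<in> M \<Longrightarrow> k \<le> i \<Longrightarrow> m i = 0" "x = (\<Oplus>m\<in>M. f m)" by blast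
    define n where "n = (\<lambda>i. int (kdeg E \<zeta> i) - int (kdeg E \<eta> i))"
    define g where "g = a \<odot> (t \<zeta> \<otimes> (t \<eta>)\<^bold>*)"
    have g: "g \<in> homogeneous n" unfolding g_def using step by (intro homogeneous.gen) (auto simp: n_def)
    note gc = homogeneous_closed[OF g] and fc = homogeneous_closed[OF M(2)]
    define N where "N = M - {n}"
    have N: "finite N" "n \<notin> N" "insert n N = insert n M" using M by (auto simp: N_def)
    have n0: "k \<le> i \<Longrightarrow> n i = 0" for i
      using step \<Lambda>.kdeg_Nk by (cases \<zeta>; cases \<eta>; auto simp: Nk_def n_def)
    have "x = (\<Oplus>m\<in>insert n M. f m)"
      unfolding M(5) using M(1) fc by (intro finsum_zero_extend) (auto intro: M(3))
    also have "\<dots> = f n \<oplus> (\<Oplus>m\<in>N. f m)"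
      unfolding N(3)[symmetric] using N fc by (subst finsum_insert) auto
    finally have x: "x = f n \<oplus> (\<Oplus>m\<in>N. f m)" .
    have "(\<Oplus>m\<in>insert n M. (f(n := g \<oplus> f n)) m) = (g \<oplus> f n) \<oplus> (\<Oplus>m\<in>N. (f(n := g \<oplus> f n)) m)"
      unfolding N(3)[symmetric] using N fc gc by (subst finsum_insert) auto
    also have "(\<Oplus>m\<in>N. (f(n := g \<oplus> f n)) m) = (\<Oplus>m\<in>N. f m)"
      using N fc by (intro finsum_cong') auto
    also have "(g \<oplus> f n) \<oplus> (\<Oplus>m\<in>N. f m) = g \<oplus> x"
      unfolding x using fc gc by (simp add: a_assoc finsum_closed Pi_iff)
    finally have "g \<oplus> x = (\<Oplus>m\<in>insert n M. (f(n := g \<oplus> f n)) m)" ..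
    moreover have "(f(n := g \<oplus> f n)) m \<in> homogeneous m" for m
      using homogeneous.add[OF g M(2)] M(2) by auto
    ultimately show ?case
      unfolding g_def[symmetric] using M n0 by (intro exI[of _ "insert n M"] exI[of _ "f(n := g \<oplus> f n)"]) auto
  qed
  then show thesis using that by blast
qed

end

subsection \<open>The gauge action\<close>

lemma cmod_torus_power: "z \<in> torus k \<Longrightarrow> cmod (torus_power k z n) = 1"
  by (simp add: torus_power_def torus_def norm_power flip: prod_norm)

lemma torus_power_mult_cnj:
  assumes z: "z \<in> torus k"
  shows "torus_power k z m * cnj (torus_power k z n) = torus_zpower k z (\<lambda>i. int (m i) - int (n i))"
proof -
  have "z i ^ m i * cnj (z i) ^ n i = z i powi (int (m i) - int (n i))" if "i < k" for i
  proof -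
    have c: "cmod (z i) = 1" using z that by (simp add: torus_def)
    then have "z i \<noteq> 0" by auto
    have "z i * cnj (z i) = 1" using complex_norm_square[of "z i"] c by simp
    then have "cnj (z i) = inverse (z i)" by (rule inverse_unique[symmetric])
    then show ?thesis using \<open>z i \<noteq> 0\<close> by (simp add: power_int_diff power_inverse divide_inverse)
  qed
  then show ?thesis
    unfolding torus_power_def torus_zpower_def cnj_prod complex_cnj_power prod.distrib[symmetric]
    by (intro prod.cong) auto
qed

context ck_rep
begin

lemma homogeneous_eigen:
  assumes z: "z \<in> torus k" and \<alpha>: "star_hom A A \<alpha>"
    and eig: "\<And>\<zeta>. \<zeta> \<in> mor E \<Longrightarrow> \<alpha> (t \<zeta>) = torus_power k z (kdeg E \<zeta>) \<odot> t \<zeta>"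
    and x: "x \<in> homogeneous m"
  shows "\<alpha> x = torus_zpower k z m \<odot> x"
proof -
  interpret a: cstar_hom A A \<alpha> by (intro cstar_hom.intro cstar_hom_axioms.intro cstar_algebra_axioms \<alpha>)
  show ?thesis
    using x
  proof (induction rule: homogeneous.induct)
    case (gen \<zeta> \<eta> b)
    have "(\<lambda>i. int (kdeg E \<zeta> i) - int (kdeg E \<eta> i)) = m" using gen(3) by blast
    then show ?case
      using gen(1,2) torus_power_mult_cnj[OF z, of "kdeg E \<zeta>" "kdeg E \<eta>"]
      by (simp add: eig adj_smult smult_mult_l smult_mult_r scale_scale mult_ac)
  qed (auto simp: homogeneous_closed scale_add_right)
qed

text \<open>The degree is additive and zero on units, and the unimodular factors cancel in every
  range projection.\<close>

lemma ck_family_rotate: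
  assumes z: "z \<in> torus k"
  shows "ck_family k G \<Lambda> L R c A (\<lambda>\<zeta>. torus_power k z (kdeg E \<zeta>) \<odot> t \<zeta>)"
proof -
  let ?w = "\<lambda>\<zeta>. torus_power k z (kdeg E \<zeta>)"
  have uni: "?w \<zeta> * cnj (?w \<zeta>) = 1" for \<zeta>
    using cmod_torus_power[OF z, of "kdeg E \<zeta>"] by (metis complex_norm_square of_real_1 power_one)
  have w0: "torus_power k z (\<lambda>i. 0) = 1" by (simp add: torus_power_def)
  have pr: "(torus_power k z (kdeg \<Lambda> x) \<odot> t (gr x)) \<otimes> (torus_power k z (kdeg \<Lambda> x) \<odot> t (gr x))\<^bold>* = pr x" if "x \<in> mor \<Lambda>" for x
    using that uni[of "gr x"] by (simp add: adj_smult smult_mult_l smult_mult_r scale_scale mult_ac)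
  have "(?w \<zeta> \<odot> t \<zeta>) \<otimes> (?w \<eta> \<odot> t \<eta>) = (if src E \<zeta> = rng E \<eta> then c \<zeta> \<eta> \<odot> (?w (cmp E \<zeta> \<eta>) \<odot> t (cmp E \<zeta> \<eta>)) else \<zero>)"
    if "\<zeta> \<in> mor E" "\<eta> \<in> mor E" for \<zeta> \<eta>
  proof (cases "src E \<zeta> = rng E \<eta>")
    case True
    have "?w (cmp E \<zeta> \<eta>) = ?w \<zeta> * ?w \<eta>"
      using E_cmp(4)[OF that True] by (simp add: torus_power_def power_add prod.distrib)
    then show ?thesis
      using that True E_cmp(1)[OF that True] by (simp add: t_mult smult_mult_l smult_mult_r scale_scale mult_ac)
  qed (use that in \<open>simp add: t_mult_zero smult_mult_l smult_mult_r\<close>)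
  moreover have "(?w \<zeta> \<odot> t \<zeta>)\<^bold>* \<otimes> (?w \<zeta> \<odot> t \<zeta>) = ?w (src E \<zeta>) \<odot> t (src E \<zeta>)" if "\<zeta> \<in> mor E" for \<zeta>
    using that uni[of \<zeta>] E_src(1,4)[OF that] w0
    by (simp add: adj_smult smult_mult_l smult_mult_r scale_scale t_star mult_ac)
  moreover have "(\<Oplus>x\<in>I. (?w (gr x) \<odot> t (gr x)) \<otimes> (?w (gr x) \<odot> t (gr x))\<^bold>*) = (\<Oplus>x\<in>I. pr x)" if "I \<subseteq> mor \<Lambda>" for I
    using that by (intro finsum_cong') (auto simp: pr subset_iff)
  moreover have "MCE \<Lambda> x y \<subseteq> mor \<Lambda>" "paths_from \<Lambda> v n \<subseteq> mor \<Lambda>" for x y v n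
    by (auto simp: MCE_def paths_from_def)
  moreover have "?w (gr v) \<odot> t (gr v) = t (gr v)" if "v \<in> obj \<Lambda>" for v
    using objD[OF that] w0 by simp
  ultimately show ?thesis
    unfolding ck_family_def Let_def by (auto simp: pr pr_mult t_obj_sum)
qed

end

lemma ck_family_hom:
  assumes "ck_rep k G \<Lambda> L R A c t" "cstar_algebra B" "star_hom A B \<phi>"
  shows "ck_family k G \<Lambda> L R c B (\<lambda>\<zeta>. \<phi> (t \<zeta>))"
proof -
  interpret ck_rep k G \<Lambda> L R A c t by fact
  interpret h: cstar_hom A B \<phi>
    by (intro cstar_hom.intro cstar_hom_axioms.intro cstar_algebra_axioms assms)
  have pr: "\<phi> (pr x) = \<phi> (t (gr x)) \<otimes>\<^bsub>B\<^esub> adj B (\<phi> (t (gr x)))" if "x \<in> mor \<Lambda>" for x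
    using that by simp
  have "(\<Oplus>\<^bsub>B\<^esub>x\<in>I. \<phi> (t (gr x)) \<otimes>\<^bsub>B\<^esub> adj B (\<phi> (t (gr x)))) = \<phi> (\<Oplus>\<^bsub>A\<^esub>x\<in>I. pr x)" if "I \<subseteq> mor \<Lambda>" for I
    using that by (subst h.hom_finsum) (auto intro!: h.cod.finsum_cong')
  moreover have "MCE \<Lambda> x y \<subseteq> mor \<Lambda>" "paths_from \<Lambda> v n \<subseteq> mor \<Lambda>" for x y v n
    by (auto simp: MCE_def paths_from_def)
  moreover have "\<phi> (t \<zeta>) \<otimes>\<^bsub>B\<^esub> \<phi> (t \<eta>) = (if src E \<zeta> = rng E \<eta> then c \<zeta> \<eta> \<odot>\<^bsub>B\<^esub> \<phi> (t (cmp E \<zeta> \<eta>)) else \<zero>\<^bsub>B\<^esub>)"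
    if "\<zeta> \<in> mor E" "\<eta> \<in> mor E" for \<zeta> \<eta>
    using that t_mult[OF that] t_mult_zero[OF that] E_cmp(1)[OF that]
    by (auto simp flip: h.hom_simps(4))
  moreover have "adj B (\<phi> (t \<zeta>)) \<otimes>\<^bsub>B\<^esub> \<phi> (t \<zeta>) = \<phi> (t (src E \<zeta>))" if "\<zeta> \<in> mor E" for \<zeta>
    using that t_star[OF that] by (simp flip: h.hom_simps(4,5))
  moreover have "(\<phi> (t (gr x)) \<otimes>\<^bsub>B\<^esub> adj B (\<phi> (t (gr x)))) \<otimes>\<^bsub>B\<^esub> (\<phi> (t (gr y)) \<otimes>\<^bsub>B\<^esub> adj B (\<phi> (t (gr y))))
      = \<phi> (\<Oplus>\<^bsub>A\<^esub>z\<in>MCE \<Lambda> x y. pr z)" if "x \<in> mor \<Lambda>" "y \<in> mor \<Lambda>" for x y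
    using that pr_mult[OF that] by (simp flip: h.hom_simps(4,5))
  ultimately show ?thesis
    unfolding ck_family_def Let_def by (auto simp: t_obj_sum)
qed

text \<open>The rotated family is moved into an algebra with real carrier, where the universal
  property applies, and the resulting map is carried back. A star endomorphism is all that
  \<open>nrm_average_le\<close> asks for.\<close>

lemma gauge_automorphism:
  fixes B :: "'b cstar"
  assumes rep: "ck_rep k G \<Lambda> L R B c s" and univ: "universal_ck_algebra k G \<Lambda> L R c B s" and z: "z \<in> torus k"
  obtains \<gamma> where "star_hom B B \<gamma>"
    "\<And>\<zeta>. \<zeta> \<in> mor (zappa_szep G \<Lambda> L R) \<Longrightarrow>
      \<gamma> (s \<zeta>) = torus_power k z (kdeg (zappa_szep G \<Lambda> L R) \<zeta>) \<odot>\<^bsub>B\<^esub> s \<zeta>"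
proof -
  interpret ck_rep k G \<Lambda> L R B c s by fact
  let ?t = "\<lambda>\<zeta>. torus_power k z (kdeg E \<zeta>) \<odot>\<^bsub>B\<^esub> s \<zeta>"
  have "cstar_generated B (s ` mor E) = carrier B" using univ by (simp add: universal_ck_algebra_def)
  then obtain f :: "'b \<Rightarrow> real" where f: "inj_on f (carrier B)" using generated_embeds_real by blast
  have "ck_rep k G \<Lambda> L R B c ?t"
    using ck_family_rotate[OF z] ck_rep_axioms by (simp add: ck_rep_def ck_rep_axioms_def)
  then have "ck_family k G \<Lambda> L R c (transport f B) (\<lambda>\<zeta>. f (?t \<zeta>))"
    using ck_family_hom transport_cstar_algebra[OF f] transport_star_hom[OF f] by blast
  then obtain \<phi> where \<phi>: "star_hom B (transport f B) \<phi>" "\<And>\<zeta>. \<zeta> \<in> mor E \<Longrightarrow> \<phi> (s \<zeta>) = f (?t \<zeta>)"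
    using univ transport_cstar_algebra[OF f] unfolding universal_ck_algebra_def by blast
  show thesis
  proof (rule that)
    show "star_hom B B (\<lambda>x. inv_into (carrier B) f (\<phi> x))"
      using star_hom_comp[OF \<phi>(1) transport_star_hom_inv[OF f]] .
    show "inv_into (carrier B) f (\<phi> (s \<zeta>)) = ?t \<zeta>" if "\<zeta> \<in> mor E" for \<zeta>
      using that f by (simp add: \<phi>(2))
  qed
qed

subsection \<open>The core\<close>

text \<open>\<open>J\<close> stands for the image of the groupoid algebra in the ambient algebra: a
  star subalgebra that need not be closed.\<close>

locale ck_core = ck_rep k G \<Lambda> L R A c t
  for k :: nat and G :: "'m cat" and \<Lambda> :: "'m kgraph" and L R
    and A :: "('a, 'z) cstar_scheme" (structure) and c t +
  fixes J :: "'a set"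
  assumes J_closed: "x \<in> J \<Longrightarrow> x \<in> carrier A"
    and J_zero: "\<zero> \<in> J"
    and J_add: "\<lbrakk>x \<in> J; y \<in> J\<rbrakk> \<Longrightarrow> x \<oplus> y \<in> J"
    and J_scale: "x \<in> J \<Longrightarrow> a \<odot> x \<in> J"
    and J_mult: "\<lbrakk>x \<in> J; y \<in> J\<rbrakk> \<Longrightarrow> x \<otimes> y \<in> J"
    and J_adj: "x \<in> J \<Longrightarrow> adj A x \<in> J"
    and J_gp: "g \<in> mor G \<Longrightarrow> t (from_groupoid G g) \<in> J"
begin

definition proj :: "'m set \<Rightarrow> 'a" where "proj F = (\<Oplus>x\<in>F. pr x)"

text \<open>The corner over \<open>F\<close>: matrices over \<open>F\<close> with entries in \<open>J\<close>.\<close>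

definition corner :: "'m set \<Rightarrow> 'a set" where
  "corner F = {x \<in> carrier A. proj F \<otimes> x = x \<and> x \<otimes> proj F = x \<and>
     (\<forall>\<mu>\<in>F. \<forall>\<nu>\<in>F. (t (gr \<mu>))\<^bold>* \<otimes> (x \<otimes> t (gr \<nu>)) \<in> J)}"

definition level :: "(nat \<Rightarrow> nat) \<Rightarrow> 'm set set" where
  "level n = {F. finite F \<and> F \<subseteq> mor \<Lambda> \<and> (\<forall>x\<in>F. kdeg \<Lambda> x = n)}"

lemma levelD: "F \<in> level n \<Longrightarrow> finite F" "\<lbrakk>F \<in> level n; x \<in> F\<rbrakk> \<Longrightarrow> x \<in> mor \<Lambda>"
  "\<lbrakk>F \<in> level n; x \<in> F\<rbrakk> \<Longrightarrow> kdeg \<Lambda> x = n"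
  by (auto simp: level_def)

lemma level_Un: "\<lbrakk>F \<in> level n; F' \<in> level n\<rbrakk> \<Longrightarrow> F \<union> F' \<in> level n"
  by (auto simp: level_def)

lemma J_finsum: "(\<And>i. i \<in> I \<Longrightarrow> f i \<in> J) \<Longrightarrow> (\<Oplus>i\<in>I. f i) \<in> J"
proof (induction I rule: infinite_finite_induct)
  case (insert i I)
  then have "f \<in> insert i I \<rightarrow> carrier A" using J_closed by blast
  then show ?case using insert by (auto simp: Pi_iff intro: J_add)
qed (auto intro: J_zero)

section \<open>Matrix calculus in a single corner\<close>

lemma corner_closed: "x \<in> corner F \<Longrightarrow> x \<in> carrier A"
  by (simp add: corner_def)

context
  fixes F n
  assumes F: "F \<in> level n"
begin

lemma pr_closed: "pr \<in> F \<rightarrow> carrier A"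
  using levelD(2)[OF F] by auto

lemma proj_closed [simp]: "proj F \<in> carrier A"
  unfolding proj_def using pr_closed by (rule finsum_closed)

lemma proj_t:
  assumes "x \<in> mor \<Lambda>" "kdeg \<Lambda> x = n"
  shows "proj F \<otimes> t (gr x) = (if x \<in> F then t (gr x) else \<zero>)"
proof -
  have term_eq: "pr y \<otimes> t (gr x) = (if x = y then t (gr y) else \<zero>)" if "y \<in> F" for y
  proof (cases "x = y")
    case False
    have "y \<in> mor \<Lambda>" "kdeg \<Lambda> y = kdeg \<Lambda> x" using levelD[OF F] that assms by auto
    then show ?thesis using False t_orthogonal[of y x] assms by (simp add: mult_assoc)
  qed (use assms t_pr in simp)
  have "proj F \<otimes> t (gr x) = (\<Oplus>y\<in>F. if x = y then t (gr y) else \<zero>)"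
    unfolding proj_def using assms pr_closed levelD(2)[OF F]
    by (subst mult_finsum_left) (auto intro!: finsum_cong' simp: term_eq)
  also have "\<dots> = (if x \<in> F then t (gr x) else \<zero>)"
  proof (cases "x \<in> F")
    case True
    then show ?thesis using levelD[OF F] by (simp, intro add.finprod_singleton) auto
  next
    case False
    then have "(\<Oplus>y\<in>F. if x = y then t (gr y) else \<zero>) = (\<Oplus>y\<in>F. \<zero>)"
      by (intro finsum_cong') auto
    then show ?thesis using False by simp
  qed
  finally show ?thesis .
qed

lemma proj_adj: "(proj F)\<^bold>* = proj F"
proof -
  have "(\<Oplus>x\<in>I. pr x)\<^bold>* = (\<Oplus>x\<in>I. pr x)" if "finite I" "I \<subseteq> mor \<Lambda>" for I
    using that
  proof (induction I)
    case (insert x I)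
    then have "pr \<in> I \<rightarrow> carrier A" by auto
    then show ?case using insert by (simp add: adj_add adj_mult finsum_closed)
  qed simp
  then show ?thesis unfolding proj_def using levelD[OF F] by blast
qed

lemma t_adj_proj:
  assumes "x \<in> mor \<Lambda>" "kdeg \<Lambda> x = n"
  shows "(t (gr x))\<^bold>* \<otimes> proj F = (if x \<in> F then (t (gr x))\<^bold>* else \<zero>)"
  using arg_cong[OF proj_t[OF assms], of "adj A"] assms(1) by (simp add: adj_mult proj_adj split: if_splits)

lemma corner_add: "\<lbrakk>x \<in> corner F; y \<in> corner F\<rbrakk> \<Longrightarrow> x \<oplus> y \<in> corner F"
  using levelD(2)[OF F] J_add by (auto simp: corner_def mult_r_distr mult_l_distr)

lemma corner_scale: "x \<in> corner F \<Longrightarrow> a \<odot> x \<in> corner F"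
  using levelD(2)[OF F] J_scale by (auto simp: corner_def smult_mult_l smult_mult_r)

lemma corner_zero: "\<zero> \<in> corner F"
  using levelD(2)[OF F] J_zero by (auto simp: corner_def)

lemma corner_adj:
  assumes "x \<in> corner F" shows "x\<^bold>* \<in> corner F"
proof -
  have x: "x \<in> carrier A" "proj F \<otimes> x = x" "x \<otimes> proj F = x"
    "\<And>\<mu> \<nu>. \<lbrakk>\<mu> \<in> F; \<nu> \<in> F\<rbrakk> \<Longrightarrow> (t (gr \<mu>))\<^bold>* \<otimes> (x \<otimes> t (gr \<nu>)) \<in> J"
    using assms by (auto simp: corner_def)
  have "proj F \<otimes> x\<^bold>* = x\<^bold>*" "x\<^bold>* \<otimes> proj F = x\<^bold>*"
    using arg_cong[OF x(3), of "adj A"] arg_cong[OF x(2), of "adj A"] x(1) by (simp_all add: adj_mult proj_adj)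
  moreover have "(t (gr \<mu>))\<^bold>* \<otimes> (x\<^bold>* \<otimes> t (gr \<nu>)) \<in> J" if "\<mu> \<in> F" "\<nu> \<in> F" for \<mu> \<nu>
    using J_adj[OF x(4)[OF that(2,1)]] levelD(2)[OF F] that x(1) by (simp add: adj_mult mult_assoc)
  ultimately show ?thesis using x(1) by (simp add: corner_def)
qed

text \<open>Inserting \<open>proj F\<close> between \<open>x\<close> and \<open>y\<close> gives the
  formula for matrix products, with \<open>F\<close> as the index set.\<close>

lemma mult_corner_expand:
  assumes "y \<in> corner F" "x \<in> carrier A"
  shows "x \<otimes> y = (\<Oplus>\<mu>\<in>F. (x \<otimes> t (gr \<mu>)) \<otimes> ((t (gr \<mu>))\<^bold>* \<otimes> y))"
proof -
  have y: "y \<in> carrier A" "proj F \<otimes> y = y" using assms by (auto simp: corner_def)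
  have "x \<otimes> y = x \<otimes> ((\<Oplus>\<mu>\<in>F. pr \<mu>) \<otimes> y)" using y by (simp add: proj_def)
  also have "(\<Oplus>\<mu>\<in>F. pr \<mu>) \<otimes> y = (\<Oplus>\<mu>\<in>F. pr \<mu> \<otimes> y)"
    using y pr_closed by (intro mult_finsum_left) auto
  also have "x \<otimes> \<dots> = (\<Oplus>\<mu>\<in>F. x \<otimes> (pr \<mu> \<otimes> y))"
    using y pr_closed assms(2) levelD(2)[OF F] by (intro mult_finsum_right) auto
  also have "\<dots> = (\<Oplus>\<mu>\<in>F. (x \<otimes> t (gr \<mu>)) \<otimes> ((t (gr \<mu>))\<^bold>* \<otimes> y))"
    using y assms(2) levelD(2)[OF F] by (intro finsum_cong') (auto simp: mult_assoc)
  finally show ?thesis .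
qed

lemma corner_mult:
  assumes x: "x \<in> corner F" and y: "y \<in> corner F"
  shows "x \<otimes> y \<in> corner F"
proof -
  note xc = corner_closed[OF x] and yc = corner_closed[OF y]
  have "proj F \<otimes> (x \<otimes> y) = x \<otimes> y" "(x \<otimes> y) \<otimes> proj F = x \<otimes> y"
    using x y xc yc by (auto simp: corner_def mult_assoc) (auto simp flip: mult_assoc)
  moreover have "(t (gr \<mu>))\<^bold>* \<otimes> ((x \<otimes> y) \<otimes> t (gr \<nu>)) \<in> J" if "\<mu> \<in> F" "\<nu> \<in> F" for \<mu> \<nu>
  proof -
    have m: "\<mu> \<in> mor \<Lambda>" "\<nu> \<in> mor \<Lambda>" using levelD(2)[OF F] that by auto
    have "(t (gr \<mu>))\<^bold>* \<otimes> ((x \<otimes> y) \<otimes> t (gr \<nu>)) = (((t (gr \<mu>))\<^bold>* \<otimes> x) \<otimes> y) \<otimes> t (gr \<nu>)"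
      using m xc yc by (simp add: mult_assoc)
    also have "((t (gr \<mu>))\<^bold>* \<otimes> x) \<otimes> y
        = (\<Oplus>\<rho>\<in>F. (((t (gr \<mu>))\<^bold>* \<otimes> x) \<otimes> t (gr \<rho>)) \<otimes> ((t (gr \<rho>))\<^bold>* \<otimes> y))"
      using m xc by (intro mult_corner_expand[OF y]) auto
    also have "\<dots> \<otimes> t (gr \<nu>)
        = (\<Oplus>\<rho>\<in>F. ((((t (gr \<mu>))\<^bold>* \<otimes> x) \<otimes> t (gr \<rho>)) \<otimes> ((t (gr \<rho>))\<^bold>* \<otimes> y)) \<otimes> t (gr \<nu>))"
      using m xc yc levelD(2)[OF F] by (intro mult_finsum_left) auto
    also have "\<dots> = (\<Oplus>\<rho>\<in>F. ((t (gr \<mu>))\<^bold>* \<otimes> (x \<otimes> t (gr \<rho>))) \<otimes> ((t (gr \<rho>))\<^bold>* \<otimes> (y \<otimes> t (gr \<nu>))))"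
      using m xc yc levelD(2)[OF F] by (intro finsum_cong') (auto simp: mult_assoc)
    also have "\<dots> \<in> J"
      by (rule J_finsum, rule J_mult) (use x y that in \<open>auto simp: corner_def\<close>)
    finally show ?thesis .
  qed
  ultimately show ?thesis using xc yc by (simp add: corner_def)
qed

text \<open>Sum over all matrix entries, one for each pair in \<open>F\<close>. The crude factor
  does no harm, since \<open>star_hom_nrm_le_of_bounded\<close> removes a constant that depends on
  \<open>F\<close> alone.\<close>

lemma nrm_corner_le:
  assumes x: "x \<in> corner F"
    and r: "\<And>\<mu> \<nu>. \<lbrakk>\<mu> \<in> F; \<nu> \<in> F\<rbrakk> \<Longrightarrow> nrm A ((t (gr \<mu>))\<^bold>* \<otimes> (x \<otimes> t (gr \<nu>))) \<le> r"
  shows "nrm A x \<le> real (card F) * (real (card F) * r)"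
proof -
  note xc = corner_closed[OF x]
  note m = levelD(2)[OF F]
  \<comment> \<open>A row is estimated through its adjoint, a column of the adjoint of
    \<open>x\<close>, so that expansion by \<open>proj F\<close> from the left applies
    again.\<close>
  have row: "nrm A ((t (gr \<mu>))\<^bold>* \<otimes> x) \<le> real (card F) * r" if \<mu>: "\<mu> \<in> F" for \<mu>
  proof -
    have xa: "x\<^bold>* \<in> corner F" by (rule corner_adj[OF x])
    have "nrm A ((t (gr \<mu>))\<^bold>* \<otimes> x) = nrm A (((t (gr \<mu>))\<^bold>* \<otimes> x)\<^bold>*)"
      using m[OF \<mu>] xc by (subst nrm_adj) auto
    also have "((t (gr \<mu>))\<^bold>* \<otimes> x)\<^bold>* = x\<^bold>* \<otimes> t (gr \<mu>)" using m[OF \<mu>] xc by (simp add: adj_mult)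
    also have "\<dots> = proj F \<otimes> (x\<^bold>* \<otimes> t (gr \<mu>))"
      using xa m[OF \<mu>] xc by (simp add: corner_def flip: mult_assoc)
    also have "\<dots> = (\<Oplus>\<nu>\<in>F. pr \<nu> \<otimes> (x\<^bold>* \<otimes> t (gr \<mu>)))"
      unfolding proj_def using pr_closed m[OF \<mu>] xc by (intro mult_finsum_left) auto
    also have "nrm A \<dots> \<le> (\<Sum>\<nu>\<in>F. nrm A (pr \<nu> \<otimes> (x\<^bold>* \<otimes> t (gr \<mu>))))"
      using m \<mu> xc by (intro nrm_finsum_le) auto
    also have "\<dots> \<le> (\<Sum>\<nu>\<in>F. r)"
    proof (rule sum_mono)
      fix \<nu> assume \<nu>: "\<nu> \<in> F"
      let ?y = "(t (gr \<nu>))\<^bold>* \<otimes> (x\<^bold>* \<otimes> t (gr \<mu>))"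
      have y: "?y \<in> carrier A" using m[OF \<nu>] m[OF \<mu>] xc by auto
      have "nrm A (pr \<nu> \<otimes> (x\<^bold>* \<otimes> t (gr \<mu>))) \<le> nrm A (t (gr \<nu>)) * nrm A ?y"
        using nrm_mult[of "t (gr \<nu>)" ?y] y m[OF \<nu>] m[OF \<mu>] xc by (simp add: mult_assoc)
      also have "\<dots> \<le> 1 * nrm A ?y"
        using nrm_t_le_1[of "gr \<nu>"] m[OF \<nu>] nrm_nonneg[OF y] by (intro mult_right_mono) auto
      also have "nrm A ?y = nrm A ((t (gr \<mu>))\<^bold>* \<otimes> (x \<otimes> t (gr \<nu>)))"
        using nrm_adj[OF y] m[OF \<nu>] m[OF \<mu>] xc by (simp add: adj_mult mult_assoc)
      finally show "nrm A (pr \<nu> \<otimes> (x\<^bold>* \<otimes> t (gr \<mu>))) \<le> r" using r[OF \<mu> \<nu>] by simp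
    qed
    finally show ?thesis by simp
  qed
  have "x = (\<Oplus>\<mu>\<in>F. pr \<mu>) \<otimes> x" using x by (simp add: corner_def proj_def)
  also have "\<dots> = (\<Oplus>\<mu>\<in>F. pr \<mu> \<otimes> x)"
    using pr_closed xc by (intro mult_finsum_left) auto
  finally have "nrm A x = nrm A (\<Oplus>\<mu>\<in>F. pr \<mu> \<otimes> x)" by simp
  also have "\<dots> \<le> (\<Sum>\<mu>\<in>F. nrm A (pr \<mu> \<otimes> x))" using m xc by (intro nrm_finsum_le) auto
  also have "\<dots> \<le> (\<Sum>\<mu>\<in>F. real (card F) * r)"
  proof (rule sum_mono)
    fix \<mu> assume \<mu>: "\<mu> \<in> F"
    let ?y = "(t (gr \<mu>))\<^bold>* \<otimes> x"
    have y: "?y \<in> carrier A" using m[OF \<mu>] xc by auto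
    have "nrm A (pr \<mu> \<otimes> x) \<le> nrm A (t (gr \<mu>)) * nrm A ?y"
      using nrm_mult[of "t (gr \<mu>)" ?y] y m[OF \<mu>] xc by (simp add: mult_assoc)
    also have "\<dots> \<le> 1 * nrm A ?y"
      using nrm_t_le_1[of "gr \<mu>"] m[OF \<mu>] nrm_nonneg[OF y] by (intro mult_right_mono) auto
    finally show "nrm A (pr \<mu> \<otimes> x) \<le> real (card F) * r" using row[OF \<mu>] by simp
  qed
  finally show ?thesis by simp
qed

text \<open>\<open>proj F\<close> kills the generators of paths in \<open>F' - F\<close>, so the new
  rows and columns are zero. Together with \<open>level_Un\<close> this puts two elements of one
  level into a common corner.\<close>

lemma corner_mono:
  assumes F': "F' \<in> level n" and sub: "F \<subseteq> F'" and x: "x \<in> corner F"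
  shows "x \<in> corner F'"
proof -
  note xc = corner_closed[OF x]
  have Px: "proj F \<otimes> x = x" "x \<otimes> proj F = x" using x by (auto simp: corner_def)
  have orth: "(t (gr \<mu>))\<^bold>* \<otimes> x = \<zero>" "x \<otimes> t (gr \<mu>) = \<zero>" if "\<mu> \<in> F' - F" for \<mu>
  proof -
    have m: "\<mu> \<in> mor \<Lambda>" "kdeg \<Lambda> \<mu> = n" "\<mu> \<notin> F" using levelD[OF F'] that by auto
    have "(t (gr \<mu>))\<^bold>* \<otimes> x = ((t (gr \<mu>))\<^bold>* \<otimes> proj F) \<otimes> x"
      using m(1) xc Px by (simp add: mult_assoc)
    then show "(t (gr \<mu>))\<^bold>* \<otimes> x = \<zero>" using t_adj_proj[OF m(1,2)] m(3) xc by simp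
    have "x \<otimes> t (gr \<mu>) = x \<otimes> (proj F \<otimes> t (gr \<mu>))"
      using m(1) xc Px by (simp flip: mult_assoc)
    then show "x \<otimes> t (gr \<mu>) = \<zero>" using proj_t[OF m(1,2)] m(3) xc by simp
  qed
  have p': "pr \<in> F' \<rightarrow> carrier A" using levelD(2)[OF F'] by auto
  have fin: "finite F'" using levelD(1)[OF F'] .
  have "(\<Oplus>\<mu>\<in>F'. pr \<mu>) \<otimes> x = (\<Oplus>\<mu>\<in>F'. pr \<mu> \<otimes> x)" using p' xc by (intro mult_finsum_left) auto
  also have "\<dots> = (\<Oplus>\<mu>\<in>F. pr \<mu> \<otimes> x)"
    using fin sub orth(1) levelD(2)[OF F'] xc
    by (intro finsum_zero_extend[symmetric]) (auto simp: mult_assoc)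
  also have "\<dots> = proj F \<otimes> x"
    unfolding proj_def using pr_closed xc by (intro mult_finsum_left[symmetric]) auto
  finally have 1: "proj F' \<otimes> x = x" using Px by (simp add: proj_def)
  have "x \<otimes> (\<Oplus>\<mu>\<in>F'. pr \<mu>) = (\<Oplus>\<mu>\<in>F'. x \<otimes> pr \<mu>)" using p' xc by (intro mult_finsum_right) auto
  also have "\<dots> = (\<Oplus>\<mu>\<in>F. x \<otimes> pr \<mu>)"
    using fin sub orth(2) levelD(2)[OF F'] xc
    by (intro finsum_zero_extend[symmetric]) (auto simp flip: mult_assoc)
  also have "\<dots> = x \<otimes> proj F"
    unfolding proj_def using pr_closed xc by (intro mult_finsum_right[symmetric]) auto
  finally have 2: "x \<otimes> proj F' = x" using Px by (simp add: proj_def)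
  have "(t (gr \<mu>))\<^bold>* \<otimes> (x \<otimes> t (gr \<nu>)) \<in> J" if mem: "\<mu> \<in> F'" "\<nu> \<in> F'" for \<mu> \<nu>
  proof -
    have m: "\<mu> \<in> mor \<Lambda>" "\<nu> \<in> mor \<Lambda>" using levelD(2)[OF F'] mem by auto
    consider "\<mu> \<in> F" "\<nu> \<in> F" | "\<mu> \<in> F' - F" | "\<nu> \<in> F' - F" using mem by blast
    then show ?thesis
    proof cases
      case 1 then show ?thesis using x by (simp add: corner_def)
    next
      case 2
      have "(t (gr \<mu>))\<^bold>* \<otimes> (x \<otimes> t (gr \<nu>)) = ((t (gr \<mu>))\<^bold>* \<otimes> x) \<otimes> t (gr \<nu>)"
        using m xc by (simp add: mult_assoc)
      then show ?thesis using orth(1)[OF 2] m J_zero by simp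
    next
      case 3 then show ?thesis using orth(2)[OF 3] m J_zero by simp
    qed
  qed
  then show ?thesis using 1 2 xc by (simp add: corner_def)
qed

end

text \<open>A directed union, so each element keeps a single finite \<open>F\<close> as index set.
  The degree is fixed because orthogonality of distinct paths is guaranteed only within one
  degree.\<close>

definition core :: "(nat \<Rightarrow> nat) \<Rightarrow> 'a set" where
  "core n = (\<Union>F\<in>level n. corner F)"

section \<open>Placing elements of degree zero in a corner\<close>

lemma core_zero: "\<zero> \<in> core n"
  using corner_zero[of "{}" n] by (auto simp: core_def level_def)

lemma core_closed: "x \<in> core n \<Longrightarrow> x \<in> carrier A"
  by (auto simp: core_def corner_closed)

lemma core_add:
  assumes "x \<in> core n" "y \<in> core n" shows "x \<oplus> y \<in> core n"
proof -
  obtain F F' where F: "F \<in> level n" "x \<in> corner F" and F': "F' \<in> level n" "y \<in> corner F'"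
    using assms by (auto simp: core_def)
  have "x \<in> corner (F \<union> F')" "y \<in> corner (F \<union> F')"
    using corner_mono[OF F(1) level_Un[OF F(1) F'(1)] _ F(2)]
      corner_mono[OF F'(1) level_Un[OF F(1) F'(1)] _ F'(2)] by auto
  then have "x \<oplus> y \<in> corner (F \<union> F')" using corner_add[OF level_Un[OF F(1) F'(1)]] by blast
  then show ?thesis using level_Un[OF F(1) F'(1)] by (auto simp: core_def)
qed

lemma core_scale: "x \<in> core n \<Longrightarrow> a \<odot> x \<in> core n"
  unfolding core_def using corner_scale by blast

lemma core_finsum: "(\<And>i. i \<in> I \<Longrightarrow> f i \<in> core n) \<Longrightarrow> (\<Oplus>i\<in>I. f i) \<in> core n"
proof (induction I rule: infinite_finite_induct)
  case (insert i I)
  then have "f \<in> insert i I \<rightarrow> carrier A" using core_closed by blast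
  then show ?case using insert by (auto simp: Pi_iff intro: core_add)
qed (auto intro: core_zero)

text \<open>At equal degree distinct paths are orthogonal, so at most the groupoid part of
  \<open>\<zeta>\<close> survives, up to a scalar.\<close>

lemma t_adj_pair_J:
  assumes z: "\<zeta> \<in> mor E" and \<mu>: "\<mu> \<in> mor \<Lambda>" "kdeg \<Lambda> \<mu> = kdeg E \<zeta>"
  shows "(t (gr \<mu>))\<^bold>* \<otimes> t \<zeta> \<in> J"
proof -
  obtain x g where xg: "\<zeta> = (x, g)" by (cases \<zeta>)
  obtain u where u: "t \<zeta> = u \<odot> (t (gr x) \<otimes> t (gp g))" using t_decompose[of x g] z xg by metis
  have m: "x \<in> mor \<Lambda>" "g \<in> mor G" "src \<Lambda> x = rng G g" using z xg by auto
  have eq: "(t (gr \<mu>))\<^bold>* \<otimes> t \<zeta> = u \<odot> (((t (gr \<mu>))\<^bold>* \<otimes> t (gr x)) \<otimes> t (gp g))"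
    unfolding u using m \<mu> by (simp add: smult_mult_r mult_assoc)
  show ?thesis
  proof (cases "\<mu> = x")
    case True
    have "(t (gr \<mu>))\<^bold>* \<otimes> t \<zeta> = u \<odot> t (gp g)"
      unfolding eq using True m t_star[of "gr x"] t_rng[of "gp g"] by simp
    then show ?thesis using J_scale[OF J_gp[OF m(2)]] by simp
  next
    case False
    then have "(t (gr \<mu>))\<^bold>* \<otimes> t (gr x) = \<zero>" using \<mu> m xg by (intro t_orthogonal) auto
    then show ?thesis unfolding eq using m J_zero by simp
  qed
qed

lemma gen_core:
  assumes z: "\<zeta> \<in> mor E" "kdeg E \<zeta> = n" and e: "\<eta> \<in> mor E" "kdeg E \<eta> = n"
  shows "t \<zeta> \<otimes> (t \<eta>)\<^bold>* \<in> core n"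
proof -
  obtain x g y h where xg: "\<zeta> = (x, g)" "\<eta> = (y, h)" by (cases \<zeta>, cases \<eta>) auto
  have m: "x \<in> mor \<Lambda>" "g \<in> mor G" "y \<in> mor \<Lambda>" "h \<in> mor G" "kdeg \<Lambda> x = n" "kdeg \<Lambda> y = n"
    using z e xg by auto
  define F where "F = {x, y}"
  have F: "F \<in> level n" using m by (auto simp: level_def F_def)
  have absorb: "proj F \<otimes> t \<alpha> = t \<alpha>" if al: "\<alpha> \<in> mor E" "fst \<alpha> \<in> F" for \<alpha>
  proof -
    obtain x g where a: "\<alpha> = (x, g)" by (cases \<alpha>)
    obtain u where u: "t \<alpha> = u \<odot> (t (gr x) \<otimes> t (gp g))" using t_decompose[of x g] al(1) a by metis
    have xF: "x \<in> F" "x \<in> mor \<Lambda>" "kdeg \<Lambda> x = n" "g \<in> mor G" using al a levelD[OF F] by auto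
    have "proj F \<otimes> t \<alpha> = u \<odot> ((proj F \<otimes> t (gr x)) \<otimes> t (gp g))"
      unfolding u using xF proj_closed[OF F] by (simp add: smult_mult_r mult_assoc)
    then show ?thesis using proj_t[OF F xF(2,3)] xF(1) u by simp
  qed
  have P: "proj F \<otimes> t \<zeta> = t \<zeta>" "proj F \<otimes> t \<eta> = t \<eta>"
    using absorb z e xg by (auto simp: F_def)
  have P': "(t \<eta>)\<^bold>* \<otimes> proj F = (t \<eta>)\<^bold>*"
    using arg_cong[OF P(2), of "adj A"] e proj_closed[OF F] by (simp add: adj_mult proj_adj[OF F])
  have "proj F \<otimes> (t \<zeta> \<otimes> (t \<eta>)\<^bold>*) = t \<zeta> \<otimes> (t \<eta>)\<^bold>*"
    using P(1) z e proj_closed[OF F] by (simp flip: mult_assoc)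
  moreover have "(t \<zeta> \<otimes> (t \<eta>)\<^bold>*) \<otimes> proj F = t \<zeta> \<otimes> (t \<eta>)\<^bold>*"
    using P' z e proj_closed[OF F] by (simp add: mult_assoc)
  moreover have "(t (gr \<mu>))\<^bold>* \<otimes> ((t \<zeta> \<otimes> (t \<eta>)\<^bold>*) \<otimes> t (gr \<nu>)) \<in> J" if "\<mu> \<in> F" "\<nu> \<in> F" for \<mu> \<nu>
  proof -
    have mm: "\<mu> \<in> mor \<Lambda>" "\<nu> \<in> mor \<Lambda>" "kdeg \<Lambda> \<mu> = n" "kdeg \<Lambda> \<nu> = n" using levelD[OF F] that by auto
    have "((t (gr \<mu>))\<^bold>* \<otimes> t \<zeta>) \<otimes> ((t (gr \<nu>))\<^bold>* \<otimes> t \<eta>)\<^bold>* \<in> J"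
      by (rule J_mult, rule t_adj_pair_J, use mm z e in simp_all)
        (rule J_adj, rule t_adj_pair_J, use mm z e in simp_all)
    then show ?thesis using mm z e by (simp add: adj_mult mult_assoc)
  qed
  ultimately have "t \<zeta> \<otimes> (t \<eta>)\<^bold>* \<in> corner F" using z e by (simp add: corner_def)
  then show ?thesis using F by (auto simp: core_def)
qed

text \<open>Row-finiteness and the absence of sources enter here: (CK) refines a generator to any
  larger degree.\<close>

lemma gen_core_refine:
  assumes z: "\<zeta> \<in> mor E" "kdeg E \<zeta> = n" and e: "\<eta> \<in> mor E" "kdeg E \<eta> = n"
    and n': "n' \<in> Nk k" "\<And>i. n i \<le> n' i"
  shows "t \<zeta> \<otimes> (t \<eta>)\<^bold>* \<in> core n'"
proof -
  obtain x g where xg: "\<zeta> = (x, g)" by (cases \<zeta>)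
  define v where "v = src G g"
  have v: "v \<in> obj \<Lambda>" "src E \<zeta> = (v, v)" using z xg src_rng_obj by (auto simp: v_def)
  \<comment> \<open>The missing degree, at which (CK) expands the source projection of
    \<open>\<zeta>\<close>.\<close>
  define m where "m = (\<lambda>i. n' i - n i)"
  have m: "m \<in> Nk k" "n' = (\<lambda>i. n i + m i)" using n' by (auto simp: m_def Nk_def fun_eq_iff)
  let ?I = "paths_from \<Lambda> v m"
  have I: "\<rho> \<in> mor \<Lambda>" "rng \<Lambda> \<rho> = v" "kdeg \<Lambda> \<rho> = m" if "\<rho> \<in> ?I" for \<rho>
    using that by (auto simp: paths_from_def)
  have "t \<zeta> \<otimes> (t \<eta>)\<^bold>* = (t \<zeta> \<otimes> t (gr v)) \<otimes> (t \<eta>)\<^bold>*"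
    using t_src[OF z(1)] v gr_obj[OF v(1)] by simp
  also have "t \<zeta> \<otimes> t (gr v) = (\<Oplus>\<rho>\<in>?I. t \<zeta> \<otimes> pr \<rho>)"
    unfolding t_obj_sum[OF v(1) m(1)] using I z by (intro mult_finsum_right) auto
  also have "\<dots> \<otimes> (t \<eta>)\<^bold>* = (\<Oplus>\<rho>\<in>?I. (t \<zeta> \<otimes> pr \<rho>) \<otimes> (t \<eta>)\<^bold>*)"
    using I z e by (intro mult_finsum_left) auto
  also have "\<dots> \<in> core n'"
  proof (rule core_finsum)
    fix \<rho> assume l: "\<rho> \<in> ?I"
    have eq: "(t \<zeta> \<otimes> pr \<rho>) \<otimes> (t \<eta>)\<^bold>* = (t \<zeta> \<otimes> t (gr \<rho>)) \<otimes> (t \<eta> \<otimes> t (gr \<rho>))\<^bold>*"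
      using I[OF l] z e by (simp add: adj_mult mult_assoc)
    have zl: "src E \<zeta> = rng E (gr \<rho>)" using I[OF l] v by simp
    show "(t \<zeta> \<otimes> pr \<rho>) \<otimes> (t \<eta>)\<^bold>* \<in> core n'"
    proof (cases "src E \<eta> = rng E (gr \<rho>)")
      case True
      let ?a = "cmp E \<zeta> (gr \<rho>)" and ?b = "cmp E \<eta> (gr \<rho>)"
      have ab: "?a \<in> mor E" "?b \<in> mor E" "kdeg E ?a = n'" "kdeg E ?b = n'"
        using E_cmp[OF z(1) _ zl] E_cmp[OF e(1) _ True] I[OF l] z e m(2) by auto
      have "(t \<zeta> \<otimes> pr \<rho>) \<otimes> (t \<eta>)\<^bold>* = (c \<zeta> (gr \<rho>) * cnj (c \<eta> (gr \<rho>))) \<odot> (t ?a \<otimes> (t ?b)\<^bold>*)"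
        unfolding eq using I[OF l] z e zl True ab
        by (simp add: t_mult adj_smult smult_mult_l smult_mult_r scale_scale mult.commute)
      then show ?thesis using core_scale[OF gen_core[OF ab(1,3,2,4)]] by simp
    next
      case False
      then show ?thesis unfolding eq using I[OF l] z e by (simp add: t_mult_zero core_zero)
    qed
  qed
  finally show ?thesis .
qed

lemma homogeneous_zero_core:
  assumes "x \<in> homogeneous (\<lambda>_. 0)"
  obtains n where "x \<in> core n"
proof -
  \<comment> \<open>All levels above \<open>n0\<close> are claimed, so that the summands of a sum
    can be moved to a common level; pointwise addition of two thresholds serves as upper
    bound.\<close>
  have "\<exists>n0\<in>Nk k. \<forall>n\<in>Nk k. (\<forall>i. n0 i \<le> n i) \<longrightarrow> x \<in> core n"
    using assms
  proof (induction rule: homogeneous.induct)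
    case zero
    show ?case by (intro bexI[of _ "\<lambda>_. 0"]) (auto simp: core_zero Nk_def)
  next
    case (gen \<zeta> \<eta> a)
    then have "kdeg E \<eta> = kdeg E \<zeta>" by (auto simp: fun_eq_iff)
    moreover have "kdeg E \<zeta> \<in> Nk k" using gen(1) \<Lambda>.kdeg_Nk by (cases \<zeta>) auto
    ultimately show ?case
      using gen(1,2) gen_core_refine[of \<zeta> "kdeg E \<zeta>" \<eta>] core_scale by (intro bexI[of _ "kdeg E \<zeta>"]) auto
  next
    case (add x y)
    then obtain m n where m: "m \<in> Nk k" "\<And>n. \<lbrakk>n \<in> Nk k; \<forall>i. m i \<le> n i\<rbrakk> \<Longrightarrow> x \<in> core n"
      and n: "n \<in> Nk k" "\<And>m. \<lbrakk>m \<in> Nk k; \<forall>i. n i \<le> m i\<rbrakk> \<Longrightarrow> y \<in> core m" by blast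
    show ?case
    proof (intro bexI[of _ "\<lambda>i. m i + n i"] ballI impI)
      show "(\<lambda>i. m i + n i) \<in> Nk k" using m n by (auto simp: Nk_def)
      fix l assume l: "l \<in> Nk k" "\<forall>i. m i + n i \<le> l i"
      then have "\<forall>i. m i \<le> l i" "\<forall>i. n i \<le> l i" by (meson add_leD1 add_leD2)+
      then show "x \<oplus> y \<in> core l" using m(2) n(2) l(1) core_add by blast
    qed
  qed
  then obtain n0 where "n0 \<in> Nk k" "\<forall>n\<in>Nk k. (\<forall>i. n0 i \<le> n i) \<longrightarrow> x \<in> core n" by blast
  then have "x \<in> core n0" by blast
  then show thesis by (rule that)
qed

text \<open>Matrix entries lie in \<open>J\<close>, where \<pi> does not decrease norms, and
  compression by the contractions \<open>t (gr \<mu>)\<close> keeps their images below the norm of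
  \<open>\<pi> a\<close>. This bounds \<open>a\<close> up to the square of \<open>card F\<close>. A
  corner is closed under products, so the power trick runs with that one constant; degree
  \<open>m\<close> follows from \<open>adj A x \<otimes> x\<close>, which has degree zero.\<close>

lemma homogeneous_nrm_le:
  assumes B: "cstar_algebra B" and \<pi>: "star_hom A B \<pi>"
    and J: "\<And>y. y \<in> J \<Longrightarrow> nrm A y \<le> nrm B (\<pi> y)"
    and x: "x \<in> homogeneous m"
  shows "nrm A x \<le> nrm B (\<pi> x)"
proof -
  interpret p: cstar_hom A B \<pi> by (intro cstar_hom.intro cstar_hom_axioms.intro cstar_algebra_axioms B \<pi>)
  have core: "nrm A y \<le> nrm B (\<pi> y)" if y: "y \<in> core n" for y n
  proof -
    obtain F where F: "F \<in> level n" "y \<in> corner F" using y by (auto simp: core_def)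
    show ?thesis
    proof (rule star_hom_nrm_le_of_bounded[where S = "corner F" and \<psi> = "\<lambda>x. x" and K = "real (card F) * real (card F)",
          OF cstar_algebra_axioms B cstar_algebra_axioms star_hom_ident \<pi> _ corner_mult[OF F(1)] corner_adj[OF F(1)] _ F(2)])
      fix a assume a: "a \<in> corner F"
      note ac = corner_closed[OF a]
      have "nrm A ((t (gr \<mu>))\<^bold>* \<otimes> (a \<otimes> t (gr \<nu>))) \<le> nrm B (\<pi> a)" if "\<mu> \<in> F" "\<nu> \<in> F" for \<mu> \<nu>
      proof -
        have m: "\<mu> \<in> mor \<Lambda>" "\<nu> \<in> mor \<Lambda>" using levelD(2)[OF F(1)] that by auto
        let ?p = "\<pi> (t (gr \<mu>))" and ?q = "\<pi> (t (gr \<nu>))"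
        have n1: "nrm B (adj B ?p) \<le> 1" "nrm B ?q \<le> 1"
          using p.hom_nrm_le[of "t (gr \<mu>)"] p.hom_nrm_le[of "t (gr \<nu>)"] nrm_t_le_1[of "gr \<mu>"] nrm_t_le_1[of "gr \<nu>"] m
          by (auto simp: p.cod.nrm_adj)
        have "nrm A ((t (gr \<mu>))\<^bold>* \<otimes> (a \<otimes> t (gr \<nu>))) \<le> nrm B (\<pi> ((t (gr \<mu>))\<^bold>* \<otimes> (a \<otimes> t (gr \<nu>))))"
          using a that by (intro J) (auto simp: corner_def)
        also have "\<dots> = nrm B (adj B ?p \<otimes>\<^bsub>B\<^esub> (\<pi> a \<otimes>\<^bsub>B\<^esub> ?q))" using m ac by simp
        also have "\<dots> \<le> nrm B (adj B ?p) * nrm B (\<pi> a \<otimes>\<^bsub>B\<^esub> ?q)"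
          using m ac by (intro p.cod.nrm_mult) auto
        also have "\<dots> \<le> 1 * (nrm B (\<pi> a) * nrm B ?q)"
          using m ac n1 by (intro mult_mono p.cod.nrm_mult) (auto simp: p.cod.nrm_nonneg)
        also have "\<dots> \<le> nrm B (\<pi> a) * 1"
          using m ac n1 by (simp add: mult_left_le p.cod.nrm_nonneg)
        finally show ?thesis by simp
      qed
      from nrm_corner_le[OF F(1) a this]
      show "nrm A a \<le> real (card F) * real (card F) * nrm B (\<pi> a)" by (simp add: mult.assoc)
    qed (use corner_closed in auto)
  qed
  note xc = homogeneous_closed[OF x]
  have "x\<^bold>* \<otimes> x \<in> homogeneous (\<lambda>_. 0)"
    using homogeneous_mult[OF homogeneous_adj[OF x] x] by simp
  then obtain n where "x\<^bold>* \<otimes> x \<in> core n" by (rule homogeneous_zero_core)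
  then have "nrm A (x\<^bold>* \<otimes> x) \<le> nrm B (\<pi> (x\<^bold>* \<otimes> x))" by (rule core)
  then have "(nrm A x)\<^sup>2 \<le> (nrm B (\<pi> x))\<^sup>2"
    using nrm_cstar[OF xc] p.cod.nrm_cstar[of "\<pi> x"] xc by simp
  then show ?thesis by (rule power2_le_imp_le) (use xc in \<open>simp add: p.cod.nrm_nonneg\<close>)
qed

end

section \<open>Gauge-invariant uniqueness\<close>

definition fejer_product :: "nat \<Rightarrow> nat \<Rightarrow> (nat \<Rightarrow> int) \<Rightarrow> real" where
  "fejer_product k N m = (\<Prod>i<k. fejer N (m i))"

lemma fejer_product_bounds: "0 \<le> fejer_product k N m" "fejer_product k N m \<le> 1"
  unfolding fejer_product_def by (auto intro!: prod_nonneg prod_le_1 simp: fejer_bounds)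

lemma fejer_product_tendsto: "(\<lambda>N. fejer_product k (Suc N) m) \<longlonglongrightarrow> 1"
  unfolding fejer_product_def using tendsto_prod[of "{..<k}" "\<lambda>i N. fejer (Suc N) (m i)" "\<lambda>_. 1"]
  by (simp add: fejer_tendsto)

text \<open>For given \<open>N\<close> only finitely many degrees survive, whatever element is
  averaged; this set is fixed before the second approximation is chosen.\<close>

lemma fejer_product_support:
  assumes "N > 0"
  shows "finite {m. (\<forall>i\<ge>k. m i = 0) \<and> fejer_product k N m \<noteq> 0}"
proof (rule finite_subset)
  show "finite {m. \<forall>i. (i \<in> {..<k} \<longrightarrow> m i \<in> {- int N..int N}) \<and> (i \<notin> {..<k} \<longrightarrow> m i = 0)}"
    by (intro finite_set_of_finite_funs) auto
  show "{m. (\<forall>i\<ge>k. m i = 0) \<and> fejer_product k N m \<noteq> 0}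
      \<subseteq> {m. \<forall>i. (i \<in> {..<k} \<longrightarrow> m i \<in> {- int N..int N}) \<and> (i \<notin> {..<k} \<longrightarrow> m i = 0)}"
  proof
    fix m assume "m \<in> {m. (\<forall>i\<ge>k. m i = 0) \<and> fejer_product k N m \<noteq> 0}"
    then have m: "\<And>i. k \<le> i \<Longrightarrow> m i = 0" "\<And>i. i < k \<Longrightarrow> fejer N (m i) \<noteq> 0"
      by (auto simp: fejer_product_def)
    have "m i \<in> {- int N..int N}" if "i < k" for i
    proof -
      have "\<bar>m i\<bar> < int N" using fejer_eq_0[OF assms, of "m i"] m(2)[OF that] by linarith
      then show ?thesis by auto
    qed
    then show "m \<in> {m. \<forall>i. (i \<in> {..<k} \<longrightarrow> m i \<in> {- int N..int N}) \<and> (i \<notin> {..<k} \<longrightarrow> m i = 0)}"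
      using m(1) by simp
  qed
qed

text \<open>The chain runs from \<open>x\<close> to \<open>b0\<close>, to its Fejer mean
  \<open>\<sigma> f0\<close>, to the Fejer mean \<open>\<sigma> f1\<close> of a second approximation
  \<open>b1\<close>, with distances d, d and 2d; the last mean has norm at most d, hence the bound
  5d. The choices are ordered: \<open>b0\<close> determines \<open>N\<close>, \<open>N\<close>
  determines the finite set \<open>K\<close> of visible degrees, \<open>K\<close> determines
  \<open>e\<close>, and \<open>b1\<close> lies within \<open>e\<close> of \<open>x\<close>. The
  element \<open>b0\<close> cannot serve as \<open>b1\<close>, since its components are only bounded
  by d while the number of visible ones depends on \<open>N\<close>.\<close>

lemma gauge_invariant_uniqueness:
  fixes B :: "'b cstar" and A :: "'a cstar"
  assumes core: "ck_core k G \<Lambda> L R B c s J" and rep: "ck_rep k G \<Lambda> L R A c S"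
    and univ: "universal_ck_algebra k G \<Lambda> L R c B s"
    and \<pi>: "star_hom B A \<pi>" and \<pi>_gen: "\<And>\<zeta>. \<zeta> \<in> mor (zappa_szep G \<Lambda> L R) \<Longrightarrow> \<pi> (s \<zeta>) = S \<zeta>"
    and \<beta>: "\<And>z. z \<in> torus k \<Longrightarrow> star_hom A A (\<beta> z)"
      "\<And>z \<zeta>. \<lbrakk>z \<in> torus k; \<zeta> \<in> mor (zappa_szep G \<Lambda> L R)\<rbrakk> \<Longrightarrow>
        \<beta> z (S \<zeta>) = torus_power k z (kdeg (zappa_szep G \<Lambda> L R) \<zeta>) \<odot>\<^bsub>A\<^esub> S \<zeta>"
    and J: "\<And>y. y \<in> J \<Longrightarrow> nrm B y \<le> nrm A (\<pi> y)"
    and x: "x \<in> carrier B" "\<pi> x = \<zero>\<^bsub>A\<^esub>"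
  shows "x = \<zero>\<^bsub>B\<^esub>"
proof -
  interpret b: ck_core k G \<Lambda> L R B c s J by (rule core)
  interpret a: ck_rep k G \<Lambda> L R A c S by (rule rep)
  interpret p: cstar_hom B A \<pi>
    by (intro cstar_hom.intro cstar_hom_axioms.intro b.cstar_algebra_axioms a.cstar_algebra_axioms \<pi>)
  have "\<forall>z. \<exists>\<gamma>. z \<in> torus k \<longrightarrow> star_hom B B \<gamma> \<and>
      (\<forall>\<zeta>\<in>mor b.E. \<gamma> (s \<zeta>) = torus_power k z (kdeg b.E \<zeta>) \<odot>\<^bsub>B\<^esub> s \<zeta>)"
    using gauge_automorphism[OF b.ck_rep_axioms univ] by metis
  then obtain \<gamma> where \<gamma>: "\<And>z. z \<in> torus k \<Longrightarrow> star_hom B B (\<gamma> z)"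
    "\<And>z \<zeta>. \<lbrakk>z \<in> torus k; \<zeta> \<in> mor b.E\<rbrakk> \<Longrightarrow> \<gamma> z (s \<zeta>) = torus_power k z (kdeg b.E \<zeta>) \<odot>\<^bsub>B\<^esub> s \<zeta>"
    by metis
  have \<pi>_hom: "\<pi> y \<in> a.homogeneous m" if "y \<in> b.homogeneous m" for y m
    using that
  proof (induction rule: b.homogeneous.induct)
    case (gen \<zeta> \<eta> r)
    then show ?case using a.homogeneous.gen[of \<zeta> \<eta> m r] by (simp add: \<pi>_gen)
  qed (auto intro: a.homogeneous.intros simp: b.homogeneous_closed)
  have gen: "cstar_generated B (s ` mor b.E) = carrier B" using univ by (simp add: universal_ck_algebra_def)
  have "nrm B x \<le> 5 * d" if d: "d > 0" for d
  proof -
    obtain b0 where b0: "b0 \<in> b.spanned UNIV" "nrm B (x \<ominus>\<^bsub>B\<^esub> b0) < d"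
      using b.spanned_dense[of x d] x gen d by blast
    obtain M0 f0 where f0: "finite M0" "\<And>m. f0 m \<in> b.homogeneous m" "\<And>m. m \<notin> M0 \<Longrightarrow> f0 m = \<zero>\<^bsub>B\<^esub>"
      "\<And>m i. \<lbrakk>m \<in> M0; k \<le> i\<rbrakk> \<Longrightarrow> m i = 0" "b0 = (\<Oplus>\<^bsub>B\<^esub>m\<in>M0. f0 m)"
      using b.spanned_decompose[OF b0(1)] by metis
    note c0 = b.homogeneous_closed[OF f0(2)]
    have "(\<lambda>N. \<Sum>m\<in>M0. (1 - fejer_product k (Suc N) m) * nrm B (f0 m)) \<longlonglongrightarrow> (\<Sum>m\<in>M0. (1 - 1) * nrm B (f0 m))"
      by (intro tendsto_intros fejer_product_tendsto)
    then have "(\<lambda>N. \<Sum>m\<in>M0. (1 - fejer_product k (Suc N) m) * nrm B (f0 m)) \<longlonglongrightarrow> 0" by simp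
    then obtain N0 where "norm ((\<Sum>m\<in>M0. (1 - fejer_product k (Suc N0) m) * nrm B (f0 m)) - 0) < d"
      using LIMSEQ_D d by blast
    then have small: "(\<Sum>m\<in>M0. (1 - fejer_product k (Suc N0) m) * nrm B (f0 m)) \<le> d" by simp
    define N where "N = Suc N0"
    define F where "F = fejer_product k N"
    have F: "0 \<le> F m" "F m \<le> 1" for m by (simp_all add: F_def fejer_product_bounds)
    define K where "K = {m. (\<forall>i\<ge>k. m i = 0) \<and> F m \<noteq> 0}"
    have K: "finite K" unfolding K_def F_def by (rule fejer_product_support) (simp add: N_def)
    \<comment> \<open>The summand 1 covers an empty \<open>K\<close> and yields
      \<open>e \<le> d\<close>.\<close>
    define e where "e = d / (real (card K) + 1)"
    have e: "0 < e" "e \<le> d" "real (card K) * e \<le> d"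
      using d by (auto simp: e_def field_simps)
    obtain b1 where b1: "b1 \<in> b.spanned UNIV" "nrm B (x \<ominus>\<^bsub>B\<^esub> b1) < e"
      using b.spanned_dense[of x e] x gen e by blast
    obtain M1 f1 where f1: "finite M1" "\<And>m. f1 m \<in> b.homogeneous m" "\<And>m. m \<notin> M1 \<Longrightarrow> f1 m = \<zero>\<^bsub>B\<^esub>"
      "\<And>m i. \<lbrakk>m \<in> M1; k \<le> i\<rbrakk> \<Longrightarrow> m i = 0" "b1 = (\<Oplus>\<^bsub>B\<^esub>m\<in>M1. f1 m)"
      using b.spanned_decompose[OF b1(1)] by metis
    note c1 = b.homogeneous_closed[OF f1(2)]
    note bc = b.spanned_closed[OF b0(1)] b.spanned_closed[OF b1(1)]
    define M where "M = M0 \<union> M1"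
    have M: "finite M" "\<And>m i. \<lbrakk>m \<in> M; k \<le> i\<rbrakk> \<Longrightarrow> m i = 0" using f0 f1 by (auto simp: M_def)
    have e0: "b0 = (\<Oplus>\<^bsub>B\<^esub>m\<in>M. f0 m)"
      unfolding f0(5) using M c0 by (intro b.finsum_zero_extend) (auto simp: M_def f0(3))
    have e1: "b1 = (\<Oplus>\<^bsub>B\<^esub>m\<in>M. f1 m)"
      unfolding f1(5) using M c1 by (intro b.finsum_zero_extend) (auto simp: M_def f1(3))
    define \<sigma> where "\<sigma> f = (\<Oplus>\<^bsub>B\<^esub>m\<in>M. complex_of_real (F m) \<odot>\<^bsub>B\<^esub> f m)" for f
    have \<sigma>c: "\<sigma> f0 \<in> carrier B" "\<sigma> f1 \<in> carrier B"
      unfolding \<sigma>_def using c0 c1 by (auto intro!: b.finsum_closed)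

    have "b0 \<ominus>\<^bsub>B\<^esub> \<sigma> f0 = (\<Oplus>\<^bsub>B\<^esub>m\<in>M. f0 m \<ominus>\<^bsub>B\<^esub> complex_of_real (F m) \<odot>\<^bsub>B\<^esub> f0 m)"
      unfolding e0 \<sigma>_def using c0 by (intro b.finsum_diff) auto
    then have "nrm B (b0 \<ominus>\<^bsub>B\<^esub> \<sigma> f0) \<le> (\<Sum>m\<in>M. nrm B (f0 m \<ominus>\<^bsub>B\<^esub> complex_of_real (F m) \<odot>\<^bsub>B\<^esub> f0 m))"
      using c0 by (auto intro!: b.nrm_finsum_le)
    also have "\<dots> = (\<Sum>m\<in>M. (1 - F m) * nrm B (f0 m))"
    proof (rule sum.cong[OF refl])
      fix m
      have "f0 m \<ominus>\<^bsub>B\<^esub> complex_of_real (F m) \<odot>\<^bsub>B\<^esub> f0 m = complex_of_real (1 - F m) \<odot>\<^bsub>B\<^esub> f0 m"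
        using b.scale_add_left[OF c0, of 1 "- complex_of_real (F m)" m] c0[of m]
        by (simp add: b.diff_eq_scale b.scale_scale)
      then show "nrm B (f0 m \<ominus>\<^bsub>B\<^esub> complex_of_real (F m) \<odot>\<^bsub>B\<^esub> f0 m) = (1 - F m) * nrm B (f0 m)"
        using c0[of m] F[of m] b.nrm_smult[of "f0 m" "complex_of_real (1 - F m)"] by (simp del: of_real_diff)
    qed
    also have "\<dots> = (\<Sum>m\<in>M0. (1 - F m) * nrm B (f0 m))"
      using M(1) by (intro sum.mono_neutral_right) (auto simp: M_def f0(3))
    finally have 1: "nrm B (b0 \<ominus>\<^bsub>B\<^esub> \<sigma> f0) \<le> d" using small by (simp add: F_def N_def)

    \<comment> \<open>The two means differ by the mean of the difference of \<open>b0\<close> and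
      \<open>b1\<close>, hence by at most d + e in norm.\<close>
    have diffH: "f0 m \<ominus>\<^bsub>B\<^esub> f1 m \<in> b.homogeneous m" for m
      using b.homogeneous.add[OF f0(2) b.homogeneous_scale[OF f1(2)], of m "-1"] c0 c1
      by (simp add: b.diff_eq_scale)
    have "\<sigma> f0 \<ominus>\<^bsub>B\<^esub> \<sigma> f1 = (\<Oplus>\<^bsub>B\<^esub>m\<in>M. complex_of_real (\<Prod>i<k. fejer N (m i)) \<odot>\<^bsub>B\<^esub> (f0 m \<ominus>\<^bsub>B\<^esub> f1 m))"
      unfolding \<sigma>_def using c0 c1
      by (subst b.finsum_diff) (auto simp: b.scale_diff_right F_def fejer_product_def intro!: b.finsum_cong')
    moreover have "nrm B (\<Oplus>\<^bsub>B\<^esub>m\<in>M. complex_of_real (\<Prod>i<k. fejer N (m i)) \<odot>\<^bsub>B\<^esub> (f0 m \<ominus>\<^bsub>B\<^esub> f1 m))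
        \<le> nrm B (\<Oplus>\<^bsub>B\<^esub>m\<in>M. f0 m \<ominus>\<^bsub>B\<^esub> f1 m)"
      using c0 c1 M(1) \<gamma> b.homogeneous_eigen[OF _ \<gamma>(1) \<gamma>(2) diffH]
      by (intro b.nrm_fejer_sum_le[where \<alpha> = \<gamma>]) (auto simp: N_def)
    moreover have "(\<Oplus>\<^bsub>B\<^esub>m\<in>M. f0 m \<ominus>\<^bsub>B\<^esub> f1 m) = b0 \<ominus>\<^bsub>B\<^esub> b1"
      unfolding e0 e1 using c0 c1 by (intro b.finsum_diff[symmetric]) auto
    moreover have "nrm B (b0 \<ominus>\<^bsub>B\<^esub> b1) \<le> nrm B (b0 \<ominus>\<^bsub>B\<^esub> x) + nrm B (x \<ominus>\<^bsub>B\<^esub> b1)"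
      using bc x by (intro b.nrm_diff_triangle) auto
    ultimately have 2: "nrm B (\<sigma> f0 \<ominus>\<^bsub>B\<^esub> \<sigma> f1) \<le> 2 * d"
      using b0(2) b1(2) e(2) b.nrm_diff_commute[OF bc(1) x(1)] by simp

    \<comment> \<open>\<open>\<pi>\<close> does not shrink homogeneous elements, extracting a
      component in \<open>A\<close> by means of \<open>\<beta>\<close> does not increase norms, and
      \<open>\<pi> x = 0\<close> makes \<open>\<pi> b1\<close> small.\<close>
    have comp: "nrm B (f1 n) \<le> e" if n: "n \<in> M" for n
    proof -
      have "nrm B (f1 n) \<le> nrm A (\<pi> (f1 n))"
        by (rule b.homogeneous_nrm_le[OF a.cstar_algebra_axioms \<pi> J f1(2)])
      also have "\<dots> \<le> nrm A (\<Oplus>\<^bsub>A\<^esub>m\<in>M. \<pi> (f1 m))"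
      proof (rule a.nrm_component_le[where k = k and M = M and x = "\<lambda>m. \<pi> (f1 m)" and \<alpha> = \<beta> and n = n])
        show "(\<lambda>m. \<pi> (f1 m)) \<in> M \<rightarrow> carrier A" using c1 by auto
        show "\<beta> z (\<pi> (f1 m)) = torus_zpower k z m \<odot>\<^bsub>A\<^esub> \<pi> (f1 m)" if "z \<in> torus k" for z m
          by (rule a.homogeneous_eigen[OF that \<beta>(1)[OF that] \<beta>(2)[OF that] \<pi>_hom[OF f1(2)]])
      qed (use M n \<beta>(1) in auto)
      also have "(\<Oplus>\<^bsub>A\<^esub>m\<in>M. \<pi> (f1 m)) = \<pi> b1"
        unfolding e1 using c1 by (intro p.hom_finsum[symmetric]) auto
      also have "nrm A (\<pi> b1) = nrm A (\<pi> (x \<ominus>\<^bsub>B\<^esub> b1))"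
        using x bc a.nrm_diff_commute[of "\<pi> b1" "\<zero>\<^bsub>A\<^esub>"] by simp
      also have "\<dots> \<le> e" using p.hom_nrm_le[of "x \<ominus>\<^bsub>B\<^esub> b1"] x bc b1(2) by simp
      finally show ?thesis .
    qed
    have "nrm B (\<sigma> f1) \<le> (\<Sum>m\<in>M. nrm B (complex_of_real (F m) \<odot>\<^bsub>B\<^esub> f1 m))"
      unfolding \<sigma>_def using c1 by (intro b.nrm_finsum_le) auto
    also have "\<dots> = (\<Sum>m\<in>M. F m * nrm B (f1 m))"
      using c1 F by (intro sum.cong) (auto simp: b.nrm_smult)
    \<comment> \<open>Only degrees in \<open>K\<close> carry weight, however large \<open>M\<close>
      is.\<close>
    also have "\<dots> = (\<Sum>m\<in>M \<inter> K. F m * nrm B (f1 m))"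
      using M by (intro sum.mono_neutral_right) (auto simp: K_def)
    also have "\<dots> \<le> (\<Sum>m\<in>M \<inter> K. 1 * e)"
      using F comp e c1 by (intro sum_mono mult_mono) (auto simp: b.nrm_nonneg)
    also have "\<dots> = real (card (M \<inter> K)) * e" by simp
    also have "\<dots> \<le> real (card K) * e"
      using K e by (intro mult_right_mono) (auto intro: card_mono)
    finally have 3: "nrm B (\<sigma> f1) \<le> d" using e(3) by simp

    have "nrm B x \<le> nrm B b0 + nrm B (x \<ominus>\<^bsub>B\<^esub> b0)" using x bc by (intro b.nrm_le_add_diff)
    moreover have "nrm B b0 \<le> nrm B (\<sigma> f0) + nrm B (b0 \<ominus>\<^bsub>B\<^esub> \<sigma> f0)" using bc \<sigma>c by (intro b.nrm_le_add_diff)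
    moreover have "nrm B (\<sigma> f0) \<le> nrm B (\<sigma> f1) + nrm B (\<sigma> f0 \<ominus>\<^bsub>B\<^esub> \<sigma> f1)" using \<sigma>c by (intro b.nrm_le_add_diff)
    ultimately show ?thesis using 1 2 3 b0(2) by linarith
  qed
  note bound = this
  have "nrm B x / 5 \<le> 0"
  proof (rule dense_ge)
    fix d :: real assume "0 < d"
    from bound[OF this] show "nrm B x / 5 \<le> d" by simp
  qed
  then show ?thesis using b.nrm_nonneg[OF x(1)] b.nrm_eq_0[OF x(1)] by simp
qed

theorem corollary7p10:
  fixes k :: nat
    and G :: "'m cat" and \<Lambda> :: "'m kgraph"
    and L R :: "'m \<Rightarrow> 'm \<Rightarrow> 'm"
    and c :: "'m \<times> 'm \<Rightarrow> 'm \<times> 'm \<Rightarrow> complex"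
    and A :: "'a cstar" and S :: "'m \<times> 'm \<Rightarrow> 'a"
    and B :: "'b cstar" and s :: "'m \<times> 'm \<Rightarrow> 'b"
    and D :: "'d cstar" and w :: "'m \<Rightarrow> 'd"
    and \<iota> :: "'d \<Rightarrow> 'b" and \<pi> :: "'b \<Rightarrow> 'a"
  assumes "self_similar_action k G \<Lambda> L R"
    and "row_finite_no_sources k \<Lambda>"
    and "normalised_cocycle (zappa_szep G \<Lambda> L R) c"
    and "universal_ck_algebra k G \<Lambda> L R c B s"
    and "twisted_groupoid_algebra G (\<lambda>g h. c (from_groupoid G g) (from_groupoid G h)) D w"
    and "star_hom D B \<iota>"
    and "\<forall>g\<in>mor G. \<iota> (w g) = s (from_groupoid G g)"
    and "cstar_algebra A"
    and "ck_family k G \<Lambda> L R c A S"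
    and "star_hom B (A\<lparr>carrier := cstar_generated A (S ` mor (zappa_szep G \<Lambda> L R))\<rparr>) \<pi>"
    and "\<forall>\<zeta>\<in>mor (zappa_szep G \<Lambda> L R). \<pi> (s \<zeta>) = S \<zeta>"
    and "\<exists>\<beta>. strongly_continuous_action k A \<beta> \<and>
           (\<forall>z\<in>torus k. \<forall>\<zeta>\<in>mor (zappa_szep G \<Lambda> L R).
              \<beta> z (S \<zeta>) = torus_power k z (kdeg (zappa_szep G \<Lambda> L R) \<zeta>) \<odot>\<^bsub>A\<^esub> S \<zeta>)"
    and "inj_on \<pi> (\<iota> ` carrier D)"
  shows "inj_on \<pi> (carrier B)"
proof -
  have B: "cstar_algebra B" "ck_family k G \<Lambda> L R c B s" using assms(4) by (auto simp: universal_ck_algebra_def)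
  have D: "cstar_algebra D" "w \<in> mor G \<rightarrow> carrier D"
    using assms(5) by (auto simp: twisted_groupoid_algebra_def unitary_rep_def)
  have repA: "ck_rep k G \<Lambda> L R A c S" and repB: "ck_rep k G \<Lambda> L R B c s"
    using assms B by (auto simp: ck_rep_def ck_rep_axioms_def)
  interpret a: ck_rep k G \<Lambda> L R A c S by (rule repA)
  interpret b: ck_rep k G \<Lambda> L R B c s by (rule repB)
  interpret i: cstar_hom D B \<iota> by (intro cstar_hom.intro cstar_hom_axioms.intro B D assms)
  \<comment> \<open>Shrinking the carrier leaves operations and norm unchanged, so
    \<open>\<pi>\<close> may be read as a map into \<open>A\<close>, where \<open>\<beta>\<close>
    acts.\<close>
  have \<pi>: "star_hom B A \<pi>"
    using assms(10) a.generated_subset_carrier unfolding star_hom_def by (auto simp: Pi_iff)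
  interpret p: cstar_hom B A \<pi> by (intro cstar_hom.intro cstar_hom_axioms.intro B assms \<pi>)
  obtain \<beta> where \<beta>: "strongly_continuous_action k A \<beta>"
    "\<And>z \<zeta>. \<lbrakk>z \<in> torus k; \<zeta> \<in> mor (zappa_szep G \<Lambda> L R)\<rbrakk> \<Longrightarrow> \<beta> z (S \<zeta>) = torus_power k z (kdeg (zappa_szep G \<Lambda> L R) \<zeta>) \<odot>\<^bsub>A\<^esub> S \<zeta>"
    using assms(12) by blast
  let ?J = "\<iota> ` carrier D"
  have core: "ck_core k G \<Lambda> L R B c s ?J"
  proof (intro ck_core.intro ck_core_axioms.intro repB)
    show "x \<oplus>\<^bsub>B\<^esub> y \<in> ?J" "x \<otimes>\<^bsub>B\<^esub> y \<in> ?J" if "x \<in> ?J" "y \<in> ?J" for x y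
      using that by (auto simp flip: i.hom_simps(2,4))
    show "a \<odot>\<^bsub>B\<^esub> x \<in> ?J" "adj B x \<in> ?J" if "x \<in> ?J" for a x
      using that by (auto simp flip: i.hom_simps(3,5))
    show "\<zero>\<^bsub>B\<^esub> \<in> ?J" using i.hom_zero by (metis i.dom.zero_closed imageI)
    show "s (from_groupoid G g) \<in> ?J" if "g \<in> mor G" for g
      using assms(7) D(2) that by (metis PiE imageI)
  qed auto
  \<comment> \<open>Injectivity on \<open>?J\<close> puts the kernel of \<open>\<pi>\<close> after
    \<open>\<iota>\<close> inside the kernel of \<open>\<iota>\<close>, as
    \<open>star_hom_nrm_le_of_kernel\<close> demands.\<close>
  have iso: "nrm B y \<le> nrm A (\<pi> y)" if "y \<in> ?J" for y
  proof -
    obtain x where x: "x \<in> carrier D" "y = \<iota> x" using \<open>y \<in> ?J\<close> by blast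
    have "nrm B (\<iota> x) \<le> nrm A (\<pi> (\<iota> x))"
    proof (rule star_hom_nrm_le_of_kernel[OF D(1) assms(8) B(1) assms(6) star_hom_comp[OF assms(6) \<pi>] _ x(1)])
      fix d assume d: "d \<in> carrier D" "\<pi> (\<iota> d) = \<zero>\<^bsub>A\<^esub>"
      then have "\<pi> (\<iota> d) = \<pi> (\<iota> \<zero>\<^bsub>D\<^esub>)" by simp
      then have "\<iota> d = \<iota> \<zero>\<^bsub>D\<^esub>" using inj_onD[OF assms(13)] d(1) by blast
      then show "\<iota> d = \<zero>\<^bsub>B\<^esub>" by simp
    qed
    then show ?thesis using x by simp
  qed
  show ?thesis
  proof (rule inj_onI)
    fix x y assume x: "x \<in> carrier B" and y: "y \<in> carrier B" and eq: "\<pi> x = \<pi> y"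
    have "x \<ominus>\<^bsub>B\<^esub> y = \<zero>\<^bsub>B\<^esub>"
    proof (rule gauge_invariant_uniqueness[OF core repA assms(4) \<pi> _ _ \<beta>(2) iso])
      show "star_hom A A (\<beta> z)" if "z \<in> torus k" for z
        using \<beta>(1) that by (simp add: strongly_continuous_action_def star_aut_def)
      show "\<pi> (x \<ominus>\<^bsub>B\<^esub> y) = \<zero>\<^bsub>A\<^esub>" using x y eq by simp
    qed (use assms(11) x y in auto)
    then show "x = y" using x y by (simp add: b.diff_eq_zero_iff)
  qed
qed

end
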